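(* Let $n\ge 2$, let $\Gamma$ be an $n$-dimensional Bieberbach group with translation lattice $\Lambda$ and holonomy group $F\simeq\Lambda\backslash\Gamma\subset \mathrm{SO}(n)$, and suppose $M_\Gamma=\Gamma\backslash\mathbb R^n$ is endowed with a spin structure $\varepsilon$. Let $\rho:\Gamma\to \mathrm U(V)$ be a finite dimensional unitary representation with $\rho|_\Lambda=\mathrm{Id}$. For $\gamma=BL_b\in\Gamma$ and $\mu>0$ put $$(\Lambda^*_{\varepsilon,\mu})^B=\{u\in\Lambda^*_{\varepsilon,\mu}: Bu=u\},\qquad e_{\mu,\gamma}(\delta_\varepsilon)=\sum_{u\in(\Lambda^*_{\varepsilon,\mu})^B}e^{-2\pi i\,u\cdot b}.$$ (1) If $n$ is even then, for each $\mu>0$, the multiplicity of the eigenvalue $\pm2\pi\mu$ of the twisted Dirac operator $D_\rho$ is $$d^{\pm}_{\rho,\mu}(\Gamma,\varepsilon)=\frac1{|F|}\sum_{\gamma\in\Lambda\backslash\Gamma}\chi_\rho(\gamma)\,e_{\mu,\gamma}(\delta_\varepsilon)\,\chi_{L_{n-1}}(x_\gamma).$$ (2) If $n$ is odd then, for each $\mu>0$, $$d^{\pm}_{\rho,\mu}(\Gamma,\varepsilon)=\frac1{|F|}\Big(\sum_{\substack{\gamma=BL_b\in\Lambda\backslash\Gamma\\ B\notin F_1}}\chi_\rho(\gamma)\,e_{\mu,\gamma}(\delta_\varepsilon)\,\chi_{L^{\pm}_{n-1}}(x_\gamma)+\sum_{\substack{\gamma=BL_b\in\Lambda\backslash\Gamma\\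 B\in F_1}}\chi_\rho(\gamma)\sum_{u\in(\Lambda^*_{\varepsilon,\mu})^B}e^{-2\pi i\,u\cdot b}\,\chi_{L_{n-1}^{\pm\sigma(u,x_\gamma)}}(x_\gamma)\Big).$$ (3) Let $\mu=0$. If $\varepsilon|_\Lambda\ne1$ then $d_{\rho,0}(\Gamma,\varepsilon)=0$. If $\varepsilon|_\Lambda=1$ then $$d_{\rho,0}(\Gamma,\varepsilon)=\frac1{|F|}\sum_{\gamma\in\Lambda\backslash\Gamma}\chi_\rho(\gamma)\,\chi_{L_n}(\varepsilon(\gamma))=\dim(\mathrm S\otimes V)^F,$$ where $F\simeq\Lambda\backslash\Gamma$ acts on $\mathrm S\otimes V$ by $\gamma\mapsto L(\varepsilon(\gamma))\otimes\rho(\gamma)$. Moreover, in (1) and (2) each summand (indexed by $\gamma\in\Lambda\backslash\Gamma$) is independent of the representative $\gamma$ modulo $\Lambda$ and of the choice of $x_\gamma$.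
   Context: Bieberbach groups. $L_b$ is translation by $b\in\mathbb R^n$, and $BL_b$ ($B\in\mathrm O(n)$) is the isometry $x\mapsto B(x+b)$. A Bieberbach group is a discrete, cocompact, torsion-free subgroup $\Gamma$ of the isometry group of $\mathbb R^n$; $M_\Gamma=\Gamma\backslash\mathbb R^n$ is a compact flat manifold. $\Lambda=\{\lambda:L_\lambda\in\Gamma\}$ is its translation lattice (identified with the normal subgroup of translations), $r(BL_b)=B$, and $F=r(\Gamma)\simeq\Lambda\backslash\Gamma$ is the (finite) holonomy group. $M_\Gamma$ is assumed orientable, i.e. $F\subset\mathrm{SO}(n)$. For $B\in F$, $n_B=\dim\ker(B-\mathrm{Id})$, and $F_1=\{B\in F:n_B=1\}$. Spin groups. $Cl(n)$ is the Clifford algebra with $vw+wv=-2\langle v,w\rangle$, $\{e_i\}$ the canonical basis of $\mathbb R^n$, $\mathrm{Spin}(n)=\{v_1\cdots v_k:\|v_j\|=1,\ k\text{ even}\}$, $\mu:\mathrm{Spin}(n)\to\mathrm{SO}(n)$, $\mu(g)(x)=gxg^{-1}$, the double cover. $\mathrm{Spin}(n-1)\subset\mathrm{Spin}(n)$ is the subgroup fixing $e_n$. The maximal torus of $\mathrm{Spin}(N)$ is $T=\{x(t_1,\dots,t_{[N/2]})\}$, $x(t_1,\dots,t_q)=\prod_{j=1}^{q}(\cos t_j+\sin t_j\,e_{2j-1}e_{2j})$ (for $N=1$, $\mathrm{Spin}(1)=\{\pm1\}$ and $T=\{\pm 1\}$). Spin representations. $m=[n/2]$. $(L,\mathrm S)=(L_n,\mathrm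 S_n)$ is an irreducible complex representation of $Cl(n)\otimes\mathbb C$, of dimension $2^m$, restricted to $\mathrm{Spin}(n)$. For $N=2q$ even, $\mathrm S_N=\mathrm S_N^+\oplus \mathrm S_N^-$, where $\mathrm S_N^\pm$ (half-spin representations $L_N^\pm$) is the subspace on which $e_1e_2\cdots e_{2q}$ acts by $\pm i^q$. For $n$ odd, the $Cl(n)$-module $\mathrm S_n$ (whose restriction to $\mathrm{Spin}(n-1)$ is $\mathrm S_{n-1}^+\oplus \mathrm S_{n-1}^-$) is the one in which $L(e_n)$ acts by $\mp i$ on $\mathrm S_{n-1}^\pm$. $\chi$ denotes characters. Spin structures and Dirac operator. Spin structures on $M_\Gamma$ correspond to homomorphisms $\varepsilon:\Gamma\to\mathrm{Spin}(n)$ with $\mu\circ\varepsilon=r$. Put $\delta_\varepsilon(\lambda)=\varepsilon(L_\lambda)\in\{\pm1\}$ for $\lambda\in\Lambda$. For $\mu\ge0$, $\Lambda^*_{\varepsilon,\mu}=\{u\in\mathbb R^n:\|u\|=\mu,\ \delta_\varepsilon(\lambda)=e^{2\pi i\,u\cdot\lambda}\ \forall\lambda\in\Lambda\}$. The twisted Dirac operator $D_\rho$ acts on smooth $f:\mathbb R^n\to \mathrm S\otimes V$ satisfying $f(\gamma x)=(L(\varepsilon(\gamma))\otimes\rho(\gamma))f(x)$ for all $\gamma\in\Gamma$ (these are the sections of the twisted spinor bundle over $M_\Gamma$), by $D_\rho f=\sum_{i=1}^n(L(e_i)\otimes\mathrm{Id})\,\partial f/\partial x_i$. $d^\pm_{\rho,\mu}(\Gamma,\varepsilon)$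 is the multiplicity (dimension of the eigenspace, possibly $0$) of $\pm2\pi\mu$ for $\mu>0$, and $d_{\rho,0}(\Gamma,\varepsilon)=\dim\ker D_\rho$. The element $x_\gamma$ and the sign $\sigma$. For $\gamma=BL_b\in\Gamma$, $x_\gamma$ is a fixed element of the maximal torus of $\mathrm{Spin}(n-1)$ that is conjugate in $\mathrm{Spin}(n)$ to $\varepsilon(\gamma)$. For $u\neq0$ with $Bu=u$, choose $h_u\in\mathrm{Spin}(n)$ with $h_uuh_u^{-1}=\|u\|e_n$; then $h_u\varepsilon(\gamma)h_u^{-1}\in\mathrm{Spin}(n-1)$. Put $\sigma(u,x_\gamma)=1$ if $h_u\varepsilon(\gamma)h_u^{-1}$ is conjugate to $x_\gamma$ in $\mathrm{Spin}(n-1)$ and $\sigma(u,x_\gamma)=-1$ otherwise (this is independent of the choice of $h_u$). $L_{n-1}^{\pm\sigma}$ means $L_{n-1}^{\pm}$ if $\sigma=1$ and $L_{n-1}^{\mp}$ if $\sigma=-1$. *)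

theory Defs
  imports
    "HOL-Analysis.Analysis"
    "HOL-Algebra.Coset"
    "HOL-Library.Function_Algebras"
begin

type_synonym 'n rvec = "real ^ 'n"
type_synonym 'n rmat = "real ^ 'n ^ 'n"

section \<open>The Clifford algebra\<close>

text \<open>
  The dimension is the cardinality of a finite linearly ordered index type \<open>'n\<close>;
  the order is what gives a meaning to \<open>e\<^sub>1, \<dots>, e\<^sub>n\<close>. The Clifford algebra
  of \<open>\<real>\<^sup>n\<close> is realised on its standard basis \<open>e\<^sub>I = e\<^sub>i\<^sub>1 \<cdots> e\<^sub>i\<^sub>k\<close>
  (\<open>I = {i\<^sub>1 < \<dots> < i\<^sub>k}\<close>): an element is its family of coordinates. Multiplying,
  \<open>e\<^sub>I e\<^sub>J = s(I,J) e\<^sub>K\<close> with \<open>K\<close> the symmetric difference of \<open>I\<close> and \<open>J\<close>;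
  sorting gives a factor \<open>-1\<close> for every \<open>(i,j) \<in> I \<times> J\<close> with \<open>j < i\<close>, and
  \<open>e\<^sub>i e\<^sub>i = -1\<close> another one for every \<open>i = j\<close>.
\<close>

definition sdiff :: "'a set \<Rightarrow> 'a set \<Rightarrow> 'a set" where
  "sdiff I J = (I - J) \<union> (J - I)"

definition csgn :: "'n::{finite,linorder} set \<Rightarrow> 'n set \<Rightarrow> real" where
  "csgn I J = (\<Prod>i\<in>I. \<Prod>j\<in>J. if j \<le> i then -1 else 1)"

typedef 'n cliff = "UNIV :: ('n set \<Rightarrow> real) set"
  morphisms coord Cliff ..

setup_lifting type_definition_cliff

instantiation cliff :: ("{finite,linorder}") real_algebra_1
begin

lift_definition zero_cliff :: "'a cliff" is "\<lambda>_. 0" .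
lift_definition one_cliff :: "'a cliff" is "\<lambda>K. if K = {} then 1 else 0" .
lift_definition plus_cliff :: "'a cliff \<Rightarrow> 'a cliff \<Rightarrow> 'a cliff" is "\<lambda>a b K. a K + b K" .
lift_definition minus_cliff :: "'a cliff \<Rightarrow> 'a cliff \<Rightarrow> 'a cliff" is "\<lambda>a b K. a K - b K" .
lift_definition uminus_cliff :: "'a cliff \<Rightarrow> 'a cliff" is "\<lambda>a K. - a K" .
lift_definition scaleR_cliff :: "real \<Rightarrow> 'a cliff \<Rightarrow> 'a cliff" is "\<lambda>c a K. c * a K" .
lift_definition times_cliff :: "'a cliff \<Rightarrow> 'a cliff \<Rightarrow> 'a cliff" is
  "\<lambda>a b K. \<Sum>I\<in>UNIV. csgn I (sdiff I K) * a I * b (sdiff I K)" .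

instance
proof
  have sd [simp]: "sdiff I (sdiff I K) = K" "sdiff {} K = K" "sdiff K {} = K" "sdiff K K = {}"
    for I K :: "'a set" by (auto simp: sdiff_def)
  have sd_assoc: "sdiff (sdiff I J) K = sdiff I (sdiff J K)" for I J K :: "'a set"
    by (auto simp: sdiff_def)
  have sd_comm: "sdiff I J = sdiff J I" for I J :: "'a set" by (auto simp: sdiff_def)
  have pm: "(\<Prod>i\<in>sdiff I J. f i) = (\<Prod>i\<in>I. f i) * (\<Prod>i\<in>J. f i :: real)"
    if f: "\<And>i. f i * f i = 1" for I J :: "'a set" and f
  proof -
    have 1: "(\<Prod>i\<in>A. f i) * (\<Prod>i\<in>A. f i) = 1" for A :: "'a set"
      by (simp add: f flip: prod.distrib)
    have "prod f I = prod f (I - J) * prod f (I \<inter> J)" for I J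
      by (subst prod.union_disjoint[symmetric]) (auto intro!: prod.cong)
    note 2 = this
    have "prod f I * prod f J = prod f (I - J) * prod f (J - I) * (prod f (I \<inter> J) * prod f (I \<inter> J))"
      unfolding 2[of I J] 2[of J I] by (simp add: Int_commute)
    also have "\<dots> = prod f (I - J) * prod f (J - I)" by (simp add: 1)
    also have "\<dots> = prod f (sdiff I J)" unfolding sdiff_def
      by (subst prod.union_disjoint) auto
    finally show ?thesis by simp
  qed
  have sq: "(\<Prod>j\<in>J. if j \<le> i then -1 else 1::real) * (\<Prod>j\<in>J. if j \<le> i then -1 else 1) = 1"
    for J and i :: 'a
    by (subst prod.distrib[symmetric]) (rule prod.neutral, auto)
  have cl: "csgn (sdiff I J) K = csgn I K * csgn J K" for I J K :: "'a set"
    unfolding csgn_def by (rule pm[OF sq])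
  have cr: "csgn I (sdiff J K) = csgn I J * csgn I K" for I J K :: "'a set"
    unfolding csgn_def prod.distrib[symmetric] by (intro prod.cong refl pm) auto
  have ce [simp]: "csgn {} K = 1" "csgn K {} = 1" for K :: "'a set"
    by (simp_all add: csgn_def)
  fix a b c :: "'a cliff" and r s :: real
  show "a + b + c = a + (b + c)" by transfer (simp add: fun_eq_iff)
  show "a + b = b + a" by transfer (simp add: fun_eq_iff)
  show "0 + a = a" by transfer simp
  show "- a + a = 0" by transfer simp
  show "a - b = a + - b" by transfer simp
  show "r *\<^sub>R (a + b) = r *\<^sub>R a + r *\<^sub>R b" by transfer (simp add: fun_eq_iff algebra_simps)
  show "(r + s) *\<^sub>R a = r *\<^sub>R a + s *\<^sub>R a" by transfer (simp add: fun_eq_iff algebra_simps)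
  show "r *\<^sub>R s *\<^sub>R a = (r * s) *\<^sub>R a" by transfer (simp add: fun_eq_iff algebra_simps)
  show "1 *\<^sub>R a = a" by transfer simp
  show "(a + b) * c = a * c + b * c"
    by transfer (simp add: fun_eq_iff algebra_simps sum.distrib)
  show "a * (b + c) = a * b + a * c"
    by transfer (simp add: fun_eq_iff algebra_simps sum.distrib)
  show "r *\<^sub>R a * b = r *\<^sub>R (a * b)"
    by transfer (simp add: fun_eq_iff algebra_simps sum_distrib_left)
  show "a * r *\<^sub>R b = r *\<^sub>R (a * b)"
    by transfer (simp add: fun_eq_iff algebra_simps sum_distrib_left)
  show "1 * a = a"
  proof (transfer, rule ext)
    fix a :: "'a set \<Rightarrow> real" and K :: "'a set"
    have "(\<Sum>I\<in>UNIV. csgn I (sdiff I K) * (if I = {} then 1 else 0) * a (sdiff I K))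
        = (\<Sum>I\<in>{{}}. csgn I (sdiff I K) * a (sdiff I K))"
      by (rule sum.mono_neutral_cong_right) auto
    then show "(\<Sum>I\<in>UNIV. csgn I (sdiff I K) * (if I = {} then 1 else 0) * a (sdiff I K)) = a K"
      by simp
  qed
  show "a * 1 = a"
  proof (transfer, rule ext)
    fix a :: "'a set \<Rightarrow> real" and K :: "'a set"
    have "(sdiff I K = {}) = (I = K)" for I by (auto simp: sdiff_def)
    then have "(\<Sum>I\<in>UNIV. csgn I (sdiff I K) * a I * (if sdiff I K = {} then 1 else 0))
        = (\<Sum>I\<in>{K}. a I)"
      by (intro sum.mono_neutral_cong_right) auto
    then show "(\<Sum>I\<in>UNIV. csgn I (sdiff I K) * a I * (if sdiff I K = {} then 1 else 0)) = a K"
      by simp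
  qed
  show "(0::'a cliff) \<noteq> 1" by transfer (auto simp: fun_eq_iff)
  show "a * b * c = a * (b * c)"
  proof (transfer, rule ext)
    fix a b c :: "'a set \<Rightarrow> real" and K :: "'a set"
    have re: "(\<Sum>J\<in>UNIV. g J) = (\<Sum>J\<in>UNIV. g (sdiff I J))" for g :: "'a set \<Rightarrow> real" and I
      by (rule sum.reindex_bij_witness[of _ "sdiff I" "sdiff I"]) auto
    have "(\<Sum>J\<in>UNIV. csgn J (sdiff J K) * (\<Sum>I\<in>UNIV. csgn I (sdiff I J) * a I * b (sdiff I J)) * c (sdiff J K))
      = (\<Sum>I\<in>UNIV. \<Sum>J\<in>UNIV. csgn J (sdiff J K) * csgn I (sdiff I J) * a I * b (sdiff I J) * c (sdiff J K))"
      by (subst sum.swap) (simp add: sum_distrib_left sum_distrib_right mult.assoc)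
    also have "\<dots> = (\<Sum>I\<in>UNIV. \<Sum>J\<in>UNIV. csgn (sdiff I J) (sdiff (sdiff I J) K) * csgn I J * a I * b J
                      * c (sdiff (sdiff I J) K))"
    proof (rule sum.cong[OF refl])
      fix I :: "'a set"
      show "(\<Sum>J\<in>UNIV. csgn J (sdiff J K) * csgn I (sdiff I J) * a I * b (sdiff I J) * c (sdiff J K))
          = (\<Sum>J\<in>UNIV. csgn (sdiff I J) (sdiff (sdiff I J) K) * csgn I J * a I * b J
                      * c (sdiff (sdiff I J) K))"
        by (subst re[of _ I]) simp
    qed
    also have "\<dots> = (\<Sum>I\<in>UNIV. \<Sum>J\<in>UNIV. csgn I (sdiff I K) * a I *
                      (csgn J (sdiff J (sdiff I K)) * b J * c (sdiff J (sdiff I K))))"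
    proof (intro sum.cong refl)
      fix I J :: "'a set"
      have 1: "sdiff (sdiff I J) K = sdiff J (sdiff I K)" by (auto simp: sdiff_def)
      have "csgn I J * csgn I J = 1"
        unfolding csgn_def by (subst prod.distrib[symmetric]) (rule prod.neutral, use sq in auto)
      then have "csgn (sdiff I J) (sdiff J (sdiff I K)) * csgn I J
          = csgn I (sdiff I K) * csgn J (sdiff J (sdiff I K))"
        by (simp add: cl cr algebra_simps)
      then show "csgn (sdiff I J) (sdiff (sdiff I J) K) * csgn I J * a I * b J * c (sdiff (sdiff I J) K)
        = csgn I (sdiff I K) * a I * (csgn J (sdiff J (sdiff I K)) * b J * c (sdiff J (sdiff I K)))"
        unfolding 1 by (simp add: algebra_simps)
    qed
    finally show "(\<Sum>J\<in>UNIV. csgn J (sdiff J K) * (\<Sum>I\<in>UNIV. csgn I (sdiff I J) * a I * b (sdiff I J)) * c (sdiff J K))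
      = (\<Sum>I\<in>UNIV. csgn I (sdiff I K) * a I *
           (\<Sum>J\<in>UNIV. csgn J (sdiff J (sdiff I K)) * b J * c (sdiff J (sdiff I K))))"
      by (simp add: sum_distrib_left mult.assoc)
  qed
qed

end


lift_definition cbasis :: "'n::{finite,linorder} set \<Rightarrow> 'n cliff" is
  "\<lambda>I K. if K = I then 1 else 0" .

definition cvec :: "'n::{finite,linorder} rvec \<Rightarrow> 'n cliff" where
  "cvec v = (\<Sum>i\<in>UNIV. v $ i *\<^sub>R cbasis {i})"

lemma linear_cvec: "linear cvec"
  by (rule linearI)
    (simp_all add: cvec_def scaleR_add_left sum.distrib scaleR_sum_right)

lemma cbasis_mult: "cbasis I * cbasis J = csgn I J *\<^sub>R cbasis (sdiff I J)"
proof (transfer, rule ext)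
  fix I J K :: "'a set"
  have 1: "(sdiff I K = J) = (K = sdiff I J)" by (auto simp: sdiff_def)
  have "(\<Sum>I'\<in>UNIV. csgn I' (sdiff I' K) * (if I' = I then 1 else 0) * (if sdiff I' K = J then 1 else 0))
      = (\<Sum>I'\<in>{I}. csgn I' (sdiff I' K) * (if sdiff I' K = J then 1 else 0))"
    by (rule sum.mono_neutral_cong_right) auto
  also have "\<dots> = csgn I J * (if K = sdiff I J then 1 else 0)"
    using 1 by auto
  finally show "(\<Sum>I'\<in>UNIV. csgn I' (sdiff I' K) * (if I' = I then 1 else 0) * (if sdiff I' K = J then 1 else 0))
    = csgn I J * (if K = sdiff I J then 1 else 0)" .
qed

lemma cvec_axis [simp]: "cvec (axis i 1) = cbasis {i}"
proof -
  have "cvec (axis i 1) = (\<Sum>j\<in>{i}. cbasis {j})"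
    unfolding cvec_def by (rule sum.mono_neutral_cong_right) (auto simp: axis_def)
  then show ?thesis by simp
qed

lemma clifford_relation: "cvec v * cvec w + cvec w * cvec v = of_real (- 2 * (v \<bullet> w))"
proof -
  have e: "cbasis {} = (1 :: 'a cliff)" by transfer (simp add: fun_eq_iff)
  have b: "cbasis {i} * cbasis {j} + cbasis {j} * cbasis {i} = of_real (if i = j then - 2 else 0)"
    for i j :: 'a
  proof (cases "i = j")
    case True
    then show ?thesis
      by (simp add: cbasis_mult csgn_def sdiff_def e)
  next
    case False
    have "csgn {i} {j} = - csgn {j} {i}" using False by (auto simp: csgn_def)
    moreover have "sdiff {i} {j} = sdiff {j} {i}" by (auto simp: sdiff_def)
    ultimately show ?thesis using False by (simp add: cbasis_mult)
  qed
  have 1: "cvec v * cvec w = (\<Sum>i\<in>UNIV. \<Sum>j\<in>UNIV. (v $ i * w $ j) *\<^sub>R (cbasis {i} * cbasis {j}))"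
    by (simp add: cvec_def sum_product mult.commute)
  have 2: "cvec w * cvec v = (\<Sum>i\<in>UNIV. \<Sum>j\<in>UNIV. (v $ i * w $ j) *\<^sub>R (cbasis {j} * cbasis {i}))"
    by (subst sum.swap) (simp add: cvec_def sum_product mult.commute)
  have "cvec v * cvec w + cvec w * cvec v
      = (\<Sum>i\<in>UNIV. \<Sum>j\<in>UNIV. (v $ i * w $ j) *\<^sub>R of_real (if i = j then - 2 else 0))"
    unfolding 1 2 by (simp only: sum.distrib[symmetric] scaleR_add_right[symmetric] b)
  also have "\<dots> = (\<Sum>i\<in>UNIV. of_real (- 2 * (v $ i * w $ i)))"
  proof (rule sum.cong[OF refl])
    fix i
    have "(\<Sum>j\<in>UNIV. (v $ i * w $ j) *\<^sub>R (of_real (if i = j then - 2 else 0) :: 'a cliff))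
        = (\<Sum>j\<in>{i}. of_real (- 2 * (v $ i * w $ j)))"
      by (rule sum.mono_neutral_cong_right) (auto simp: of_real_def)
    then show "(\<Sum>j\<in>UNIV. (v $ i * w $ j) *\<^sub>R (of_real (if i = j then - 2 else 0) :: 'a cliff))
        = of_real (- 2 * (v $ i * w $ i))" by simp
  qed
  also have "\<dots> = of_real (- 2 * (v \<bullet> w))"
    unfolding of_real_sum[symmetric] by (simp add: inner_vec_def sum_distrib_left)
  finally show ?thesis .
qed

lemma cbasis_eq_prod:
  "cbasis I = prod_list (map (\<lambda>i. cvec (axis i 1)) (sorted_list_of_set I))"
proof -
  have "sorted_wrt (<) xs \<Longrightarrow> cbasis (set xs) = prod_list (map (\<lambda>i. cvec (axis i 1)) xs)" for xs :: "'a list"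
  proof (induction xs)
    case Nil
    show ?case by simp (transfer, simp add: fun_eq_iff)
  next
    case (Cons x xs)
    have "sdiff {x} (set xs) = set (x # xs)" using Cons.prems by (auto simp: sdiff_def)
    moreover have "csgn {x} (set xs) = 1"
      unfolding csgn_def using Cons.prems by (auto intro!: prod.neutral)
    ultimately have "cbasis (set (x # xs)) = cbasis {x} * cbasis (set xs)"
      by (simp add: cbasis_mult)
    with Cons show ?case by simp
  qed
  from this[of "sorted_list_of_set I"] show ?thesis by simp
qed

definition eb :: "nat \<Rightarrow> 'n::{finite,linorder} rvec" where
  "eb j = axis (sorted_list_of_set UNIV ! (j - 1)) 1"

text \<open>\<open>cl N\<close> is the subalgebra generated by \<open>e\<^sub>1, \<dots>, e\<^sub>N\<close>, for \<open>N \<le> n\<close> a copy of \<open>Cl(N)\<close>.\<close>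

definition cl :: "nat \<Rightarrow> 'n::{finite,linorder} cliff set" where
  "cl N = span {prod_list (map cvec vs) | vs. set vs \<subseteq> eb ` {1..N}}"

definition cinv :: "'n::{finite,linorder} cliff \<Rightarrow> 'n cliff" where
  "cinv a = (THE b. a * b = 1 \<and> b * a = 1)"

section \<open>Spin groups\<close>

definition spin :: "'n::{finite,linorder} cliff set" where
  "spin = {prod_list (map cvec vs) | vs. even (length vs) \<and> (\<forall>v\<in>set vs. norm v = 1)}"

definition spin_group :: "'n::{finite,linorder} cliff monoid" where
  "spin_group = \<lparr>carrier = spin, mult = (*), one = 1\<rparr>"

definition mu :: "'n::{finite,linorder} cliff \<Rightarrow> 'n rmat" where
  "mu g = (THE B. \<forall>x. cvec (B *v x) = g * cvec x * cinv g)"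

lemma cvec_inject: "cvec v = cvec w \<longleftrightarrow> v = w"
proof
  assume eq: "cvec v = cvec w"
  have c: "coord (\<Sum>i\<in>A. f i) K = (\<Sum>i\<in>A. coord (f i) K)"
    for f :: "'a \<Rightarrow> 'a cliff" and A K
    by (induction A rule: infinite_finite_induct) (simp_all add: zero_cliff.rep_eq plus_cliff.rep_eq)
  have "coord (cvec u) {i} = u $ i" for u :: "'a rvec" and i
  proof -
    have "coord (cvec u) {i} = (\<Sum>j\<in>UNIV. u $ j * (if {i} = {j} then 1 else 0))"
      unfolding cvec_def c by (rule sum.cong[OF refl], transfer, simp)
    also have "\<dots> = (\<Sum>j\<in>{i}. u $ j)"
      by (rule sum.mono_neutral_cong_right) auto
    finally show ?thesis by simp
  qed
  then show "v = w" using eq by (metis vec_eq_iff)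
qed simp

lemma cinv_eqI: "a * b = 1 \<Longrightarrow> b * a = 1 \<Longrightarrow> cinv a = b"
  unfolding cinv_def by (rule the_equality) (simp, metis mult.assoc mult.left_neutral mult.right_neutral)

lemma cvec_unit_sq: "norm v = 1 \<Longrightarrow> cvec v * cvec v = - 1"
proof -
  assume "norm v = 1"
  then have "(2::real) *\<^sub>R (cvec v * cvec v) = 2 *\<^sub>R (- 1)"
    using clifford_relation[of v v]
    by (simp add: dot_square_norm scaleR_2)
  then show ?thesis by (simp only: scaleR_cancel_left) simp
qed

lemma mu_spin:
  assumes "g \<in> spin"
  shows "cvec (mu g *v x) = g * cvec x * cinv g"
proof -
  obtain vs where g: "g = prod_list (map cvec vs)" and vs: "\<forall>v\<in>set vs. norm v = 1"
    using assms by (auto simp: spin_def)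
  have "\<exists>h B. prod_list (map cvec vs) * h = 1 \<and> h * prod_list (map cvec vs) = 1 \<and>
          (\<forall>x. cvec (B *v x) = prod_list (map cvec vs) * cvec x * h)"
    using vs
  proof (induction vs)
    case Nil
    show ?case by (rule exI[of _ 1], rule exI[of _ "mat 1"]) simp
  next
    case (Cons v vs)
    let ?p = "prod_list (map cvec vs)"
    obtain h B where hB: "?p * h = 1" "h * ?p = 1" "\<And>x. cvec (B *v x) = ?p * cvec x * h"
      using Cons by auto
    have sq: "cvec v * cvec v = - 1" using Cons.prems by (simp add: cvec_unit_sq)
    define R where "R = matrix (\<lambda>x. (2 * (v \<bullet> x)) *\<^sub>R v - x)"
    have "linear (\<lambda>x. (2 * (v \<bullet> x)) *\<^sub>R v - x)"
      by (rule linearI) (simp_all add: inner_add_right algebra_simps)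
    then have R: "R *v x = (2 * (v \<bullet> x)) *\<^sub>R v - x" for x
      by (simp add: R_def matrix_works)
    have conj: "cvec (R *v x) = cvec v * cvec x * - cvec v" for x
    proof -
      have eq: "cvec v * cvec x = of_real (- 2 * (v \<bullet> x)) - cvec x * cvec v"
        using clifford_relation[of v x] by (simp add: algebra_simps)
      have "cvec v * cvec x * - cvec v = - ((cvec v * cvec x) * cvec v)" by simp
      also have "\<dots> = - ((of_real (- 2 * (v \<bullet> x)) - cvec x * cvec v) * cvec v)"
        by (simp only: eq)
      also have "\<dots> = (2 * (v \<bullet> x)) *\<^sub>R cvec v + cvec x * (cvec v * cvec v)"
        by (simp add: algebra_simps scaleR_conv_of_real)
      also have "\<dots> = cvec (R *v x)"
        by (simp add: R sq linear_diff[OF linear_cvec] linear_scale[OF linear_cvec])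
      finally show ?thesis by simp
    qed
    have "(cvec v * ?p) * (h * - cvec v) = cvec v * (?p * h) * - cvec v"
      by (simp add: mult.assoc)
    then have a: "(cvec v * ?p) * (h * - cvec v) = 1" by (simp add: hB sq)
    have "(h * - cvec v) * (cvec v * ?p) = h * (- (cvec v * cvec v)) * ?p"
      by (simp add: mult.assoc)
    then have b: "(h * - cvec v) * (cvec v * ?p) = 1" by (simp add: hB sq)
    have c: "cvec ((R ** B) *v x) = (cvec v * ?p) * cvec x * (h * - cvec v)" for x
    proof -
      have "cvec ((R ** B) *v x) = cvec (R *v (B *v x))"
        by (simp only: matrix_vector_mul_assoc)
      also have "\<dots> = cvec v * (?p * cvec x * h) * - cvec v"
        by (simp only: conj hB(3))
      finally show ?thesis by (simp only: mult.assoc)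
    qed
    show ?case
      by (rule exI[of _ "h * - cvec v"], rule exI[of _ "R ** B"]) (use a b c in simp)
  qed
  then obtain h B where hB: "g * h = 1" "h * g = 1" "\<And>x. cvec (B *v x) = g * cvec x * h"
    unfolding g by blast
  then have "cinv g = h" by (intro cinv_eqI)
  then have B: "\<forall>x. cvec (B *v x) = g * cvec x * cinv g" using hB by simp
  have "B' = B" if "\<forall>x. cvec (B' *v x) = g * cvec x * cinv g" for B'
  proof -
    have "cvec (B' *v x) = cvec (B *v x)" for x using that B by simp
    then show ?thesis by (simp add: cvec_inject matrix_eq)
  qed
  with B have "mu g = B" unfolding mu_def by (intro the_equality) blast+
  with B show ?thesis by simp
qed

text \<open>\<open>Spin(n - 1)\<close>, as the stabiliser of \<open>e\<^sub>n\<close>.\<close>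

definition spin1 :: "'n::{finite,linorder} cliff set" where
  "spin1 = {g \<in> spin. mu g *v eb CARD('n) = eb CARD('n)}"

definition conj_in :: "'n::{finite,linorder} cliff set \<Rightarrow> 'n cliff \<Rightarrow> 'n cliff \<Rightarrow> bool" where
  "conj_in G a b \<longleftrightarrow> (\<exists>g\<in>G. b = g * a * cinv g)"

definition torus_elt :: "nat \<Rightarrow> (nat \<Rightarrow> real) \<Rightarrow> 'n::{finite,linorder} cliff" where
  "torus_elt q t = prod_list (map (\<lambda>j. of_real (cos (t j))
      + sin (t j) *\<^sub>R (cvec (eb (2 * j - 1)) * cvec (eb (2 * j)))) [1..<q + 1])"

definition torus :: "nat \<Rightarrow> 'n::{finite,linorder} cliff set" where
  "torus N = (if N = 1 then {1, - 1} else range (torus_elt (N div 2)))"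

section \<open>Spin representations\<close>

text \<open>
  A complex representation of \<open>Cl(N) \<otimes> \<complex>\<close> on \<open>\<complex>\<^sup>s\<close> is a homomorphism
  of unital real algebras from \<open>Cl(N)\<close> to the complex \<open>s \<times> s\<close> matrices.
\<close>

definition cl_rep :: "nat \<Rightarrow> ('n::{finite,linorder} cliff \<Rightarrow> complex ^ 's ^ 's) \<Rightarrow> bool" where
  "cl_rep N L \<longleftrightarrow> L 1 = mat 1 \<and>
     (\<forall>a\<in>cl N. \<forall>b\<in>cl N. L (a + b) = L a + L b \<and> L (a * b) = L a ** L b) \<and>
     (\<forall>a\<in>cl N. \<forall>c. L (c *\<^sub>R a) = c *\<^sub>R L a)"

definition irreducible_rep :: "nat \<Rightarrow> ('n::{finite,linorder} cliff \<Rightarrow> complex ^ 's ^ 's) \<Rightarrow> bool" where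
  "irreducible_rep N L \<longleftrightarrow>
     (\<forall>W. vec.subspace W \<and> (\<forall>a\<in>cl N. \<forall>w\<in>W. L a *v w \<in> W) \<longrightarrow> W = {0} \<or> W = UNIV)"

text \<open>Signs are passed as a real parameter \<open>s\<close> with value \<open>1\<close> or \<open>-1\<close>. For even \<open>N\<close>,
  \<open>half_spin N s L\<close> is the half-spin space \<open>S\<^sub>N\<^sup>\<plusminus>\<close>.\<close>

definition half_spin :: "nat \<Rightarrow> real \<Rightarrow> ('n::{finite,linorder} cliff \<Rightarrow> complex ^ 's ^ 's)
    \<Rightarrow> (complex ^ 's) set" where
  "half_spin N s L = {w. L (prod_list (map (\<lambda>j. cvec (eb j)) [1..<N + 1])) *v w
                         = (of_real s * \<i> ^ (N div 2)) *s w}"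

definition spin_rep :: "nat \<Rightarrow> ('n::{finite,linorder} cliff \<Rightarrow> complex ^ 's ^ 's) \<Rightarrow> bool" where
  "spin_rep N L \<longleftrightarrow> cl_rep N L \<and> irreducible_rep N L \<and> CARD('s) = 2 ^ (N div 2) \<and>
     (odd N \<longrightarrow> (\<forall>s\<in>{1, -1}. \<forall>w\<in>half_spin (N - 1) s L.
         L (cvec (eb N)) *v w = (- of_real s * \<i>) *s w))"

text \<open>The trace of an endomorphism of a subspace, computed in an arbitrary basis of it.\<close>

definition trace_on :: "(complex ^ 's) set \<Rightarrow> (complex ^ 's \<Rightarrow> complex ^ 's) \<Rightarrow> complex" where
  "trace_on W f = (let B = (SOME B. vec.independent B \<and> vec.span B = W)
                   in \<Sum>b\<in>B. vec.representation B (f b) b)"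

definition chi :: "('n::{finite,linorder} cliff \<Rightarrow> complex ^ 's ^ 's) \<Rightarrow> 'n cliff \<Rightarrow> complex" where
  "chi L g = trace (L g)"

definition chi_half :: "nat \<Rightarrow> real \<Rightarrow> ('n::{finite,linorder} cliff \<Rightarrow> complex ^ 's ^ 's)
    \<Rightarrow> 'n cliff \<Rightarrow> complex" where
  "chi_half N s L g = trace_on (half_spin N s L) (\<lambda>w. L g *v w)"

section \<open>Bieberbach groups\<close>

type_synonym 'n isometry = "'n rvec \<Rightarrow> 'n rvec"

definition isom :: "'n::finite isometry monoid" where
  "isom = \<lparr>carrier = {f. \<forall>x y. dist (f x) (f y) = dist x y}, mult = (\<circ>), one = id\<rparr>"

definition transl :: "'n rvec \<Rightarrow> 'n::finite isometry" where
  "transl b = (\<lambda>x. x + b)"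

definition BL :: "'n rmat \<Rightarrow> 'n rvec \<Rightarrow> 'n::finite isometry" where
  "BL B b = (\<lambda>x. B *v (x + b))"

text \<open>The \<open>B\<close> and the \<open>b\<close> of \<open>\<gamma> = BL\<^sub>b\<close>.\<close>

definition rot :: "'n::finite isometry \<Rightarrow> 'n rmat" where
  "rot \<gamma> = (THE B. orthogonal_matrix B \<and> (\<exists>b. \<gamma> = BL B b))"

definition tvec :: "'n::finite isometry \<Rightarrow> 'n rvec" where
  "tvec \<gamma> = (THE b. \<gamma> = BL (rot \<gamma>) b)"

lemma BL_unique:
  assumes "orthogonal_matrix B" "BL B b = BL B' b'"
  shows "B = B'" "b = b'"
proof -
  have e: "B *v x + B *v b = B' *v x + B' *v b'" for x
    using fun_cong[OF assms(2), of x] by (simp add: BL_def matrix_vector_right_distrib)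
  from e[of 0] have "B *v b = B' *v b'" by simp
  with e have "B *v x = B' *v x" for x by simp
  then show 1: "B = B'" by (simp add: matrix_eq)
  from \<open>B *v b = B' *v b'\<close> 1 have "transpose B *v (B *v b) = transpose B *v (B *v b')" by simp
  then show "b = b'"
    using assms(1) by (simp add: matrix_vector_mul_assoc orthogonal_matrix_def)
qed

lemma rot_BL: "orthogonal_matrix B \<Longrightarrow> rot (BL B b) = B"
  unfolding rot_def by (rule the_equality) (auto dest: BL_unique)

lemma tvec_BL: "orthogonal_matrix B \<Longrightarrow> tvec (BL B b) = b"
  unfolding tvec_def by (rule the_equality) (auto simp: rot_BL dest: BL_unique)

lemma carrier_isom: "carrier isom = {BL B b | B b. orthogonal_matrix B}"
proof safe
  fix f :: "'a isometry" assume "f \<in> carrier isom"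
  then have f: "dist (f x) (f y) = dist x y" for x y by (simp add: isom_def)
  have ot: "orthogonal_transformation (\<lambda>x. f x - f 0)"
    unfolding orthogonal_transformation_isometry using f by (simp add: dist_norm)
  define B where "B = matrix (\<lambda>x. f x - f 0)"
  have B: "orthogonal_matrix B" "B *v x = f x - f 0" for x
    using ot by (auto simp: B_def orthogonal_transformation_matrix matrix_works)
  have "B *v (x + transpose B *v f 0) = f x" for x
  proof -
    have "B *v (x + transpose B *v f 0) = B *v x + (B ** transpose B) *v f 0"
      by (simp only: matrix_vector_right_distrib matrix_vector_mul_assoc)
    then show ?thesis using B by (simp add: orthogonal_matrix_def)
  qed
  then have "f = BL B (transpose B *v f 0)" by (simp add: BL_def)
  with B show "\<exists>B b. f = BL B b \<and> orthogonal_matrix B" by blast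
next
  fix B :: "real ^ 'a ^ 'a" and b assume "orthogonal_matrix B"
  then have "orthogonal_transformation ((*v) B)"
    by (simp add: orthogonal_transformation_matrix)
  then have n: "norm (B *v x) = norm x" for x
    by (rule orthogonal_transformation_norm)
  have "dist (BL B b x) (BL B b y) = dist x y" for x y
  proof -
    have "BL B b x - BL B b y = B *v (x - y)"
      unfolding BL_def by (simp only: matrix_vector_mult_diff_distrib[symmetric] add_diff_cancel_right)
    then show ?thesis by (simp only: dist_norm n)
  qed
  then show "BL B b \<in> carrier isom" by (simp add: isom_def)
qed

text \<open>\<open>\<Gamma>\<close> is discrete in the usual topology of the isometry group, that of
  \<open>O(n) \<times> \<real>\<^sup>n\<close>; the orbit space carries the quotient topology.\<close>

definition discrete_group :: "'n::finite isometry set \<Rightarrow> bool" where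
  "discrete_group \<Gamma> \<longleftrightarrow> discrete ((\<lambda>\<gamma>. (rot \<gamma>, tvec \<gamma>)) ` \<Gamma>)"

definition orbit :: "'n::finite isometry set \<Rightarrow> 'n rvec \<Rightarrow> ('n rvec) set" where
  "orbit \<Gamma> x = {\<gamma> x | \<gamma>. \<gamma> \<in> \<Gamma>}"

definition orbit_space :: "'n::finite isometry set \<Rightarrow> ('n rvec) set topology" where
  "orbit_space \<Gamma> = topology (\<lambda>U. U \<subseteq> range (orbit \<Gamma>) \<and> open (orbit \<Gamma> -` U))"

lemma openin_orbit_space:
  "openin (orbit_space \<Gamma>) U \<longleftrightarrow> U \<subseteq> range (orbit \<Gamma>) \<and> open (orbit \<Gamma> -` U)"
proof -
  have "istopology (\<lambda>U. U \<subseteq> range (orbit \<Gamma>) \<and> open (orbit \<Gamma> -` U))"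
    unfolding istopology_def by (auto simp: vimage_Union)
  then show ?thesis by (simp add: orbit_space_def topology_inverse')
qed

definition torsion_free :: "'n::finite isometry set \<Rightarrow> bool" where
  "torsion_free \<Gamma> \<longleftrightarrow> (\<forall>\<gamma>\<in>\<Gamma>. \<forall>k>0. \<gamma> ^^ k = id \<longrightarrow> \<gamma> = id)"

definition bieberbach :: "'n::finite isometry set \<Rightarrow> bool" where
  "bieberbach \<Gamma> \<longleftrightarrow> subgroup \<Gamma> isom \<and> discrete_group \<Gamma> \<and> compact_space (orbit_space \<Gamma>) \<and> torsion_free \<Gamma>"

abbreviation grp :: "'n::finite isometry set \<Rightarrow> 'n isometry monoid" where
  "grp \<Gamma> \<equiv> isom\<lparr>carrier := \<Gamma>\<rparr>"

definition transl_lattice :: "'n::finite isometry set \<Rightarrow> ('n rvec) set" where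
  "transl_lattice \<Gamma> = {l. transl l \<in> \<Gamma>}"

abbreviation transl_group :: "'n::finite isometry set \<Rightarrow> 'n isometry set" where
  "transl_group \<Gamma> \<equiv> transl ` transl_lattice \<Gamma>"

definition cosets :: "'n::finite isometry set \<Rightarrow> 'n isometry set set" where
  "cosets \<Gamma> = rcosets\<^bsub>grp \<Gamma>\<^esub> transl_group \<Gamma>"

definition holonomy :: "'n::finite isometry set \<Rightarrow> ('n rmat) set" where
  "holonomy \<Gamma> = rot ` \<Gamma>"

definition orientable :: "'n::finite isometry set \<Rightarrow> bool" where
  "orientable \<Gamma> \<longleftrightarrow> (\<forall>B\<in>holonomy \<Gamma>. det B = 1)"

definition F1 :: "'n::finite isometry set \<Rightarrow> ('n rmat) set" where
  "F1 \<Gamma> = {B \<in> holonomy \<Gamma>. dim {x. (B - mat 1) *v x = 0} = 1}"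

section \<open>Spin structures and twisted Dirac operators\<close>

definition spin_structure :: "'n::{finite,linorder} isometry set \<Rightarrow> ('n isometry \<Rightarrow> 'n cliff) \<Rightarrow> bool" where
  "spin_structure \<Gamma> \<epsilon> \<longleftrightarrow> \<epsilon> \<in> hom (grp \<Gamma>) spin_group \<and> (\<forall>\<gamma>\<in>\<Gamma>. mu (\<epsilon> \<gamma>) = rot \<gamma>)"

definition unitary_group :: "(complex ^ 'v ^ 'v::finite) monoid" where
  "unitary_group = \<lparr>carrier = {A. map_matrix cnj (transpose A) ** A = mat 1 \<and>
                                  A ** map_matrix cnj (transpose A) = mat 1},
                    mult = (**), one = mat 1\<rparr>"

text \<open>\<open>\<epsilon>\<close> takes the values \<open>1\<close> and \<open>-1\<close> on translations; \<open>delta\<close> reads these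
  Clifford scalars as real numbers.\<close>

definition delta :: "('n::{finite,linorder} isometry \<Rightarrow> 'n cliff) \<Rightarrow> 'n rvec \<Rightarrow> real" where
  "delta \<epsilon> l = (THE s. of_real s = \<epsilon> (transl l))"

definition dual_set :: "'n::{finite,linorder} isometry set \<Rightarrow> ('n isometry \<Rightarrow> 'n cliff) \<Rightarrow> real
    \<Rightarrow> ('n rvec) set" where
  "dual_set \<Gamma> \<epsilon> m = {u. norm u = m \<and>
     (\<forall>l\<in>transl_lattice \<Gamma>. of_real (delta \<epsilon> l) = exp (2 * of_real pi * \<i> * of_real (u \<bullet> l)))}"

definition dual_fix :: "'n::{finite,linorder} isometry set \<Rightarrow> ('n isometry \<Rightarrow> 'n cliff) \<Rightarrow> real
    \<Rightarrow> 'n isometry \<Rightarrow> ('n rvec) set" where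
  "dual_fix \<Gamma> \<epsilon> m \<gamma> = {u \<in> dual_set \<Gamma> \<epsilon> m. rot \<gamma> *v u = u}"

definition e_sum :: "'n::{finite,linorder} isometry set \<Rightarrow> ('n isometry \<Rightarrow> 'n cliff) \<Rightarrow> real
    \<Rightarrow> 'n isometry \<Rightarrow> complex" where
  "e_sum \<Gamma> \<epsilon> m \<gamma> = (\<Sum>u\<in>dual_fix \<Gamma> \<epsilon> m \<gamma>. exp (- 2 * of_real pi * \<i> * of_real (u \<bullet> tvec \<gamma>)))"

definition kron :: "complex ^ 's ^ 's \<Rightarrow> complex ^ 'v ^ 'v \<Rightarrow> complex ^ ('s \<times> 'v) ^ ('s \<times> 'v)" where
  "kron A B = (\<chi> p q. A $ fst p $ fst q * B $ snd p $ snd q)"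

primrec Ck :: "nat \<Rightarrow> ('a::real_normed_vector \<Rightarrow> 'b::real_normed_vector) \<Rightarrow> bool" where
  "Ck 0 f \<longleftrightarrow> continuous_on UNIV f"
| "Ck (Suc k) f \<longleftrightarrow> f differentiable_on UNIV \<and> (\<forall>v. Ck k (\<lambda>x. frechet_derivative f (at x) v))"

definition smooth :: "('a::real_normed_vector \<Rightarrow> 'b::real_normed_vector) \<Rightarrow> bool" where
  "smooth f \<longleftrightarrow> (\<forall>k. Ck k f)"

definition dirac :: "('n::{finite,linorder} cliff \<Rightarrow> complex ^ 's ^ 's)
    \<Rightarrow> ('n rvec \<Rightarrow> complex ^ ('s \<times> 'v::finite)) \<Rightarrow> 'n rvec \<Rightarrow> complex ^ ('s \<times> 'v)" where
  "dirac L f x = (\<Sum>i = 1..CARD('n). kron (L (cvec (eb i))) (mat 1) *v frechet_derivative f (at x) (eb i))"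

definition spinor_fields :: "'n::{finite,linorder} isometry set \<Rightarrow> ('n isometry \<Rightarrow> 'n cliff)
    \<Rightarrow> ('n isometry \<Rightarrow> complex ^ 'v ^ 'v) \<Rightarrow> ('n cliff \<Rightarrow> complex ^ 's ^ 's)
    \<Rightarrow> ('n rvec \<Rightarrow> complex ^ ('s \<times> 'v)) set" where
  "spinor_fields \<Gamma> \<epsilon> \<rho> L =
     {f. smooth f \<and> (\<forall>\<gamma>\<in>\<Gamma>. \<forall>x. f (\<gamma> x) = kron (L (\<epsilon> \<gamma>)) (\<rho> \<gamma>) *v f x)}"

definition eigenspace :: "'n::{finite,linorder} isometry set \<Rightarrow> ('n isometry \<Rightarrow> 'n cliff)
    \<Rightarrow> ('n isometry \<Rightarrow> complex ^ 'v ^ 'v) \<Rightarrow> ('n cliff \<Rightarrow> complex ^ 's ^ 's) \<Rightarrow> real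
    \<Rightarrow> ('n rvec \<Rightarrow> complex ^ ('s \<times> 'v)) set" where
  "eigenspace \<Gamma> \<epsilon> \<rho> L r =
     {f \<in> spinor_fields \<Gamma> \<epsilon> \<rho> L. \<forall>x. dirac L f x = of_real r *s f x}"

definition cfun_scale :: "complex \<Rightarrow> ('a \<Rightarrow> complex ^ 'k) \<Rightarrow> 'a \<Rightarrow> complex ^ 'k" where
  "cfun_scale c f = (\<lambda>x. c *s f x)"

global_interpretation cfun: vector_space "cfun_scale :: complex \<Rightarrow> ('a \<Rightarrow> complex ^ 'k) \<Rightarrow> _"
  by unfold_locales
    (simp_all add: cfun_scale_def fun_eq_iff vector_add_ldistrib vector_sadd_rdistrib vector_smult_assoc)

text \<open>As a relation, since \<open>cfun.dim\<close> is \<open>0\<close> on infinite-dimensional spaces.\<close>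

definition eigenvalue_mult :: "'n::{finite,linorder} isometry set \<Rightarrow> ('n isometry \<Rightarrow> 'n cliff)
    \<Rightarrow> ('n isometry \<Rightarrow> complex ^ 'v ^ 'v) \<Rightarrow> ('n cliff \<Rightarrow> complex ^ 's ^ 's) \<Rightarrow> real \<Rightarrow> nat \<Rightarrow> bool" where
  "eigenvalue_mult \<Gamma> \<epsilon> \<rho> L r d \<longleftrightarrow>
     (\<exists>A. finite A \<and> cfun.independent A \<and> cfun.span A = eigenspace \<Gamma> \<epsilon> \<rho> L r \<and> card A = d)"

text \<open>\<open>(S \<otimes> V)\<^sup>F\<close>: the action of \<open>\<Gamma>\<close> factors through \<open>F\<close> when \<open>\<epsilon>\<close> and
  \<open>\<rho>\<close> are trivial on translations.\<close>

definition invariants :: "'n::{finite,linorder} isometry set \<Rightarrow> ('n isometry \<Rightarrow> 'n cliff)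
    \<Rightarrow> ('n isometry \<Rightarrow> complex ^ 'v ^ 'v) \<Rightarrow> ('n cliff \<Rightarrow> complex ^ 's ^ 's)
    \<Rightarrow> (complex ^ ('s \<times> 'v)) set" where
  "invariants \<Gamma> \<epsilon> \<rho> L = {w. \<forall>\<gamma>\<in>\<Gamma>. kron (L (\<epsilon> \<gamma>)) (\<rho> \<gamma>) *v w = w}"

section \<open>The terms of the multiplicity formulas\<close>

text \<open>\<open>x\<close> may serve as \<open>x\<^sub>\<gamma>\<close>.\<close>

definition torus_conj :: "('n::{finite,linorder} isometry \<Rightarrow> 'n cliff) \<Rightarrow> 'n isometry \<Rightarrow> 'n cliff \<Rightarrow> bool" where
  "torus_conj \<epsilon> \<gamma> x \<longleftrightarrow> x \<in> torus (CARD('n) - 1) \<and> conj_in spin (\<epsilon> \<gamma>) x"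

definition h_elt :: "'n::{finite,linorder} rvec \<Rightarrow> 'n cliff" where
  "h_elt u = (SOME h. h \<in> spin \<and> h * cvec u * cinv h = norm u *\<^sub>R cvec (eb CARD('n)))"

definition sigma :: "('n::{finite,linorder} isometry \<Rightarrow> 'n cliff) \<Rightarrow> 'n isometry \<Rightarrow> 'n rvec \<Rightarrow> 'n cliff \<Rightarrow> real" where
  "sigma \<epsilon> \<gamma> u x = (if conj_in spin1 (h_elt u * \<epsilon> \<gamma> * cinv (h_elt u)) x then 1 else - 1)"

text \<open>The summands for even \<open>n\<close>, for odd \<open>n\<close> and \<open>B \<notin> F\<^sub>1\<close>, and for odd \<open>n\<close> and \<open>B \<in> F\<^sub>1\<close>;
  \<open>L'\<close> is the spin representation of \<open>Cl(n - 1)\<close>.\<close>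

definition term_even :: "'n::{finite,linorder} isometry set \<Rightarrow> ('n isometry \<Rightarrow> 'n cliff)
    \<Rightarrow> ('n isometry \<Rightarrow> complex ^ 'v ^ 'v) \<Rightarrow> ('n cliff \<Rightarrow> complex ^ 't ^ 't) \<Rightarrow> real
    \<Rightarrow> 'n isometry \<Rightarrow> 'n cliff \<Rightarrow> complex" where
  "term_even \<Gamma> \<epsilon> \<rho> L' m \<gamma> x = trace (\<rho> \<gamma>) * e_sum \<Gamma> \<epsilon> m \<gamma> * chi L' x"

definition term_gen :: "'n::{finite,linorder} isometry set \<Rightarrow> ('n isometry \<Rightarrow> 'n cliff)
    \<Rightarrow> ('n isometry \<Rightarrow> complex ^ 'v ^ 'v) \<Rightarrow> ('n cliff \<Rightarrow> complex ^ 't ^ 't) \<Rightarrow> real \<Rightarrow> real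
    \<Rightarrow> 'n isometry \<Rightarrow> 'n cliff \<Rightarrow> complex" where
  "term_gen \<Gamma> \<epsilon> \<rho> L' s m \<gamma> x =
     trace (\<rho> \<gamma>) * e_sum \<Gamma> \<epsilon> m \<gamma> * chi_half (CARD('n) - 1) s L' x"

definition term_F1 :: "'n::{finite,linorder} isometry set \<Rightarrow> ('n isometry \<Rightarrow> 'n cliff)
    \<Rightarrow> ('n isometry \<Rightarrow> complex ^ 'v ^ 'v) \<Rightarrow> ('n cliff \<Rightarrow> complex ^ 't ^ 't) \<Rightarrow> real \<Rightarrow> real
    \<Rightarrow> 'n isometry \<Rightarrow> 'n cliff \<Rightarrow> complex" where
  "term_F1 \<Gamma> \<epsilon> \<rho> L' s m \<gamma> x = trace (\<rho> \<gamma>) *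
     (\<Sum>u\<in>dual_fix \<Gamma> \<epsilon> m \<gamma>. exp (- 2 * of_real pi * \<i> * of_real (u \<bullet> tvec \<gamma>))
        * chi_half (CARD('n) - 1) (s * sigma \<epsilon> \<gamma> u x) L' x)"

end

theory Submission
  imports Defs
begin

text \<open>
  By Bieberbach's first theorem \<open>\<Lambda>\<close> spans \<open>\<real>\<^sup>n\<close> and \<open>F\<close> is finite; the proof is Buser's, by
  minimality of a commutator. Fourier expansion over a sublattice of \<open>\<Lambda>\<close> turns an eigenspinor for
  \<open>\<plusminus>2\<pi>\<mu>\<close> into a family \<open>(c\<^sub>u)\<close> indexed by the finite set \<open>\<Lambda>\<^sup>*\<^sub>\<epsilon>\<^sub>,\<^sub>\<mu>\<close>, with \<open>c\<^sub>u\<close> in an eigenspace of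
  Clifford multiplication by \<open>u\<close>; equivariance says that the family is fixed by an action of
  \<open>F\<close>. The dimension of the fixed space is the trace of the averaging projection, to which only
  the \<open>u\<close> with \<open>Bu = u\<close> contribute. All traces in the Clifford modules can be read off from two
  coordinates: up to a factor, \<open>tr L(a)\<close> is the coordinate of \<open>a\<close> at \<open>1\<close> if \<open>a\<close> is even,
  and its coordinate at \<open>e\<^sub>1 \<cdots> e\<^sub>n\<close> if \<open>a\<close> is odd and \<open>n\<close> is odd. The sign \<open>\<sigma>\<close> is the sign by
  which the coordinates of \<open>\<epsilon>(\<gamma>) u / \<mu>\<close> and \<open>x\<^sub>\<gamma> e\<^sub>n\<close> at \<open>e\<^sub>1 \<cdots> e\<^sub>n\<close> differ; both vanish
  as soon as \<open>B\<close> fixes a plane.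
\<close>


section \<open>Traces of endomorphisms of subspaces\<close>

text \<open>The eigenspaces of Clifford multiplication by u, |u| = \<mu>, are cut out by the
  projections (1 + i s u / \<mu>)/2 with s = 1 or -1. The trace of \<epsilon>(\<gamma>) on such an
  eigenspace is therefore half of tr L(\<epsilon>(\<gamma>)) + (i s / \<mu>) tr
  L(\<epsilon>(\<gamma>) u): this is where an even and an odd Clifford element enter together. For
  even n the factor 1/2 is the ratio of dim S_(n-1) to dim S_n; for odd n it matches the 1/2 in the
  projections onto the half-spin spaces of S_(n-1). The formulas live on S_(n-1), the spinors on
  S_n. No isomorphism between an eigenspace of u and a module over Cl(n - 1) is built: both
  characters are linear in the same two coordinates, and only those are compared. The statement is
  full of choices: coset representatives, x_\<gamma>, h_u, bases behind traces. Each summand is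
  identified with the contribution of \<gamma> to one trace, which involves neither x_\<gamma> nor
  h_u and is constant on cosets; independence of the choices comes with the formula.\<close>

context vector_space
begin

text \<open>Cyclicity of the trace: expand \<open>p b\<close> in \<open>B\<close> and \<open>f b\<close> in \<open>B0\<close>.\<close>
lemma trace_projection:
  assumes fin: "finite B0" "finite B" and ind: "independent B0" "independent B"
    and p: "Vector_Spaces.linear scale scale p" and f: "Vector_Spaces.linear scale scale f"
    and pB: "\<And>v. v \<in> span B0 \<Longrightarrow> p v \<in> span B"
    and BB: "span B \<subseteq> span B0"
    and pid: "\<And>v. v \<in> span B \<Longrightarrow> p v = v"
    and fB: "\<And>v. v \<in> span B \<Longrightarrow> f v \<in> span B"
  shows "(\<Sum>b\<in>B0. representation B0 (f (p b)) b) = (\<Sum>b\<in>B. representation B (f b) b)"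
proof -
  interpret p: Vector_Spaces.linear scale scale p by fact
  interpret f: Vector_Spaces.linear scale scale f by fact
  have expB: "(\<Sum>b\<in>B. scale (representation B v b) b) = v" if "v \<in> span B" for v
    using sum_representation_eq[OF ind(2) that fin(2)] by simp
  have expB0: "(\<Sum>b\<in>B0. scale (representation B0 v b) b) = v" if "v \<in> span B0" for v
    using sum_representation_eq[OF ind(1) that fin(1)] by simp
  have rep_sum: "representation C (\<Sum>a\<in>A. scale (k a) (w a)) b = (\<Sum>a\<in>A. k a * representation C (w a) b)"
    if "independent C" "\<And>a. a \<in> A \<Longrightarrow> w a \<in> span C" for C A k w b
    using that by (simp add: representation_sum representation_scale span_scale)
  have fp: "representation B0 (f (p c)) c' = (\<Sum>b\<in>B. representation B (p c) b * representation B0 (f b) c')"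
    if "c \<in> B0" for c c'
  proof -
    have pc: "p c \<in> span B" using pB span_base[OF that] by blast
    have "f (p c) = f (\<Sum>b\<in>B. scale (representation B (p c) b) b)" using expB[OF pc] by simp
    also have "\<dots> = (\<Sum>b\<in>B. scale (representation B (p c) b) (f b))"
      by (simp add: f.sum f.scale)
    moreover have "f b \<in> span B0" if "b \<in> B" for b using BB fB span_base[OF that] by blast
    ultimately show ?thesis by (simp add: rep_sum[OF ind(1)])
  qed
  have "(\<Sum>c\<in>B0. representation B0 (f (p c)) c)
      = (\<Sum>b\<in>B. \<Sum>c\<in>B0. representation B0 (f b) c * representation B (p c) b)"
    by (subst sum.swap) (simp add: fp mult.commute)
  also have "\<dots> = (\<Sum>b\<in>B. representation B (p (\<Sum>c\<in>B0. scale (representation B0 (f b) c) c)) b)"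
  proof (rule sum.cong[OF refl])
    fix b assume "b \<in> B"
    have "p (\<Sum>c\<in>B0. scale (representation B0 (f b) c) c) = (\<Sum>c\<in>B0. scale (representation B0 (f b) c) (p c))"
      by (simp add: p.sum p.scale)
    then show "(\<Sum>c\<in>B0. representation B0 (f b) c * representation B (p c) b)
        = representation B (p (\<Sum>c\<in>B0. scale (representation B0 (f b) c) c)) b"
      using pB span_base by (simp add: rep_sum[OF ind(2)])
  qed
  also have "\<dots> = (\<Sum>b\<in>B. representation B (f b) b)"
  proof (rule sum.cong[OF refl])
    fix b assume "b \<in> B"
    then have "f b \<in> span B" by (intro fB span_base)
    moreover from this have "f b \<in> span B0" using BB by blast
    ultimately show "representation B (p (\<Sum>c\<in>B0. scale (representation B0 (f b) c) c)) b
        = representation B (f b) b" by (simp add: expB0 pid)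
  qed
  finally show ?thesis .
qed

text \<open>With \<open>f\<close> the identity, the trace of a projection counts the dimension of
  its image. This is how a multiplicity becomes a sum over holonomy elements.\<close>

lemma trace_projection_eq_card:
  assumes fin: "finite B0" "finite B" and ind: "independent B0" "independent B"
    and p: "Vector_Spaces.linear scale scale p"
    and pB: "\<And>v. v \<in> span B0 \<Longrightarrow> p v \<in> span B"
    and BB: "span B \<subseteq> span B0"
    and pid: "\<And>v. v \<in> span B \<Longrightarrow> p v = v"
  shows "(\<Sum>b\<in>B0. representation B0 (p b) b) = of_nat (card B)"
proof -
  have "(\<Sum>b\<in>B0. representation B0 (p b) b) = (\<Sum>b\<in>B. representation B b b)"
    using trace_projection[OF fin ind p linear_ident pB BB pid] by simp
  also have "\<dots> = (\<Sum>b\<in>B. 1)"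
    by (rule sum.cong) (use ind in \<open>auto simp: representation_basis\<close>)
  finally show ?thesis by simp
qed

end

section \<open>Matrix traces in the standard basis\<close>

definition cart_axes :: "(complex ^ 's) set" where
  "cart_axes = range (\<lambda>i. axis i 1)"

lemma cart_axes_basis: "finite (cart_axes :: (complex ^ 's) set)"
  "vec.independent (cart_axes :: (complex ^ 's) set)"
  "vec.span (cart_axes :: (complex ^ 's) set) = UNIV"
  using vec.independent_Basis vec.span_Basis
  by (auto simp: cart_axes_def cart_basis_def full_SetCompr_eq)

lemma axis_nth_if: "axis j a $ i = (if i = j then a else 0)"
  by (simp add: axis_def)

lemma representation_cart_axes:
  "vec.representation (cart_axes :: (complex ^ 's) set) v (axis i 1) = v $ i"
proof -
  have inj: "inj (\<lambda>i. axis i (1::complex) :: complex ^ 's)"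
    by (rule injI) (simp add: axis_eq_axis)
  have "(\<Sum>b\<in>cart_axes. vec.representation cart_axes v b *s b) = v"
    by (rule vec.sum_representation_eq) (use cart_axes_basis in auto)
  then have "v = (\<Sum>j\<in>UNIV. vec.representation cart_axes v (axis j 1) *s axis j 1)"
    unfolding cart_axes_def by (subst (asm) sum.reindex[OF inj]) simp
  then have "v $ i = (\<Sum>j\<in>UNIV. vec.representation cart_axes v (axis j 1) *s axis j 1) $ i"
    by simp
  also have "\<dots> = (\<Sum>j\<in>UNIV. if i = j then vec.representation cart_axes v (axis j 1) else 0)"
    unfolding sum_component by (rule sum.cong) (simp_all add: axis_nth_if)
  finally show ?thesis by simp
qed

lemma trace_eq_representation:
  "trace (A :: complex ^ 's ^ 's) = (\<Sum>b\<in>cart_axes. vec.representation cart_axes (A *v b) b)"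
proof -
  have inj: "inj (\<lambda>i. axis i (1::complex) :: complex ^ 's)"
    by (rule injI) (simp add: axis_eq_axis)
  have "(\<Sum>b\<in>cart_axes. vec.representation cart_axes (A *v b) b) = (\<Sum>i\<in>UNIV. (A *v axis i 1) $ i)"
    unfolding cart_axes_def by (subst sum.reindex[OF inj])
      (simp add: representation_cart_axes[unfolded cart_axes_def])
  also have "\<dots> = trace A"
    by (simp add: trace_def matrix_vector_mult_def axis_nth_if if_distrib cong: if_cong)
  finally show ?thesis by simp
qed

text \<open>\<open>trace_on\<close> refers to a basis of the subspace picked by \<open>SOME\<close>.
  A projection \<open>P\<close> onto the subspace removes the choice: by
  \<open>trace_projection\<close> the value is the trace of \<open>A ** P\<close> on the whole
  space.\<close>

lemma trace_on_eq_trace: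
  fixes A P :: "complex ^ 's ^ 's"
  assumes W: "W = {w. P *v w = w}" and idem: "P ** P = P" and AW: "\<And>w. w \<in> W \<Longrightarrow> A *v w \<in> W"
  shows "trace_on W ((*v) A) = trace (A ** P)"
proof -
  have sub: "vec.subspace W"
    unfolding W vec.subspace_def
    by (simp add: matrix_vector_right_distrib vector_scalar_commute)
  define B where "B = (SOME B. vec.independent B \<and> vec.span B = W)"
  have "\<exists>B. vec.independent B \<and> vec.span B = W"
    using vec.basis_exists[of W] sub by (metis vec.span_subspace)
  then have B: "vec.independent B" "vec.span B = W"
    unfolding B_def by (metis (mono_tags, lifting) someI_ex)+
  have fin: "finite B" by (rule vec.independent_bound_general[THEN conjunct1, OF B(1)])
  have "trace_on W ((*v) A) = (\<Sum>b\<in>B. vec.representation B (A *v b) b)"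
    by (simp add: trace_on_def Let_def B_def)
  also have "\<dots> = (\<Sum>b\<in>cart_axes. vec.representation cart_axes (A *v (P *v b)) b)"
  proof (rule vec.trace_projection[symmetric, OF cart_axes_basis(1) fin cart_axes_basis(2) B(1)
        matrix_vector_mul_linear_gen matrix_vector_mul_linear_gen])
    show "P *v v \<in> vec.span B" for v
      using idem by (simp add: B W matrix_vector_mul_assoc)
    show "P *v v = v" if "v \<in> vec.span B" for v using that by (simp add: B W)
    show "A *v v \<in> vec.span B" if "v \<in> vec.span B" for v using that AW by (simp add: B)
  qed (simp add: cart_axes_basis)
  finally show ?thesis by (simp add: trace_eq_representation matrix_vector_mul_assoc)
qed

section \<open>Groups of isometries\<close>

declare transpose_matrix_vector [simp del]

lemma norm_matrix_sq: "(norm (M :: real ^ 'n ^ 'm))\<^sup>2 = (\<Sum>i\<in>UNIV. (norm (M $ i))\<^sup>2)"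
  by (simp add: norm_vec_def L2_set_def sum_nonneg)

text \<open>The norm of a matrix is its Frobenius norm, so this is the Cauchy-Schwarz inequality for
  each row.\<close>

lemma norm_matrix_vector_mult_le: "norm (M *v x) \<le> norm (M :: real ^ 'n ^ 'm) * norm x"
proof (rule power2_le_imp_le)
  have "(norm (M *v x))\<^sup>2 = (\<Sum>i\<in>UNIV. (M $ i \<bullet> x)\<^sup>2)"
    by (simp add: norm_vec_def L2_set_def sum_nonneg matrix_vector_mul_component)
  also have "\<dots> \<le> (\<Sum>i\<in>UNIV. (norm (M $ i))\<^sup>2 * (norm x)\<^sup>2)"
    by (intro sum_mono) (metis Cauchy_Schwarz_ineq power2_norm_eq_inner)
  finally show "(norm (M *v x))\<^sup>2 \<le> (norm M * norm x)\<^sup>2"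
    by (simp add: norm_matrix_sq power_mult_distrib sum_distrib_right)
qed simp

lemma orthogonal_matrix_norm: "orthogonal_matrix A \<Longrightarrow> norm (A *v x) = norm (x :: real ^ 'n)"
  by (simp add: orthogonal_transformation_matrix orthogonal_transformation_norm[of "(*v) A"])

lemma orthogonal_matrix_mul_transpose:
  "orthogonal_matrix (A :: real ^ 'n ^ 'n) \<Longrightarrow> transpose A ** A = mat 1 \<and> A ** transpose A = mat 1"
  by (simp add: orthogonal_matrix_def)

lemma orthogonal_matrix_cancel [simp]:
  assumes "orthogonal_matrix (A :: real ^ 'n ^ 'n)"
  shows "transpose A *v (A *v x) = x" "A *v (transpose A *v x) = x"
  using orthogonal_matrix_mul_transpose[OF assms] by (simp_all add: matrix_vector_mul_assoc)

text \<open>The rows of \<open>M ** transpose A\<close> are the images under \<open>A\<close> of the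
  rows of \<open>M\<close>.\<close>

lemma norm_matrix_mul_orthogonal:
  assumes "orthogonal_matrix (A :: real ^ 'n ^ 'n)"
  shows "norm (M ** transpose A) = norm (M :: real ^ 'n ^ 'm)"
proof -
  have "(M ** transpose A) $ i = A *v (M $ i)" for i
    by (simp add: vec_eq_iff matrix_matrix_mult_def matrix_vector_mult_def transpose_def mult.commute)
  then have "(norm (M ** transpose A))\<^sup>2 = (norm M)\<^sup>2"
    by (simp add: norm_matrix_sq orthogonal_matrix_norm assms)
  then show ?thesis by (simp add: power2_eq_iff_nonneg)
qed

lemma norm_orthogonal_matrix:
  assumes "orthogonal_matrix (A :: real ^ 'n ^ 'n)"
  shows "norm A = norm (mat 1 :: real ^ 'n ^ 'n)"
  using norm_matrix_mul_orthogonal[of "transpose A" "mat 1"] assms by simp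

lemma matrix_diff_rdistrib: "(A - B) ** (C :: real ^ 'n ^ 'm) = A ** C - B ** C"
  by (simp add: matrix_matrix_mult_def vec_eq_iff left_diff_distrib sum_subtractf)

lemma isom_rot:
  assumes "\<gamma> \<in> carrier isom"
  shows "orthogonal_matrix (rot \<gamma>)" "\<gamma> = BL (rot \<gamma>) (tvec \<gamma>)"
proof -
  obtain B b where "\<gamma> = BL B b" "orthogonal_matrix B"
    using assms by (auto simp: carrier_isom)
  then show "orthogonal_matrix (rot \<gamma>)" "\<gamma> = BL (rot \<gamma>) (tvec \<gamma>)"
    by (simp_all add: rot_BL tvec_BL)
qed

text \<open>Calculations use \<gamma> 0 = Bb in place of b: in the form x -> Bx + \<gamma> 0
  composition and inversion stay simple, and |\<gamma> 0| = |b| because B is orthogonal.\<close>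

lemma isom_apply:
  assumes "\<gamma> \<in> carrier isom"
  shows "\<gamma> x = rot \<gamma> *v (x + tvec \<gamma>)" "\<gamma> x = rot \<gamma> *v x + \<gamma> 0" "\<gamma> 0 = rot \<gamma> *v tvec \<gamma>"
proof -
  have e: "\<gamma> x = rot \<gamma> *v (x + tvec \<gamma>)" for x
    using fun_cong[OF isom_rot(2)[OF assms], of x] by (simp add: BL_def)
  show "\<gamma> x = rot \<gamma> *v (x + tvec \<gamma>)" "\<gamma> 0 = rot \<gamma> *v tvec \<gamma>" "\<gamma> x = rot \<gamma> *v x + \<gamma> 0"
    by (simp_all add: e matrix_vector_right_distrib)
qed

lemma isom_eqI:
  assumes "\<gamma> \<in> carrier isom" "\<delta> \<in> carrier isom" "rot \<gamma> = rot \<delta>" "\<gamma> 0 = \<delta> 0"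
  shows "\<gamma> = \<delta>"
  by (rule ext) (metis isom_apply(2) assms)

lemma norm_tvec: "\<gamma> \<in> carrier isom \<Longrightarrow> norm (tvec \<gamma>) = norm (\<gamma> 0)"
  by (simp add: isom_apply(3) orthogonal_matrix_norm isom_rot)

lemma rot_eqI:
  assumes "orthogonal_matrix B" "\<And>x. \<gamma> x = B *v x + c"
  shows "rot \<gamma> = B"
proof -
  have "\<gamma> = BL B (transpose B *v c)"
    using assms by (simp add: fun_eq_iff BL_def matrix_vector_right_distrib)
  then show ?thesis using assms by (simp add: rot_BL)
qed

lemma rot_comp:
  assumes "\<gamma> \<in> carrier isom" "\<delta> \<in> carrier isom"
  shows "rot (\<gamma> \<circ> \<delta>) = rot \<gamma> ** rot \<delta>"
proof (rule rot_eqI)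
  show "orthogonal_matrix (rot \<gamma> ** rot \<delta>)"
    using assms by (simp add: isom_rot orthogonal_matrix_mul)
  show "(\<gamma> \<circ> \<delta>) x = (rot \<gamma> ** rot \<delta>) *v x + (rot \<gamma> *v \<delta> 0 + \<gamma> 0)" for x
    using isom_apply(2)[OF assms(1), of "\<delta> x"] isom_apply(2)[OF assms(2), of x]
    by (simp add: matrix_vector_right_distrib matrix_vector_mul_assoc)
qed

lemma rot_transl [simp]: "rot (transl l) = mat 1"
  by (rule rot_eqI[of _ _ l]) (simp_all add: transl_def orthogonal_matrix_id)

lemma rot_id [simp]: "rot id = mat 1"
  by (rule rot_eqI[of _ _ 0]) (simp_all add: orthogonal_matrix_id)

lemma transl_in_isom: "transl l \<in> carrier isom"
  by (simp add: isom_def transl_def)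

lemma isom_transl: "\<gamma> \<in> carrier isom \<Longrightarrow> rot \<gamma> = mat 1 \<Longrightarrow> \<gamma> = transl (\<gamma> 0)"
  by (rule ext) (metis isom_apply(2) transl_def matrix_vector_mul_lid)

lemma transl_0: "transl 0 = id" by (auto simp: transl_def)

lemma transl_comp: "transl l \<circ> transl k = transl (l + k)"
  by (auto simp: transl_def)

lemma comp_transl: "\<gamma> \<in> carrier isom \<Longrightarrow> \<gamma> \<circ> transl l = transl (rot \<gamma> *v l) \<circ> \<gamma>"
  by (auto simp: transl_def isom_apply(1) matrix_vector_right_distrib fun_eq_iff)

lemma isom_inverse:
  assumes "\<gamma> \<in> carrier isom"
  shows "bij \<gamma>" "inv_into UNIV \<gamma> \<in> carrier isom" "m_inv isom \<gamma> = inv_into UNIV \<gamma>"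
proof -
  have o: "orthogonal_matrix (rot \<gamma>)" by (rule isom_rot[OF assms])
  have e: "\<gamma> x = rot \<gamma> *v x + c" if "c = \<gamma> 0" for x c
    unfolding that by (rule isom_apply(2)[OF assms])
  define c where "c = \<gamma> 0"
  show bij: "bij \<gamma>"
  proof (rule o_bij)
    show "(\<lambda>y. transpose (rot \<gamma>) *v (y - c)) \<circ> \<gamma> = id"
      using e[OF c_def] o by (simp add: fun_eq_iff)
    show "\<gamma> \<circ> (\<lambda>y. transpose (rot \<gamma>) *v (y - c)) = id"
      using e[OF c_def] o by (simp add: fun_eq_iff)
  qed
  then have inv: "inv_into UNIV \<gamma> \<circ> \<gamma> = id" "\<gamma> \<circ> inv_into UNIV \<gamma> = id"
    by (simp_all add: bij_is_inj bij_is_surj flip: surj_iff)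
  show inv_in: "inv_into UNIV \<gamma> \<in> carrier isom"
    using assms bij by (simp add: isom_def) (metis bij_inv_eq_iff)
  show "m_inv isom \<gamma> = inv_into UNIV \<gamma>"
    unfolding m_inv_def
  proof (rule the_equality)
    fix y assume "y \<in> carrier isom \<and> \<gamma> \<otimes>\<^bsub>isom\<^esub> y = \<one>\<^bsub>isom\<^esub> \<and> y \<otimes>\<^bsub>isom\<^esub> \<gamma> = \<one>\<^bsub>isom\<^esub>"
    then have "y \<circ> \<gamma> = id" by (simp add: isom_def)
    then show "y = inv_into UNIV \<gamma>" using inv by (metis comp_assoc comp_id id_comp)
  qed (use inv inv_in in \<open>simp add: isom_def\<close>)
qed

locale isometry_group =
  fixes \<Gamma> :: "'n::finite isometry set"
  assumes subgroup: "subgroup \<Gamma> isom"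
begin

lemma in_isom: "\<gamma> \<in> \<Gamma> \<Longrightarrow> \<gamma> \<in> carrier isom"
  using subgroup by (meson subgroup.mem_carrier)

lemma comp_in: "\<gamma> \<in> \<Gamma> \<Longrightarrow> \<delta> \<in> \<Gamma> \<Longrightarrow> \<gamma> \<circ> \<delta> \<in> \<Gamma>"
  using subgroup.m_closed[OF subgroup] by (simp add: isom_def)

lemma id_in: "id \<in> \<Gamma>"
  using subgroup.one_closed[OF subgroup] by (simp add: isom_def)

lemma inv_in: "\<gamma> \<in> \<Gamma> \<Longrightarrow> inv_into UNIV \<gamma> \<in> \<Gamma>"
  using subgroup.m_inv_closed[OF subgroup] in_isom isom_inverse(3) by metis

lemma inv_comp: "\<gamma> \<in> \<Gamma> \<Longrightarrow> inv_into UNIV \<gamma> \<circ> \<gamma> = id" "\<gamma> \<in> \<Gamma> \<Longrightarrow> \<gamma> \<circ> inv_into UNIV \<gamma> = id"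
  using isom_inverse(1)[OF in_isom] by (simp_all add: bij_is_inj bij_is_surj flip: surj_iff)

lemmas orthogonal_rot = isom_rot(1)[OF in_isom]

lemma rot_inv: "\<gamma> \<in> \<Gamma> \<Longrightarrow> rot (inv_into UNIV \<gamma>) = transpose (rot \<gamma>)"
proof -
  assume g: "\<gamma> \<in> \<Gamma>"
  have "rot (inv_into UNIV \<gamma>) ** rot \<gamma> = mat 1"
    using g inv_comp(1)[OF g] by (simp flip: rot_comp[OF in_isom in_isom] add: inv_in)
  then have "rot (inv_into UNIV \<gamma>) ** (rot \<gamma> ** transpose (rot \<gamma>)) = transpose (rot \<gamma>)"
    by (simp add: matrix_mul_assoc)
  then show ?thesis using orthogonal_matrix_mul_transpose[OF orthogonal_rot[OF g]] by simp
qed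

lemma inv_apply_0: "\<gamma> \<in> \<Gamma> \<Longrightarrow> inv_into UNIV \<gamma> 0 = - (transpose (rot \<gamma>) *v \<gamma> 0)"
proof -
  assume g: "\<gamma> \<in> \<Gamma>"
  have "inv_into UNIV \<gamma> (\<gamma> 0) = 0" using inv_comp(1)[OF g] by (simp add: fun_eq_iff)
  then show ?thesis using isom_apply(2)[OF in_isom[OF inv_in[OF g]], of "\<gamma> 0"] rot_inv[OF g]
    by (simp add: add_eq_0_iff)
qed

end

text \<open>Compare \<open>\<gamma>\<close>, \<open>\<delta>\<close> through \<open>\<gamma>\<delta>\<inverse>\<close>: the rotational part of the quotient is as close to the
  identity as \<open>rot \<gamma>\<close> is to \<open>rot \<delta>\<close>, because the Frobenius norm is invariant.\<close>
lemma (in isometry_group) finite_bounded: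
  assumes "discrete_group \<Gamma>"
  shows "finite {\<gamma>\<in>\<Gamma>. norm (\<gamma> 0) \<le> R}"
proof (rule ccontr)
  define h where "h \<gamma> = (rot \<gamma>, \<gamma> 0)" for \<gamma> :: "'n isometry"
  let ?X = "{\<gamma>\<in>\<Gamma>. norm (\<gamma> 0) \<le> R}"
  assume inf: "infinite ?X"
  have "inj_on h ?X" by (rule inj_onI) (auto simp: h_def intro: isom_eqI in_isom)
  then have inf2: "infinite (h ` ?X)" using inf by (simp add: finite_image_iff)
  \<comment> \<open>All orthogonal matrices have the Frobenius norm of the identity, so the pairs
    (rotational part, image of 0) stay in a compact set.\<close>
  have "h ` ?X \<subseteq> cball 0 (norm (mat 1 :: real^'n^'n)) \<times> cball 0 R"
    by (auto simp: h_def norm_orthogonal_matrix orthogonal_rot)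
  moreover have "compact ((cball 0 (norm (mat 1 :: real^'n^'n)) :: (real^'n^'n) set) \<times> (cball 0 R :: (real^'n) set))"
    by (intro compact_Times compact_cball)
  ultimately obtain p where p: "p islimpt (h ` ?X)"
    using Heine_Borel_imp_Bolzano_Weierstrass[OF _ inf2] by blast
  have close: "\<exists>\<gamma>\<in>?X. \<exists>\<delta>\<in>?X. \<gamma> \<noteq> \<delta> \<and> dist (h \<gamma>) (h \<delta>) < e" if "e > 0" for e
  proof -
    obtain q where q: "q \<in> h ` ?X" "q \<noteq> p" "dist q p < e/2"
      using p \<open>e > 0\<close> unfolding islimpt_approachable by (meson half_gt_zero)
    \<comment> \<open>Taking q' strictly nearer to p than q makes the two points different.\<close>
    then have "min (e/2) (dist q p) > 0" using \<open>e > 0\<close> by simp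
    then obtain q' where q': "q' \<in> h ` ?X" "q' \<noteq> p" "dist q' p < min (e/2) (dist q p)"
      using p unfolding islimpt_approachable by blast
    then have "q \<noteq> q'" "dist q q' < e"
      using q dist_triangle_half_r[of p q e q'] by (auto simp: dist_commute)
    moreover obtain \<gamma> \<delta> where "\<gamma> \<in> ?X" "q = h \<gamma>" "\<delta> \<in> ?X" "q' = h \<delta>"
      using q(1) q'(1) by blast
    ultimately show ?thesis by (intro bexI[of _ \<gamma>] bexI[of _ \<delta>]) auto
  qed
  have "(mat 1, 0) isolated_in ((\<lambda>\<gamma>. (rot \<gamma>, tvec \<gamma>)) ` \<Gamma>)"
  proof -
    have "tvec (id :: 'n isometry) = 0" using norm_tvec[OF in_isom[OF id_in]] by simp
    then have "(mat 1, 0) \<in> (\<lambda>\<gamma>. (rot \<gamma>, tvec \<gamma>)) ` \<Gamma>"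
      by (intro image_eqI[OF _ id_in]) simp
    with assms show ?thesis unfolding discrete_group_def discrete_def by blast
  qed
  then obtain e where e: "e > 0"
    "\<And>\<gamma>. \<gamma> \<in> \<Gamma> \<Longrightarrow> dist (mat 1, 0) (rot \<gamma>, tvec \<gamma>) < e \<Longrightarrow> rot \<gamma> = mat 1 \<and> tvec \<gamma> = 0"
    unfolding isolated_in_dist_Ex_iff by auto
  \<comment> \<open>The errors below add up to \<open>e' * (2 + \<bar>R\<bar>)\<close>: one
    \<open>e'\<close> from the rotational part and \<open>e' + e' * \<bar>R\<bar>\<close> from the
    image of 0.\<close>
  define e' where "e' = e / (3 + \<bar>R\<bar>)"
  have e': "e' > 0" "e' * (3 + \<bar>R\<bar>) = e" using e(1) by (simp_all add: e'_def)
  obtain \<gamma> \<delta> where gd: "\<gamma> \<in> \<Gamma>" "norm (\<gamma> 0) \<le> R" "\<delta> \<in> \<Gamma>" "norm (\<delta> 0) \<le> R" "\<gamma> \<noteq> \<delta>"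
    "dist (h \<gamma>) (h \<delta>) < e'" using close[OF e'(1)] by auto
  have dr: "norm (rot \<gamma> - rot \<delta>) < e'" and d0: "norm (\<gamma> 0 - \<delta> 0) < e'"
    using gd(6) dist_fst_le[of "h \<gamma>" "h \<delta>"] dist_snd_le[of "h \<gamma>" "h \<delta>"]
    by (auto simp: h_def dist_norm)
  define \<beta> where "\<beta> = \<gamma> \<circ> inv_into UNIV \<delta>"
  have b: "\<beta> \<in> \<Gamma>" unfolding \<beta>_def using gd by (intro comp_in inv_in)
  have rb: "rot \<beta> = rot \<gamma> ** transpose (rot \<delta>)"
    unfolding \<beta>_def using gd by (simp add: rot_comp in_isom inv_in rot_inv)
  have "rot \<beta> - mat 1 = (rot \<gamma> - rot \<delta>) ** transpose (rot \<delta>)"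
    using orthogonal_matrix_mul_transpose[OF orthogonal_rot[OF gd(3)]]
    by (simp add: rb matrix_diff_rdistrib)
  then have nb: "norm (rot \<beta> - mat 1) < e'"
    using dr norm_matrix_mul_orthogonal[OF orthogonal_rot[OF gd(3)], of "rot \<gamma> - rot \<delta>"] by simp
  have "\<beta> (\<delta> 0) = \<gamma> 0" using inv_comp(1)[OF gd(3)] by (simp add: \<beta>_def fun_eq_iff)
  then have "\<beta> 0 = (\<gamma> 0 - \<delta> 0) - (rot \<beta> - mat 1) *v \<delta> 0"
    using isom_apply(2)[OF in_isom[OF b], of "\<delta> 0"] by (simp add: matrix_vector_mult_diff_rdistrib algebra_simps)
  then have "norm (\<beta> 0) \<le> norm (\<gamma> 0 - \<delta> 0) + norm ((rot \<beta> - mat 1) *v \<delta> 0)"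
    by (simp add: norm_triangle_ineq4)
  also have "norm ((rot \<beta> - mat 1) *v \<delta> 0) \<le> e' * \<bar>R\<bar>"
    by (rule order_trans[OF norm_matrix_vector_mult_le mult_mono]) (use nb gd e'(1) in auto)
  finally have b0: "norm (\<beta> 0) < e' + e' * \<bar>R\<bar>" using d0 by simp
  have "dist (mat 1, 0) (rot \<beta>, tvec \<beta>) \<le> norm (rot \<beta> - mat 1) + norm (tvec \<beta>)"
    using norm_Pair_le[of "mat 1 - rot \<beta>" "- tvec \<beta>"] by (simp add: dist_norm norm_minus_commute)
  also have "\<dots> < e' + (e' + e' * \<bar>R\<bar>)"
    using nb b0 norm_tvec[OF in_isom[OF b]] by simp
  also have "\<dots> \<le> e" using e' by (simp add: algebra_simps)
  finally have "rot \<beta> = mat 1" "tvec \<beta> = 0" using e(2)[OF b] by auto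
  then have "\<beta> = id"
    using isom_eqI[OF in_isom[OF b] in_isom[OF id_in]] isom_apply(3)[OF in_isom[OF b]] by simp
  then have "\<gamma> = \<delta>"
    unfolding \<beta>_def using inv_comp(1)[OF gd(3)] by (metis comp_assoc comp_id id_comp)
  with gd show False by simp
qed

text \<open>The images of the balls of radius k about 0 form an open cover of the orbit space.
  Finitely many suffice, and the largest radius works for all x because \<gamma> preserves
  distances.\<close>

lemma (in isometry_group) cocompact:
  assumes "compact_space (orbit_space \<Gamma>)"
  obtains R where "\<And>x. \<exists>\<gamma>\<in>\<Gamma>. norm (\<gamma> 0 - x) \<le> R"
proof -
  define U where "U k = orbit \<Gamma> ` ball 0 (real k)" for k
  have orb: "orbit \<Gamma> x = orbit \<Gamma> y \<longleftrightarrow> (\<exists>\<gamma>\<in>\<Gamma>. x = \<gamma> y)" for x y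
  proof
    assume "orbit \<Gamma> x = orbit \<Gamma> y"
    moreover have "x \<in> orbit \<Gamma> x" unfolding orbit_def using id_in by (auto intro!: exI[of _ id])
    ultimately show "\<exists>\<gamma>\<in>\<Gamma>. x = \<gamma> y" by (auto simp: orbit_def)
  next
    assume "\<exists>\<gamma>\<in>\<Gamma>. x = \<gamma> y"
    then obtain \<gamma> where g: "\<gamma> \<in> \<Gamma>" "x = \<gamma> y" by blast
    have "\<delta> x \<in> orbit \<Gamma> y" if "\<delta> \<in> \<Gamma>" for \<delta>
      unfolding orbit_def using comp_in[OF that g(1)] g(2) by (auto intro!: exI[of _ "\<delta> \<circ> \<gamma>"])
    moreover have "\<delta> y \<in> orbit \<Gamma> x" if "\<delta> \<in> \<Gamma>" for \<delta>
    proof -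
      have "\<delta> y = (\<delta> \<circ> inv_into UNIV \<gamma>) x" using inv_comp(1)[OF g(1)] g(2) by (simp add: fun_eq_iff)
      then show ?thesis unfolding orbit_def using comp_in[OF that inv_in[OF g(1)]] by blast
    qed
    ultimately show "orbit \<Gamma> x = orbit \<Gamma> y" by (auto simp: orbit_def)
  qed
  have pre: "orbit \<Gamma> -` U k = (\<Union>\<gamma>\<in>\<Gamma>. \<gamma> -` ball 0 (real k))" for k
  proof (intro equalityI subsetI)
    fix x assume "x \<in> orbit \<Gamma> -` U k"
    then obtain y where "norm y < real k" "orbit \<Gamma> y = orbit \<Gamma> x" by (auto simp: U_def)
    then show "x \<in> (\<Union>\<gamma>\<in>\<Gamma>. \<gamma> -` ball 0 (real k))" by (auto simp: orb)
  next
    fix x assume "x \<in> (\<Union>\<gamma>\<in>\<Gamma>. \<gamma> -` ball 0 (real k))"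
    then obtain \<gamma> where "\<gamma> \<in> \<Gamma>" "norm (\<gamma> x) < real k" by auto
    moreover from this have "orbit \<Gamma> (\<gamma> x) = orbit \<Gamma> x" by (auto simp: orb)
    ultimately show "x \<in> orbit \<Gamma> -` U k"
      unfolding U_def by (intro vimageI2 image_eqI[of _ _ "\<gamma> x"]) auto
  qed
  have cont: "continuous_on UNIV \<gamma>" if "\<gamma> \<in> \<Gamma>" for \<gamma>
  proof -
    have "dist (\<gamma> x) (\<gamma> y) = dist x y" for x y using in_isom[OF that] by (simp add: isom_def)
    then show ?thesis by (auto simp: continuous_on_iff)
  qed
  have "openin (orbit_space \<Gamma>) (U k)" for k
    unfolding openin_orbit_space pre using cont by (auto simp: U_def intro!: open_vimage)
  moreover have "topspace (orbit_space \<Gamma>) \<subseteq> \<Union> (range U)"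
  proof
    fix c assume "c \<in> topspace (orbit_space \<Gamma>)"
    then obtain x where "c = orbit \<Gamma> x"
      unfolding topspace_def using openin_orbit_space by blast
    moreover obtain k where "norm x < real k" using reals_Archimedean2 by blast
    ultimately have "c \<in> U k" by (auto simp: U_def)
    then show "c \<in> \<Union> (range U)" by blast
  qed
  ultimately obtain \<F> where F: "finite \<F>" "\<F> \<subseteq> range U" "topspace (orbit_space \<Gamma>) \<subseteq> \<Union> \<F>"
    using assms unfolding compact_space_alt by (metis (no_types, lifting) imageE)
  then obtain K where K: "finite K" "\<F> = U ` K" by (meson finite_subset_image)
  \<comment> \<open>\<open>insert 0\<close> keeps \<open>Max\<close> meaningful for empty
    \<open>K\<close>.\<close>
  define R where "R = real (Max (insert 0 K))"
  show thesis
  proof (rule that[of R])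
    fix x
    have "openin (orbit_space \<Gamma>) (range (orbit \<Gamma>))"
      by (auto simp: openin_orbit_space vimage_def)
    then have "orbit \<Gamma> x \<in> topspace (orbit_space \<Gamma>)" using openin_subset by blast
    then obtain k where "k \<in> K" "orbit \<Gamma> x \<in> U k" using F(3) K(2) by auto
    then obtain y where y: "norm y < real k" "orbit \<Gamma> x = orbit \<Gamma> y" by (auto simp: U_def)
    then obtain \<gamma> where g: "\<gamma> \<in> \<Gamma>" "x = \<gamma> y" using orb by blast
    have "dist (\<gamma> 0) (\<gamma> y) = dist 0 y" using in_isom[OF g(1)] by (simp add: isom_def)
    then have "norm (\<gamma> 0 - x) = norm y" using g by (simp add: dist_norm)
    moreover have "real k \<le> R" unfolding R_def using K(1) \<open>k \<in> K\<close> by simp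
    ultimately show "\<exists>\<gamma>\<in>\<Gamma>. norm (\<gamma> 0 - x) \<le> R" using g y by force
  qed
qed

section \<open>Bieberbach's first theorem\<close>

text \<open>The subspace \<open>E\<close> on which \<open>\<bar>Ax - x\<bar> / \<bar>x\<bar>\<close> is maximal; it is the top eigenspace of
  \<open>(A - 1)\<^sup>T(A - 1)\<close>, and \<open>A - 1\<close> is normal.\<close>
lemma max_displacement:
  fixes A :: "real ^ 'n ^ 'n"
  assumes A: "orthogonal_matrix A" "A \<noteq> mat 1"
  obtains E m c where "subspace E" "E \<noteq> {0}" "0 \<le> c" "c < m"
    "\<And>x. norm (A *v x - x) \<le> m * norm x"
    "\<And>x. x \<in> E \<Longrightarrow> norm (A *v x - x) = m * norm x \<and> A *v x - x \<in> E"
    "\<And>x. (\<forall>y\<in>E. x \<bullet> y = 0) \<Longrightarrow> norm (A *v x - x) \<le> c * norm x \<and> (\<forall>y\<in>E. (A *v x - x) \<bullet> y = 0)"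
proof -
  define D where "D = A - mat 1"
  \<comment> \<open>D' is the adjoint of D = A - 1. Both are polynomials in A and its inverse, hence
    commute, and this normality gives |D'x| = |Dx|.\<close>
  define D' where "D' = transpose A - mat 1"
  have D: "D *v x = A *v x - x" "D' *v x = transpose A *v x - x" for x
    by (simp_all add: D_def D'_def matrix_vector_mult_diff_rdistrib)
  have adj: "(D *v x) \<bullet> y = x \<bullet> (D' *v y)" for x y
    unfolding D inner_diff_left inner_diff_right transpose_matrix_vector
    by (metis dot_lmul_matrix inner_commute)
  have comm: "D *v (D' *v x) = D' *v (D *v x)" for x
    using A(1) by (simp add: D matrix_vector_mult_diff_distrib)
  have nD': "norm (D' *v x) = norm (D *v x)" for x
  proof -
    have "(norm (D' *v x))\<^sup>2 = (D *v (D' *v x)) \<bullet> x" by (simp add: adj power2_norm_eq_inner)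
    also have "\<dots> = (norm (D *v x))\<^sup>2"
      by (metis comm adj inner_commute power2_norm_eq_inner)
    finally show ?thesis by (simp add: power2_eq_iff_nonneg)
  qed
  have cont: "continuous_on S (\<lambda>x. norm (D *v x))" for S
    by (intro continuous_intros linear_continuous_on) (simp add: bounded_linear.bounded_linear linear_conv_bounded_linear[symmetric])
  have max_on: "\<exists>c\<ge>0. (\<forall>x\<in>W. norm (D *v x) \<le> c * norm x) \<and> (W \<noteq> {0} \<longrightarrow> (\<exists>x\<in>W. x \<noteq> 0 \<and> norm (D *v x) = c * norm x))"
    if W: "subspace W" for W
  proof (cases "W = {0}")
    case True
    then show ?thesis by (intro exI[of _ 0]) auto
  next
    case False
    then obtain w where w: "w \<in> W" "w \<noteq> 0" using subspace_0[OF W] by blast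
    have "compact (W \<inter> sphere 0 1)" by (intro closed_Int_compact closed_subspace W compact_sphere)
    moreover have "(1 / norm w) *\<^sub>R w \<in> W \<inter> sphere 0 1" using w by (simp add: subspace_scale[OF W])
    ultimately obtain x where x: "x \<in> W \<inter> sphere 0 1"
      "\<And>y. y \<in> W \<inter> sphere 0 1 \<Longrightarrow> norm (D *v y) \<le> norm (D *v x)"
      using continuous_attains_sup[OF _ _ cont] by (metis empty_iff)
    have "norm (D *v y) \<le> norm (D *v x) * norm y" if "y \<in> W" for y
    proof (cases "y = 0")
      case False
      have "(1 / norm y) *\<^sub>R y \<in> W \<inter> sphere 0 1" using that False by (simp add: subspace_scale[OF W])
      from x(2)[OF this] show ?thesis using False
        by (simp add: matrix_vector_mult_scaleR pos_divide_le_eq)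
    qed simp
    then show ?thesis using x(1) by (intro exI[of _ "norm (D *v x)"]) force
  qed
  obtain m where m: "m \<ge> 0" "\<And>x. norm (D *v x) \<le> m * norm x" "\<exists>x. x \<noteq> 0 \<and> norm (D *v x) = m * norm x"
  proof -
    have "(UNIV :: (real ^ 'n) set) \<noteq> {0}" by (metis UNIV_I axis_eq_0_iff singletonD zero_neq_one)
    then show ?thesis using max_on[OF subspace_UNIV] that by auto
  qed
  have "m \<noteq> 0"
  proof
    assume "m = 0"
    then have "A *v x = x" for x using m(2)[of x] by (simp add: D)
    then show False using A(2) by (simp add: matrix_eq)
  qed
  then have "m > 0" using m(1) by simp
  define E where "E = {x. D' *v (D *v x) = m\<^sup>2 *\<^sub>R x}"
  have Eiff: "x \<in> E \<longleftrightarrow> norm (D *v x) = m * norm x" for x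
  proof
    assume "x \<in> E"
    then have "(norm (D *v x))\<^sup>2 = (m * norm x)\<^sup>2"
      by (simp add: power2_norm_eq_inner adj E_def power_mult_distrib)
    then show "norm (D *v x) = m * norm x" using m(1) by (simp add: power2_eq_iff_nonneg)
  next
    assume n: "norm (D *v x) = m * norm x"
    \<comment> \<open>Expanding the square and using |D'Dx| = |DDx| \<le> m|Dx| = m^2 |x| bounds it
      by 0: attaining the maximum forces the eigenvector equation.\<close>
    have "(norm (D' *v (D *v x) - m\<^sup>2 *\<^sub>R x))\<^sup>2
        = (norm (D' *v (D *v x)))\<^sup>2 - 2 * m\<^sup>2 * (norm (D *v x))\<^sup>2 + m^4 * (norm x)\<^sup>2"
    proof -
      have e: "(D' *v (D *v x)) \<bullet> x = (D *v x) \<bullet> (D *v x)"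
        by (metis adj inner_commute)
      show ?thesis
        unfolding power2_norm_eq_inner inner_diff_left inner_diff_right
        using e by (simp add: inner_commute algebra_simps power4_eq_xxxx power2_eq_square)
    qed
    also have "(norm (D' *v (D *v x)))\<^sup>2 \<le> m\<^sup>2 * (norm (D *v x))\<^sup>2"
      using power_mono[OF m(2)[of "D *v x"], of 2] by (simp add: nD' power_mult_distrib)
    also have "m\<^sup>2 * (norm (D *v x))\<^sup>2 - 2 * m\<^sup>2 * (norm (D *v x))\<^sup>2 + m^4 * (norm x)\<^sup>2 = 0"
      by (simp add: n power_mult_distrib power4_eq_xxxx power2_eq_square)
    finally show "x \<in> E" by (simp add: E_def)
  qed
  have subE: "subspace E"
    unfolding E_def subspace_def
    by (simp add: matrix_vector_right_distrib scaleR_add_right matrix_vector_mult_scaleR)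
  have DE: "D *v x \<in> E" "D' *v x \<in> E" if "x \<in> E" for x
    using that comm by (simp_all add: E_def) (metis matrix_vector_mult_scaleR)+
  define W where "W = {x. \<forall>y\<in>E. x \<bullet> y = 0}"
  have subW: "subspace W" by (auto simp: W_def subspace_def inner_add_left)
  obtain c where c: "c \<ge> 0" "\<And>x. x \<in> W \<Longrightarrow> norm (D *v x) \<le> c * norm x"
    "W \<noteq> {0} \<Longrightarrow> \<exists>x\<in>W. x \<noteq> 0 \<and> norm (D *v x) = c * norm x"
    using max_on[OF subW] by blast
  \<comment> \<open>If E is the whole space, its complement carries no maximum and 0 serves as the
    bound. Otherwise a maximizing vector of the complement lies outside E, so its ratio is below
    m.\<close>
  obtain c' where c': "0 \<le> c'" "c' < m" "\<And>x. x \<in> W \<Longrightarrow> norm (D *v x) \<le> c' * norm x"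
  proof (cases "W = {0}")
    case True
    then show ?thesis using that[of 0] \<open>m > 0\<close> by simp
  next
    case False
    then obtain x where x: "x \<in> W" "x \<noteq> 0" "norm (D *v x) = c * norm x" using c(3) by blast
    have "x \<notin> E" using x by (auto simp: W_def)
    then have "c * norm x < m * norm x" using m(2)[of x] Eiff[of x] x(3) by simp
    then show ?thesis using that[OF c(1) _ c(2)] x(2) by simp
  qed
  show thesis
  proof (rule that[OF subE _ c'(1,2)])
    show "E \<noteq> {0}" using m(3) Eiff by auto
    show "norm (A *v x - x) \<le> m * norm x" for x using m(2) by (simp add: D)
    show "norm (A *v x - x) = m * norm x \<and> A *v x - x \<in> E" if "x \<in> E" for x
      using that Eiff DE(1) by (simp add: D)
    show "norm (A *v x - x) \<le> c' * norm x \<and> (\<forall>y\<in>E. (A *v x - x) \<bullet> y = 0)"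
      if "\<forall>y\<in>E. x \<bullet> y = 0" for x
    proof -
      have "(D *v x) \<bullet> y = 0" if "y \<in> E" for y
        using \<open>\<forall>y\<in>E. x \<bullet> y = 0\<close> DE(2)[OF that] by (simp add: adj)
      moreover have "x \<in> W" using that by (simp add: W_def)
      ultimately show ?thesis using c'(3) by (simp add: D)
    qed
  qed
qed

text \<open>A bound on the operator norm of A - 1. It is measured by the same ratio |Ax - x| / |x|
  whose maximum singles out E in \<open>max_displacement\<close>.\<close>

definition near_id :: "real \<Rightarrow> real ^ 'n ^ 'n \<Rightarrow> bool" where
  "near_id e A \<longleftrightarrow> (\<forall>x. norm (A *v x - x) \<le> e * norm x)"

text \<open>Cocompactness supplies elements moving 0 close to ku for every k. Their rotational parts
  accumulate somewhere in the compact orthogonal group, so the quotient of two late ones is almost a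
  pure translation along u.\<close>

lemma (in isometry_group) elements_in_direction:
  assumes "compact_space (orbit_space \<Gamma>)" "norm u = 1" "e > 0"
  obtains \<beta> t where "\<beta> \<in> \<Gamma>" "near_id e (rot \<beta>)" "t > 0" "norm (\<beta> 0 - t *\<^sub>R u) \<le> e * t"
proof -
  obtain R where "\<And>x. \<exists>\<gamma>\<in>\<Gamma>. norm (\<gamma> 0 - x) \<le> R" using cocompact[OF assms(1)] by blast
  then have "\<forall>k. \<exists>\<gamma>\<in>\<Gamma>. norm (\<gamma> 0 - real k *\<^sub>R u) \<le> R" by blast
  then obtain g where g: "\<And>k. g k \<in> \<Gamma>" "\<And>k. norm (g k 0 - real k *\<^sub>R u) \<le> R" by metis
  have "bounded (range (\<lambda>k. rot (g k)))"
    unfolding bounded_iff by (rule exI[of _ "norm (mat 1 :: real^'n^'n)"])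
      (auto simp: norm_orthogonal_matrix orthogonal_rot g)
  then obtain l r where r: "strict_mono r" "(\<lambda>k. rot (g (r k))) \<longlonglongrightarrow> l"
    using bounded_imp_convergent_subsequence[of "\<lambda>k. rot (g k)"] by (auto simp: o_def)
  then have "Cauchy (\<lambda>k. rot (g (r k)))" by (simp add: LIMSEQ_imp_Cauchy)
  then obtain N where N: "\<And>i j. i \<ge> N \<Longrightarrow> j \<ge> N \<Longrightarrow> norm (rot (g (r i)) - rot (g (r j))) < e"
    using assms(3) unfolding Cauchy_iff by blast
  define i where "i = r N"
  \<comment> \<open>The fixed element \<open>g i\<close> costs an error of at most
    \<open>R + norm (g i 0)\<close>; an index \<open>j\<close> beyond \<open>k\<close> makes the
    displacement long enough for this to be at most \<open>e * j\<close>.\<close>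
  obtain k where k: "R + norm (g i 0) \<le> e * real k"
    using reals_Archimedean2[of "(R + norm (g i 0)) / e"] assms(3)
    by (metis less_eq_real_def mult.commute pos_divide_less_eq)
  define j where "j = r (max N (Suc k))"
  have j: "j \<ge> Suc k" unfolding j_def using seq_suble[OF r(1), of "max N (Suc k)"] by simp
  have rij: "norm (rot (g j) - rot (g i)) < e" unfolding i_def j_def by (rule N) auto
  define \<beta> where "\<beta> = g j \<circ> inv_into UNIV (g i)"
  have b: "\<beta> \<in> \<Gamma>" unfolding \<beta>_def by (intro comp_in inv_in g)
  have rb: "rot \<beta> = rot (g j) ** transpose (rot (g i))"
    unfolding \<beta>_def using g by (simp add: rot_comp in_isom inv_in rot_inv)
  have oi: "orthogonal_matrix (rot (g i))" using g orthogonal_rot by blast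
  have near: "near_id e (rot \<beta>)"
    unfolding near_id_def
  proof
    fix x
    have "rot \<beta> *v x - x = (rot \<beta> - mat 1) *v x" by (simp add: matrix_vector_mult_diff_rdistrib)
    moreover have "rot \<beta> - mat 1 = (rot (g j) - rot (g i)) ** transpose (rot (g i))"
      using orthogonal_matrix_mul_transpose[OF oi] by (simp add: rb matrix_diff_rdistrib)
    then have "norm (rot \<beta> - mat 1) < e" using rij norm_matrix_mul_orthogonal[OF oi, of "rot (g j) - rot (g i)"] by simp
    then have "norm (rot \<beta> - mat 1) * norm x \<le> e * norm x" by (intro mult_right_mono) auto
    ultimately show "norm (rot \<beta> *v x - x) \<le> e * norm x"
      using norm_matrix_vector_mult_le[of "rot \<beta> - mat 1" x] by simp
  qed
  have "\<beta> (g i 0) = g j 0" using inv_comp(1)[OF g(1)] by (simp add: \<beta>_def fun_eq_iff)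
  then have "g j 0 = rot \<beta> *v g i 0 + \<beta> 0" using isom_apply(2)[OF in_isom[OF b], of "g i 0"] by simp
  then have "\<beta> 0 - real j *\<^sub>R u = (g j 0 - real j *\<^sub>R u) - rot \<beta> *v g i 0" by simp
  then have "norm (\<beta> 0 - real j *\<^sub>R u) \<le> norm (g j 0 - real j *\<^sub>R u) + norm (rot \<beta> *v g i 0)"
    by (simp only: norm_triangle_ineq4)
  also have "\<dots> \<le> R + norm (g i 0)"
    using g(2)[of j] orthogonal_matrix_norm[OF orthogonal_rot[OF b]] by simp
  also have "\<dots> \<le> e * real j" 
  proof -
    have "e * real k \<le> e * real j" using j assms(3) by simp
    then show ?thesis using k by simp
  qed
  finally show thesis using that[OF b near, of "real j"] j by simp
qed

text \<open>The commutator of isometries whose rotational parts are near the identity has a rotational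
  part still nearer to it. Take \<open>\<alpha>\<close> with nontrivial \<open>A\<close> near \<open>1\<close> and with the least \<open>\<bar>\<alpha> 0\<bar>\<close>, then
  \<open>\<beta>\<close> with the least \<open>\<bar>\<beta> 0\<bar>\<close> pointing roughly into \<open>E\<close>: the commutator is shorter than
  \<open>\<beta>\<close> and has the same properties.\<close>
lemma (in isometry_group) near_id_imp_translation:
  assumes disc: "discrete_group \<Gamma>" and coc: "compact_space (orbit_space \<Gamma>)"
    and \<alpha>: "\<alpha> \<in> \<Gamma>" "near_id (1/2) (rot \<alpha>)"
  shows "rot \<alpha> = mat 1"
proof (rule ccontr)
  \<comment> \<open>Only finitely many elements move 0 by at most a given amount, so |\<gamma> 0|
    attains a minimum on every nonempty subset of \<Gamma>.\<close>
  have minimal: "\<exists>\<gamma>\<in>\<Gamma>. P \<gamma> \<and> (\<forall>\<delta>\<in>\<Gamma>. P \<delta> \<longrightarrow> norm (\<gamma> 0) \<le> norm (\<delta> 0))"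
    if "\<gamma>0 \<in> \<Gamma>" "P \<gamma>0" for P \<gamma>0
  proof -
    let ?S = "{\<gamma>\<in>{\<gamma>\<in>\<Gamma>. norm (\<gamma> 0) \<le> norm (\<gamma>0 0)}. P \<gamma>}"
    have S: "finite ?S"
      by (rule finite_subset[OF _ finite_bounded[OF disc, of "norm (\<gamma>0 0)"]]) auto
    moreover have "?S \<noteq> {}" using that by auto
    ultimately have g: "arg_min_on (\<lambda>\<gamma>. norm (\<gamma> 0)) ?S \<in> ?S" (is "?g \<in> _")
      by (rule arg_min_if_finite(1))
    have "norm (?g 0) \<le> norm (\<delta> 0)" if "\<delta> \<in> \<Gamma>" "P \<delta>" for \<delta>
    proof (cases "norm (\<delta> 0) \<le> norm (\<gamma>0 0)")
      case True
      show ?thesis by (rule arg_min_least[OF S \<open>?S \<noteq> {}\<close>]) (use that True in simp)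
    qed (use g in simp)
    then show ?thesis using g by blast
  qed
  assume "rot \<alpha> \<noteq> mat 1"
  then obtain \<alpha>' where a': "\<alpha>' \<in> \<Gamma>" "near_id (1/2) (rot \<alpha>')" "rot \<alpha>' \<noteq> mat 1"
    "\<And>\<delta>. \<delta> \<in> \<Gamma> \<Longrightarrow> near_id (1/2) (rot \<delta>) \<Longrightarrow> rot \<delta> \<noteq> mat 1 \<Longrightarrow> norm (\<alpha>' 0) \<le> norm (\<delta> 0)"
    using minimal[of \<alpha> "\<lambda>\<gamma>. near_id (1/2) (rot \<gamma>) \<and> rot \<gamma> \<noteq> mat 1"] \<alpha> by blast
  define A where "A = rot \<alpha>'"
  have oA: "orthogonal_matrix A" unfolding A_def by (rule orthogonal_rot[OF a'(1)])
  obtain E m c where E: "subspace E" "E \<noteq> {0}" "0 \<le> c" "c < m"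
    "\<And>x. norm (A *v x - x) \<le> m * norm x"
    "\<And>x. x \<in> E \<Longrightarrow> norm (A *v x - x) = m * norm x \<and> A *v x - x \<in> E"
    "\<And>x. (\<forall>y\<in>E. x \<bullet> y = 0) \<Longrightarrow> norm (A *v x - x) \<le> c * norm x \<and> (\<forall>y\<in>E. (A *v x - x) \<bullet> y = 0)"
    by (rule max_displacement[OF oA a'(3)[folded A_def]]) blast
  obtain u where u: "u \<in> E" "norm u = 1"
  proof -
    obtain w where "w \<in> E" "w \<noteq> 0" using E(1,2) subspace_0 by blast
    then show ?thesis using that[of "(1 / norm w) *\<^sub>R w"] E(1) by (simp add: subspace_scale)
  qed
  have m2: "m \<le> 1/2"
  proof -
    have "norm (A *v u - u) \<le> 1/2 * norm u" using a'(2) unfolding near_id_def A_def by blast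
    then show ?thesis using E(6)[OF u(1)] u(2) by simp
  qed
  \<comment> \<open>The remainder \<open>r\<close> below satisfies |r| < 6 \<eta> |e|, while 2|r| <
    (m - c)|e| is wanted, so any denominator from 12 on would do. The bound 1/32 comes from m \<le>
    1/2 and keeps m + 3 \<eta> below 1.\<close>
  define \<eta> where "\<eta> = (m - c) / 16"
  have eta: "\<eta> > 0" "16 * \<eta> = m - c" "\<eta> \<le> 1/32" using E(3,4) m2 by (simp_all add: \<eta>_def)
  have decomp: "\<exists>e p. x = e + p \<and> e \<in> E \<and> (\<forall>y\<in>E. p \<bullet> y = 0) \<and> norm e \<le> norm x \<and> norm p \<le> norm x" for x
  proof -
    obtain e p where ep: "e \<in> span E" "\<And>w. w \<in> span E \<Longrightarrow> orthogonal p w" "x = e + p"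
      using orthogonal_subspace_decomp_exists by blast
    have sE: "span E = E" using E(1) by (simp add: span_eq_iff)
    have "(norm x)\<^sup>2 = (norm e)\<^sup>2 + (norm p)\<^sup>2"
      using ep by (auto simp: orthogonal_commute intro: norm_add_Pythagorean)
    then have "norm e \<le> norm x" "norm p \<le> norm x"
      by (auto intro: power2_le_imp_le)
    then show ?thesis using ep sE by (auto simp: orthogonal_def)
  qed
  define P where "P \<beta> \<longleftrightarrow> near_id \<eta> (rot \<beta>) \<and>
    (\<exists>e p. \<beta> 0 = e + p \<and> e \<in> E \<and> (\<forall>y\<in>E. p \<bullet> y = 0) \<and> norm p < norm e)" for \<beta> :: "'n isometry"
  obtain \<beta>0 t where b0: "\<beta>0 \<in> \<Gamma>" "near_id \<eta> (rot \<beta>0)" "t > 0" "norm (\<beta>0 0 - t *\<^sub>R u) \<le> \<eta> * t"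
    using elements_in_direction[OF coc u(2) eta(1)] by blast
  have "P \<beta>0"
  proof -
    obtain e p where ep: "\<beta>0 0 - t *\<^sub>R u = e + p" "e \<in> E" "\<forall>y\<in>E. p \<bullet> y = 0"
      "norm e \<le> norm (\<beta>0 0 - t *\<^sub>R u)" "norm p \<le> norm (\<beta>0 0 - t *\<^sub>R u)" using decomp by blast
    have "norm (t *\<^sub>R u) \<le> norm (t *\<^sub>R u + e) + norm e" by (metis add_diff_cancel_right' norm_triangle_ineq4)
    then have "t \<le> norm (t *\<^sub>R u + e) + \<eta> * t" using ep(4) b0(3,4) u(2) by simp
    moreover have "\<eta> * t \<le> t / 32" using eta(3) b0(3) by simp
    \<comment> \<open>The part in E has length at least 31t/32, the orthogonal part at most
      t/32.\<close>
    ultimately have "norm p < norm (t *\<^sub>R u + e)" using ep(5) b0(3,4) by linarith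
    moreover have "t *\<^sub>R u + e \<in> E" using E(1) u(1) ep(2) by (simp add: subspace_add subspace_scale)
    moreover have "\<beta>0 0 = (t *\<^sub>R u + e) + p" using ep(1) by (simp add: algebra_simps)
    ultimately show ?thesis unfolding P_def using b0(2) ep(3) by blast
  qed
  then obtain \<beta> where b: "\<beta> \<in> \<Gamma>" "P \<beta>" "\<And>\<delta>. \<delta> \<in> \<Gamma> \<Longrightarrow> P \<delta> \<Longrightarrow> norm (\<beta> 0) \<le> norm (\<delta> 0)"
    using minimal[OF b0(1), of P] by blast
  define B where "B = rot \<beta>"
  have oB: "orthogonal_matrix B" unfolding B_def by (rule orthogonal_rot[OF b(1)])
  have nB: "norm (B *v x - x) \<le> \<eta> * norm x" for x using b(2) by (simp add: P_def near_id_def B_def)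
  obtain e p where ep: "\<beta> 0 = e + p" "e \<in> E" "\<forall>y\<in>E. p \<bullet> y = 0" "norm p < norm e"
    using b(2) unfolding P_def by blast
  define \<delta> where "\<delta> = \<alpha>' \<circ> \<beta> \<circ> inv_into UNIV \<alpha>' \<circ> inv_into UNIV \<beta>"
  have d: "\<delta> \<in> \<Gamma>" unfolding \<delta>_def by (intro comp_in inv_in a'(1) b(1))
  define C where "C = rot \<delta>"
  have C: "C *v (B *v (A *v x)) = A *v (B *v x)" for x
  proof -
    have "rot \<delta> = A ** B ** transpose A ** transpose B"
      unfolding \<delta>_def A_def B_def using a'(1) b(1)
      by (simp add: rot_comp in_isom inv_in comp_in rot_inv del: comp_apply)
    then show ?thesis using oA oB by (simp add: C_def flip: matrix_vector_mul_assoc)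
  qed
  have nC: "norm (C *v x - x) \<le> 2 * m * \<eta> * norm x" for x
  proof -
    define y where "y = transpose A *v (transpose B *v x)"
    have x: "x = B *v (A *v y)" using oA oB by (simp add: y_def)
    have ny: "norm y = norm x" using oA oB by (simp add: x orthogonal_matrix_norm)
    have "C *v x - x = A *v (B *v y) - B *v (A *v y)" by (simp add: x C)
    \<comment> \<open>AB - BA = (A - 1)(B - 1) - (B - 1)(A - 1), so the smallness of both factors
      counts.\<close>
    also have "\<dots> = (A *v (B *v y - y) - (B *v y - y)) - (B *v (A *v y - y) - (A *v y - y))"
      by (simp add: matrix_vector_mult_diff_distrib)
    finally have "norm (C *v x - x) \<le> norm (A *v (B *v y - y) - (B *v y - y)) + norm (B *v (A *v y - y) - (A *v y - y))"
      by (simp only: norm_triangle_ineq4)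
    also have "\<dots> \<le> m * norm (B *v y - y) + \<eta> * norm (A *v y - y)"
      by (intro add_mono E(5) nB)
    also have "\<dots> \<le> m * (\<eta> * norm y) + \<eta> * (m * norm y)"
      using E(3,4) eta(1) by (intro add_mono mult_left_mono E(5) nB) auto
    finally show ?thesis by (simp add: ny algebra_simps)
  qed
  have nC': "norm (C *v x - x) \<le> \<eta> * norm x" for x
  proof -
    have "2 * m * \<eta> \<le> 1 * \<eta>" using m2 eta(1) by (intro mult_right_mono) auto
    from mult_right_mono[OF this norm_ge_zero[of x]] show ?thesis using nC[of x] by simp
  qed
  \<comment> \<open>What is left of \<delta> 0 besides (A - 1)(\<beta> 0). Each term carries a
    factor C - 1 or B - 1, hence is of order \<eta>.\<close>
  define r where "r = - (C *v (B *v \<alpha>' 0 + \<beta> 0) - (B *v \<alpha>' 0 + \<beta> 0)) - (B *v \<alpha>' 0 - \<alpha>' 0)"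
  have d0: "\<delta> 0 = (A *v \<beta> 0 - \<beta> 0) + r"
  proof -
    have "\<delta> (\<beta> (\<alpha>' 0)) = \<alpha>' (\<beta> 0)"
      using fun_cong[OF inv_comp(1)[OF a'(1)], of 0] fun_cong[OF inv_comp(1)[OF b(1)], of "\<alpha>' 0"]
      by (simp add: \<delta>_def)
    moreover have "\<beta> (\<alpha>' 0) = B *v \<alpha>' 0 + \<beta> 0" "\<alpha>' (\<beta> 0) = A *v \<beta> 0 + \<alpha>' 0"
      "\<delta> (\<beta> (\<alpha>' 0)) = C *v \<beta> (\<alpha>' 0) + \<delta> 0"
      unfolding A_def B_def C_def
      using isom_apply(2)[OF in_isom[OF b(1)], of "\<alpha>' 0"] isom_apply(2)[OF in_isom[OF a'(1)], of "\<beta> 0"]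
        isom_apply(2)[OF in_isom[OF d], of "\<beta> (\<alpha>' 0)"] by blast+
    ultimately have "C *v (B *v \<alpha>' 0 + \<beta> 0) + \<delta> 0 = A *v \<beta> 0 + \<alpha>' 0" by simp
    then show ?thesis by (simp add: r_def algebra_simps)
  qed
  have r: "norm r \<le> 3 * \<eta> * norm (\<beta> 0)"
  \<comment> \<open>Minimality of \<alpha>' compares |\<alpha>' 0| with |\<beta> 0| only if B is not
    the identity. If it is, then so is C, and r vanishes.\<close>
  proof (cases "B = mat 1")
    case True
    have "C *v x = x" for x
    proof -
      have "C *v (A *v (transpose A *v x)) = A *v (transpose A *v x)" using C[of "transpose A *v x"] True by simp
      then show ?thesis using oA by simp
    qed
    then have "r = 0" by (simp add: r_def True)
    then show ?thesis using eta(1) by simp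
  next
    case False
    have "near_id (1/2) (rot \<beta>)"
      unfolding near_id_def
    proof
      fix x show "norm (rot \<beta> *v x - x) \<le> 1 / 2 * norm x"
        using nB[of x] eta(3) mult_right_mono[of \<eta> "1/2" "norm x"] by (simp add: B_def)
    qed
    then have ab: "norm (\<alpha>' 0) \<le> norm (\<beta> 0)" using a'(4)[OF b(1)] False by (simp add: B_def)
    have "norm r \<le> norm (C *v (B *v \<alpha>' 0 + \<beta> 0) - (B *v \<alpha>' 0 + \<beta> 0)) + norm (B *v \<alpha>' 0 - \<alpha>' 0)"
      unfolding r_def by (metis norm_minus_cancel norm_triangle_ineq4)
    also have "\<dots> \<le> \<eta> * norm (B *v \<alpha>' 0 + \<beta> 0) + \<eta> * norm (\<alpha>' 0)"
      by (intro add_mono nC' nB)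
    also have "\<dots> \<le> \<eta> * (norm (\<beta> 0) + norm (\<beta> 0)) + \<eta> * norm (\<beta> 0)"
      using eta(1) ab norm_triangle_ineq[of "B *v \<alpha>' 0" "\<beta> 0"]
      by (intro add_mono mult_left_mono) (auto simp: orthogonal_matrix_norm[OF oB])
    finally show ?thesis by (simp add: algebra_simps)
  qed
  have nb: "norm (\<beta> 0) < 2 * norm e" using ep(1,4) norm_triangle_ineq[of e p] by simp
  obtain r1 r2 where rr: "r = r1 + r2" "r1 \<in> E" "\<forall>y\<in>E. r2 \<bullet> y = 0" "norm r1 \<le> norm r" "norm r2 \<le> norm r"
    using decomp by blast
  have "P \<delta>"
    unfolding P_def
  proof (intro conjI exI)
    show "near_id \<eta> (rot \<delta>)" using nC' by (simp add: near_id_def C_def)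
    show "\<delta> 0 = ((A *v e - e) + r1) + ((A *v p - p) + r2)"
      by (simp add: d0 rr(1) ep(1) matrix_vector_right_distrib)
    show "(A *v e - e) + r1 \<in> E" using E(6)[OF ep(2)] rr(2) E(1) by (simp add: subspace_add)
    show "\<forall>y\<in>E. ((A *v p - p) + r2) \<bullet> y = 0" using E(7)[OF ep(3)] rr(3) by (simp add: inner_add_left)
    \<comment> \<open>A - 1 stretches E exactly by m and the complement by at most c < m, so it
      widens the lead of the part in E; \<eta> is small enough for this gain to outweigh r.\<close>
    have "norm ((A *v p - p) + r2) \<le> c * norm p + norm r"
      using norm_triangle_ineq[of "A *v p - p" r2] E(7)[OF ep(3)] rr(5) by linarith
    also have "\<dots> \<le> c * norm e + norm r" using E(3) ep(4) by (simp add: mult_left_mono)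
    also have "\<dots> < m * norm e - norm r"
    proof -
      have "3 * \<eta> * norm (\<beta> 0) < 3 * \<eta> * (2 * norm e)" using eta(1) nb by simp
      then have "norm r < 6 * (\<eta> * norm e)" using r by (simp add: mult_ac)
      moreover have "0 \<le> \<eta> * norm e" using eta(1) by simp
      ultimately have "2 * norm r < 16 * \<eta> * norm e" by (simp add: mult_ac)
      then show ?thesis unfolding eta(2) left_diff_distrib by linarith
    qed
    also have "\<dots> \<le> norm ((A *v e - e) + r1)"
      using norm_diff_ineq[of "A *v e - e" r1] E(6)[OF ep(2)] rr(4) by linarith
    finally show "norm ((A *v p - p) + r2) < norm ((A *v e - e) + r1)" .
  qed
  \<comment> \<open>By m + 3 \<eta> < 1 the commutator moves 0 less than \<beta> does unless \<beta>
    0 = 0, and the latter contradicts |p| < |e|.\<close>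
  then have "norm (\<beta> 0) \<le> norm (\<delta> 0)" by (rule b(3)[OF d])
  also have "\<dots> \<le> m * norm (\<beta> 0) + 3 * \<eta> * norm (\<beta> 0)"
    unfolding d0 using norm_triangle_ineq[of "A *v \<beta> 0 - \<beta> 0" r] E(5)[of "\<beta> 0"] r by linarith
  also have "\<dots> \<le> 1/2 * norm (\<beta> 0) + 3/32 * norm (\<beta> 0)"
    using m2 eta(3) by (intro add_mono mult_right_mono) auto
  finally have "norm (\<beta> 0) \<le> 0" by simp
  then have "e = - p" using ep(1) by (simp add: eq_neg_iff_add_eq_0)
  then show False using ep(4) by simp
qed

text \<open>A unit vector u orthogonal to the lattice would be followed closely by some \<beta> with
  rotational part near the identity. Such a \<beta> is a translation, so \<beta> 0 is a lattice
  vector that is orthogonal to u and yet close to tu.\<close>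

lemma (in isometry_group) span_transl_lattice:
  assumes disc: "discrete_group \<Gamma>" and coc: "compact_space (orbit_space \<Gamma>)"
  shows "span (transl_lattice \<Gamma>) = UNIV"
proof (rule ccontr)
  assume ne: "span (transl_lattice \<Gamma>) \<noteq> UNIV"
  then have "span (transl_lattice \<Gamma>) \<subset> span UNIV" by auto
  then obtain w where w: "w \<noteq> 0" "\<And>y. y \<in> span (transl_lattice \<Gamma>) \<Longrightarrow> orthogonal w y"
    using orthogonal_to_subspace_exists_gen by metis
  define u where "u = (1 / norm w) *\<^sub>R w"
  have u: "norm u = 1" using w(1) by (simp add: u_def)
  obtain \<beta> t where b: "\<beta> \<in> \<Gamma>" "near_id (1/2) (rot \<beta>)" "t > 0" "norm (\<beta> 0 - t *\<^sub>R u) \<le> 1/2 * t"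
    using elements_in_direction[OF coc u, of "1/2"] by auto
  have "rot \<beta> = mat 1" by (rule near_id_imp_translation[OF disc coc b(1,2)])
  then have "\<beta> = transl (\<beta> 0)" by (rule isom_transl[OF in_isom[OF b(1)]])
  then have "\<beta> 0 \<in> transl_lattice \<Gamma>" using b(1) by (simp add: transl_lattice_def)
  then have "orthogonal w (\<beta> 0)" by (intro w(2) span_base)
  then have "u \<bullet> \<beta> 0 = 0" by (simp add: orthogonal_def u_def)
  moreover have "u \<bullet> u = 1" using u by (simp add: dot_square_norm)
  ultimately have "u \<bullet> (\<beta> 0 - t *\<^sub>R u) = - t" by (simp add: inner_diff_right)
  then have "t \<le> norm (\<beta> 0 - t *\<^sub>R u)" using Cauchy_Schwarz_ineq2[of u "\<beta> 0 - t *\<^sub>R u"] u by simp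
  then show False using b(3,4) by simp
qed

lemma (in isometry_group) rot_lattice:
  assumes "\<gamma> \<in> \<Gamma>" "l \<in> transl_lattice \<Gamma>"
  shows "rot \<gamma> *v l \<in> transl_lattice \<Gamma>"
proof -
  have "transl (rot \<gamma> *v l) = (\<gamma> \<circ> transl l) \<circ> inv_into UNIV \<gamma>"
    unfolding comp_transl[OF in_isom[OF assms(1)]] comp_assoc by (simp add: inv_comp[OF assms(1)])
  also have "\<dots> \<in> \<Gamma>"
    using assms by (intro comp_in inv_in) (simp_all add: transl_lattice_def)
  finally show ?thesis by (simp add: transl_lattice_def)
qed

text \<open>A rotational part permutes the lattice vectors of given length, and is determined by its
  values on a spanning set.\<close>
lemma (in isometry_group) finite_holonomy:
  assumes disc: "discrete_group \<Gamma>" and coc: "compact_space (orbit_space \<Gamma>)"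
  shows "finite (holonomy \<Gamma>)"
proof -
  obtain Bs where Bs: "Bs \<subseteq> transl_lattice \<Gamma>" "independent Bs" "transl_lattice \<Gamma> \<subseteq> span Bs"
    using maximal_independent_subset by blast
  have span: "span Bs = UNIV"
    using Bs span_transl_lattice[OF disc coc] by (metis span_mono span_span top.extremum_unique)
  have finB: "finite Bs" by (rule independent_imp_finite[OF Bs(2)])
  define R where "R = Max (insert 0 (norm ` Bs))"
  have R: "norm l \<le> R" if "l \<in> Bs" for l unfolding R_def using finB that by simp
  define S where "S = {l \<in> transl_lattice \<Gamma>. norm l \<le> R}"
  have "transl ` S \<subseteq> {\<gamma>\<in>\<Gamma>. norm (\<gamma> 0) \<le> R}" by (auto simp: S_def transl_lattice_def transl_def)
  then have "finite (transl ` S)" using finite_bounded[OF disc] finite_subset by blast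
  moreover have "inj transl" by (rule injI) (metis transl_def add_0)
  ultimately have "finite S" using finite_imageD inj_on_subset by blast
  then have fin: "finite (Bs \<rightarrow>\<^sub>E S)" using finB by (intro finite_PiE)
  define \<Phi> where "\<Phi> B = restrict ((*v) B) Bs" for B :: "real ^ 'n ^ 'n"
  have "\<Phi> ` holonomy \<Gamma> \<subseteq> Bs \<rightarrow>\<^sub>E S"
    using Bs(1) R by (auto simp: \<Phi>_def holonomy_def S_def rot_lattice orthogonal_matrix_norm orthogonal_rot)
  moreover have "inj_on \<Phi> (holonomy \<Gamma>)"
  proof (rule inj_onI)
    fix B B' assume "\<Phi> B = \<Phi> B'"
    then have "B *v l = B' *v l" if "l \<in> Bs" for l using that by (metis \<Phi>_def restrict_apply')
    then have "B *v l = B' *v l" for l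
      using linear_eq_on_span[of "(*v) B" "(*v) B'" Bs l] span by simp
    then show "B = B'" by (simp add: matrix_eq)
  qed
  ultimately show ?thesis using fin by (metis finite_imageD finite_subset)
qed

section \<open>Fourier expansion of periodic eigenfunctions\<close>

definition expi :: "'a::real_inner \<Rightarrow> 'a \<Rightarrow> complex" where
  "expi u x = cis (2 * pi * (u \<bullet> x))"

lemma expi_add: "expi u (x + y) = expi u x * expi u y"
  by (simp add: expi_def inner_add_right cis_mult algebra_simps)

lemma expi_add_left: "expi (u + v) x = expi u x * expi v x"
  by (simp add: expi_def inner_add_left cis_mult algebra_simps)

lemma expi_minus_left: "expi (- u) x = cnj (expi u x)"
  by (simp add: expi_def cis_cnj)

lemma expi_0 [simp]: "expi 0 x = 1" "expi u 0 = 1"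
  by (simp_all add: expi_def)

lemma norm_expi [simp]: "norm (expi u x) = 1"
  by (simp add: expi_def)

lemma expi_minus_mult [simp]: "expi (- u) x * expi u x = 1" "expi u x * expi (- u) x = 1"
  by (simp_all flip: expi_add_left)

lemma expi_minus_mult_left [simp]: "expi (- u) x * (expi u x * z) = z" "expi u x * (expi (- u) x * z) = z"
  by (simp_all flip: mult.assoc)

lemma expi_nonzero [simp]: "expi u x \<noteq> 0"
  by (simp add: expi_def)

lemma expi_eq_1_iff: "expi u x = 1 \<longleftrightarrow> u \<bullet> x \<in> \<int>"
proof -
  have "2 * pi * r = of_int (2 * n) * pi \<longleftrightarrow> r = of_int n" for r :: real and n :: int
    by auto
  then show ?thesis
    unfolding expi_def cis_conv_exp exp_eq_1 by (auto simp: Ints_def)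
qed

lemma expi_derivative:
  "((\<lambda>x. expi u x) has_derivative (\<lambda>v. 2 * of_real pi * \<i> * of_real (u \<bullet> v) * expi u x)) (at x)"
proof -
  have "((\<lambda>x. \<i> * of_real (2 * pi * (u \<bullet> x))) has_derivative (\<lambda>v. \<i> * of_real (2 * pi * (u \<bullet> v)))) (at x)"
    by (auto intro!: derivative_eq_intros)
  from has_derivative_compose[OF this DERIV_exp[unfolded has_field_derivative_def]]
  show ?thesis unfolding expi_def cis_conv_exp by (simp add: mult_ac)
qed

lemma continuous_expi [continuous_intros]:
  "continuous_on S f \<Longrightarrow> continuous_on S (\<lambda>x. expi u (f x))"
  unfolding expi_def cis_conv_exp by (intro continuous_intros)

section \<open>Averages over lattice directions\<close>

text \<open>Iterated averages over segments in lattice directions take the place of the integral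
  over a fundamental domain, so that only one-dimensional integrals of continuous functions
  occur.\<close>

definition seg :: "'a::euclidean_space \<Rightarrow> ('a \<Rightarrow> 'b::euclidean_space) \<Rightarrow> 'a \<Rightarrow> 'b" where
  "seg l g x = integral {0..1} (\<lambda>t. g (x + t *\<^sub>R l))"

lemma continuous_on_line:
  fixes g :: "'a::euclidean_space \<Rightarrow> 'b::euclidean_space"
  assumes "continuous_on UNIV g"
  shows "continuous_on S (\<lambda>t::real. g (x + t *\<^sub>R l))"
  by (rule continuous_on_compose2[OF assms]) (auto intro!: continuous_intros)

lemma integrable_line:
  fixes g :: "'a::euclidean_space \<Rightarrow> 'b::euclidean_space"
  assumes "continuous_on UNIV g"
  shows "(\<lambda>t. g (x + t *\<^sub>R l)) integrable_on {0..1::real}"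
  by (rule integrable_continuous_real[OF continuous_on_line[OF assms]])

lemma seg_continuous: "continuous_on UNIV g \<Longrightarrow> continuous_on UNIV (seg l g)"
proof -
  assume g: "continuous_on UNIV g"
  have "continuous_on (UNIV \<times> cbox 0 1) (\<lambda>(x, t). g (x + t *\<^sub>R l))"
    unfolding case_prod_beta
    by (rule continuous_on_compose2[OF g]) (auto intro!: continuous_intros)
  from integral_continuous_on_param[OF this] show ?thesis
    by (simp add: seg_def[abs_def])
qed

lemma seg_commute: "continuous_on UNIV g \<Longrightarrow> seg l (seg k g) = seg k (seg l g)"
proof
  fix x assume g: "continuous_on UNIV g"
  have "continuous_on (cbox (0, 0) (1, 1)) (\<lambda>(s, t). g (x + s *\<^sub>R l + t *\<^sub>R k))"
    unfolding case_prod_beta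
    by (rule continuous_on_compose2[OF g]) (auto intro!: continuous_intros)
  from integral_swap_continuous[OF this]
  show "seg l (seg k g) x = seg k (seg l g) x"
    by (simp add: seg_def add.commute add.left_commute)
qed

lemma seg_linear:
  assumes "continuous_on UNIV g" "bounded_linear h"
  shows "seg l (\<lambda>x. h (g x)) = (\<lambda>x. h (seg l g x))"
  using integral_linear[OF integrable_line[OF assms(1)] assms(2)]
  by (simp add: seg_def[abs_def] o_def)

lemma seg_add:
  assumes "continuous_on UNIV g" "continuous_on UNIV h"
  shows "seg l (\<lambda>x. g x + h x) = (\<lambda>x. seg l g x + seg l h x)"
  unfolding seg_def[abs_def] by (rule ext, rule integral_add[OF integrable_line[OF assms(1)] integrable_line[OF assms(2)]])

lemma seg_const [simp]: "seg l (\<lambda>x. c) = (\<lambda>x. c)"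
  by (simp add: seg_def[abs_def])

lemma seg_norm_le:
  assumes "continuous_on UNIV g" "\<And>x. norm (g x) \<le> C"
  shows "norm (seg l g x) \<le> C"
  unfolding seg_def
  using integral_bound[of 0 1 "\<lambda>t. g (x + t *\<^sub>R l)" C] continuous_on_line[OF assms(1)] assms(2) by simp

text \<open>The fundamental theorem of calculus over one full period.\<close>

lemma seg_derivative:
  assumes "\<And>x. (g has_derivative g' x) (at x)" "\<And>x. g (x + l) = g x"
  shows "seg l (\<lambda>x. g' x l) = (\<lambda>x. 0)"
proof
  fix x
  have "((\<lambda>t. g (x + t *\<^sub>R l)) has_vector_derivative g' (x + t *\<^sub>R l) l) (at t within {0..1})" for t
  proof -
    have "((\<lambda>t. g (x + t *\<^sub>R l)) has_derivative (\<lambda>s. g' (x + t *\<^sub>R l) (s *\<^sub>R l))) (at t within {0..1})"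
      by (rule has_derivative_compose[OF _ assms(1)]) (auto intro!: derivative_eq_intros)
    then show ?thesis
      unfolding has_vector_derivative_def
      using linear_scale[OF has_derivative_linear[OF assms(1)]] by simp
  qed
  then have "((\<lambda>t. g' (x + t *\<^sub>R l) l) has_integral (g (x + 1 *\<^sub>R l) - g (x + 0 *\<^sub>R l))) {0..1}"
    by (intro fundamental_theorem_of_calculus) auto
  then show "seg l (\<lambda>x. g' x l) x = 0"
    using assms(2) by (simp add: seg_def integral_unique)
qed

lemma seg_nonneg:
  fixes g :: "'a::euclidean_space \<Rightarrow> real"
  assumes "continuous_on UNIV g" "\<And>x. g x \<ge> 0"
  shows "seg l g x \<ge> 0"
  unfolding seg_def by (rule integral_nonneg[OF integrable_line[OF assms(1)]]) (rule assms(2))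

text \<open>A nonnegative continuous integrand with integral 0 vanishes on the whole segment, and
  the segment starts at x.\<close>

lemma seg_eq_0:
  fixes g :: "'a::euclidean_space \<Rightarrow> real"
  assumes "continuous_on UNIV g" "\<And>x. g x \<ge> 0" "seg l g x = 0"
  shows "g x = 0"
proof -
  have "(\<forall>t\<in>{0..1}. g (x + t *\<^sub>R l) = 0)"
    using integral_eq_0_iff[of 0 1 "\<lambda>t. g (x + t *\<^sub>R l)"] continuous_on_line[OF assms(1)] assms(2,3)
    by (simp add: seg_def)
  from bspec[OF this, of 0] show ?thesis by simp
qed

definition avg :: "'a::euclidean_space list \<Rightarrow> ('a \<Rightarrow> 'b::euclidean_space) \<Rightarrow> 'a \<Rightarrow> 'b" where
  "avg ls g = foldr seg ls g"

lemma avg_simps [simp]: "avg [] g = g" "avg (l # ls) g = seg l (avg ls g)"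
  by (simp_all add: avg_def)

lemma avg_continuous: "continuous_on UNIV g \<Longrightarrow> continuous_on UNIV (avg ls g)"
  by (induction ls) (simp_all add: seg_continuous)

lemma avg_seg: "continuous_on UNIV g \<Longrightarrow> avg ls (seg l g) = seg l (avg ls g)"
  by (induction ls) (simp_all add: seg_commute avg_continuous)

lemma avg_linear:
  assumes "continuous_on UNIV g" "bounded_linear h"
  shows "avg ls (\<lambda>x. h (g x)) = (\<lambda>x. h (avg ls g x))"
  by (induction ls) (simp_all add: seg_linear avg_continuous assms)

lemma avg_const [simp]: "avg ls (\<lambda>x. c) = (\<lambda>x. c)"
  by (induction ls) simp_all

lemma avg_add:
  assumes "continuous_on UNIV g" "continuous_on UNIV h"
  shows "avg ls (\<lambda>x. g x + h x) = (\<lambda>x. avg ls g x + avg ls h x)"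
  by (induction ls) (simp_all add: seg_add avg_continuous assms)

lemma avg_diff:
  assumes "continuous_on UNIV g" "continuous_on UNIV h"
  shows "avg ls (\<lambda>x. g x - h x) = (\<lambda>x. avg ls g x - avg ls h x)"
  using avg_add[OF assms(1), of "\<lambda>x. - h x" ls] avg_linear[OF assms(2) bounded_linear_minus[OF bounded_linear_ident], of ls]
    assms(2) by (simp add: continuous_on_minus)

lemma avg_sum:
  assumes "\<And>i. i \<in> I \<Longrightarrow> continuous_on UNIV (g i)"
  shows "avg ls (\<lambda>x. \<Sum>i\<in>I. g i x) = (\<lambda>x. \<Sum>i\<in>I. avg ls (g i) x)"
  using assms
  by (induction I rule: infinite_finite_induct) (simp_all add: avg_add continuous_on_sum)

lemma avg_norm_le:
  assumes "continuous_on UNIV g" "\<And>x. norm (g x) \<le> C"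
  shows "norm (avg ls g x) \<le> C"
  by (induction ls arbitrary: x) (simp_all add: seg_norm_le avg_continuous assms)

text \<open>Segment averages commute, so the one that kills g may be performed first.\<close>

lemma avg_eq_zero:
  assumes "continuous_on UNIV g" "seg l g = (\<lambda>x. 0)" "l \<in> set ls"
  shows "avg ls g = (\<lambda>x. 0)"
  using assms(3)
proof (induction ls)
  case (Cons k ls)
  show ?case
  proof (cases "k = l")
    case True
    have "avg (k # ls) g = avg ls (seg l g)" by (simp only: True avg_simps avg_seg[OF assms(1)])
    then show ?thesis by (simp only: assms(2) avg_const)
  next
    case False
    then have "avg ls g = (\<lambda>x. 0)" using Cons by simp
    then show ?thesis by (simp only: avg_simps seg_const)
  qed
qed simp

lemma avg_nonneg:
  fixes g :: "'a::euclidean_space \<Rightarrow> real"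
  assumes "continuous_on UNIV g" "\<And>x. g x \<ge> 0"
  shows "avg ls g x \<ge> 0"
proof (induction ls arbitrary: x)
  case (Cons l ls)
  then show ?case using seg_nonneg[OF avg_continuous[OF assms(1)]] by simp
qed (use assms(2) in simp)

lemma avg_eq_0:
  fixes g :: "'a::euclidean_space \<Rightarrow> real"
  assumes "continuous_on UNIV g" "\<And>x. g x \<ge> 0" "avg ls g x = 0"
  shows "g x = 0"
  using assms(3)
proof (induction ls)
  case (Cons l ls)
  have "avg ls g x = 0"
  proof (rule seg_eq_0[where g = "avg ls g" and l = l and x = x])
    show "continuous_on UNIV (avg ls g)" by (rule avg_continuous[OF assms(1)])
    show "avg ls g y \<ge> 0" for y by (rule avg_nonneg[OF assms(1,2)])
    show "seg l (avg ls g) x = 0" using Cons.prems by simp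
  qed
  then show ?case by (rule Cons.IH)
qed simp

section \<open>Dual bases, trigonometric polynomials and uniqueness of Fourier coefficients\<close>

locale dual_bases =
  fixes lam w :: "'n::finite \<Rightarrow> real ^ 'n"
  assumes dual: "w i \<bullet> lam j = (if i = j then 1 else 0)"
    and expand: "x = (\<Sum>i\<in>UNIV. (w i \<bullet> x) *\<^sub>R lam i)"
begin

definition dual_lattice :: "(real ^ 'n) set" where
  "dual_lattice = {u. \<forall>i. u \<bullet> lam i \<in> \<int>}"

definition periodic :: "(real ^ 'n \<Rightarrow> 'b) \<Rightarrow> bool" where
  "periodic g \<longleftrightarrow> (\<forall>i x. g (x + lam i) = g x)"

text \<open>The order of the directions is immaterial for continuous functions. The value still
  depends formally on a base point; for continuous periodic complex functions it is constant by
  \<open>mean_const\<close>, and Fourier coefficients are read off at 0.\<close>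

definition mean :: "(real ^ 'n \<Rightarrow> 'b::euclidean_space) \<Rightarrow> real ^ 'n \<Rightarrow> 'b" where
  "mean g = avg (map lam (SOME is. set is = UNIV)) g"

lemma set_directions: "set (map lam (SOME is. set is = UNIV)) = range lam"
proof -
  have "\<exists>is. set is = (UNIV :: 'n set)" by (rule finite_list) simp
  then have "set (SOME is. set is = (UNIV :: 'n set)) = UNIV" by (rule someI_ex)
  then show ?thesis by simp
qed

lemma w_in_dual: "w i \<in> dual_lattice" "- w i \<in> dual_lattice"
  by (simp_all add: dual_lattice_def dual)

lemma dual_lattice_closed: "0 \<in> dual_lattice"
  "u \<in> dual_lattice \<Longrightarrow> v \<in> dual_lattice \<Longrightarrow> u + v \<in> dual_lattice"
  "u \<in> dual_lattice \<Longrightarrow> - u \<in> dual_lattice"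
  by (simp_all add: dual_lattice_def inner_add_left)

lemma dual_lattice_eqI: "(\<And>i. u \<bullet> lam i = v \<bullet> lam i) \<Longrightarrow> u = v"
proof -
  assume e: "\<And>i. u \<bullet> lam i = v \<bullet> lam i"
  have "(u - v) \<bullet> x = 0" for x
    by (subst expand[of x]) (simp add: inner_sum_right inner_diff_left e)
  from this[of "u - v"] show "u = v" by simp
qed

lemma expi_periodic: "u \<in> dual_lattice \<Longrightarrow> periodic (expi u)"
  by (auto simp: periodic_def expi_add dual_lattice_def expi_eq_1_iff)

text \<open>A derivative along a period averages to 0, and every direction is a combination of the
  periods. This is integration by parts on the torus in disguise.\<close>

lemma mean_derivative:
  fixes g :: "real ^ 'n \<Rightarrow> 'b::euclidean_space"
  assumes "periodic g" "\<And>x. (g has_derivative g' x) (at x)" "\<And>v. continuous_on UNIV (\<lambda>x. g' x v)"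
  shows "mean (\<lambda>x. g' x v) = (\<lambda>x. 0)"
proof -
  have m: "mean (\<lambda>x. g' x (lam i)) = (\<lambda>x. 0)" for i
    unfolding mean_def
  proof (rule avg_eq_zero[OF assms(3)])
    show "seg (lam i) (\<lambda>x. g' x (lam i)) = (\<lambda>x. 0)"
      using assms(1) by (intro seg_derivative[OF assms(2)]) (simp add: periodic_def)
    show "lam i \<in> set (map lam (SOME is. set is = UNIV))" unfolding set_directions by blast
  qed
  have "g' x v = (\<Sum>i\<in>UNIV. (w i \<bullet> v) *\<^sub>R g' x (lam i))" for x
  proof -
    interpret linear "g' x" by (rule has_derivative_linear[OF assms(2)])
    show ?thesis by (subst (1) expand[of v]) (simp add: sum scale)
  qed
  then have "mean (\<lambda>x. g' x v) = mean (\<lambda>x. \<Sum>i\<in>UNIV. (w i \<bullet> v) *\<^sub>R g' x (lam i))"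
    by simp
  also have "\<dots> = (\<lambda>x. \<Sum>i\<in>UNIV. mean (\<lambda>x. (w i \<bullet> v) *\<^sub>R g' x (lam i)) x)"
    unfolding mean_def by (rule avg_sum) (intro continuous_intros assms(3))
  also have "\<dots> = (\<lambda>x. \<Sum>i\<in>UNIV. (w i \<bullet> v) *\<^sub>R mean (\<lambda>x. g' x (lam i)) x)"
    unfolding mean_def by (simp add: avg_linear[OF assms(3) bounded_linear_scaleR_right])
  finally show ?thesis by (simp add: m)
qed

lemma mean_mult: "continuous_on UNIV g \<Longrightarrow> mean (\<lambda>x. c * g x) = (\<lambda>x. c * mean g x)" for c :: complex
  unfolding mean_def by (rule avg_linear[OF _ bounded_linear_mult_right])

text \<open>A nontrivial character is a nonzero multiple of its own derivative along some lam_i, and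
  derivatives have mean 0.\<close>

lemma mean_expi:
  assumes "u \<in> dual_lattice"
  shows "mean (expi u) = (\<lambda>x. if u = 0 then 1 else 0)"
proof (cases "u = 0")
  case True
  then have "expi u = (\<lambda>x. 1)" by auto
  then show ?thesis using True by (simp add: mean_def)
next
  case False
  then obtain i where i: "u \<bullet> lam i \<noteq> 0" using dual_lattice_eqI[of u 0] by auto
  have c: "continuous_on UNIV (\<lambda>x. c * expi u x)" for c by (intro continuous_intros)
  have "mean (\<lambda>x. 2 * of_real pi * \<i> * of_real (u \<bullet> lam i) * expi u x) = (\<lambda>x. 0)"
    by (rule mean_derivative[OF expi_periodic[OF assms] expi_derivative c])
  then have "(\<lambda>x. 2 * of_real pi * \<i> * of_real (u \<bullet> lam i) * mean (expi u) x) = (\<lambda>x. 0)"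
    using mean_mult[OF continuous_expi[OF continuous_on_id]] by simp
  then show ?thesis using i False by (auto simp: fun_eq_iff)
qed

inductive trig :: "(real ^ 'n \<Rightarrow> complex) \<Rightarrow> bool" where
  char: "u \<in> dual_lattice \<Longrightarrow> trig (\<lambda>x. c * expi u x)"
| add: "trig p \<Longrightarrow> trig q \<Longrightarrow> trig (\<lambda>x. p x + q x)"

lemma trig_const: "trig (\<lambda>x. c)"
  using char[OF dual_lattice_closed(1), of c] by simp

lemma trig_mult: "trig p \<Longrightarrow> trig q \<Longrightarrow> trig (\<lambda>x. p x * q x)"
proof (induction p rule: trig.induct)
  case (char u c)
  from char.prems show ?case
  proof (induction q rule: trig.induct)
    case (char v d)
    have "(\<lambda>x. c * expi u x * (d * expi v x)) = (\<lambda>x. (c * d) * expi (u + v) x)"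
      by (simp add: expi_add_left mult_ac)
    then show ?case using trig.char[OF dual_lattice_closed(2)[OF \<open>u \<in> dual_lattice\<close> char]] by simp
  next
    case (add p q)
    then show ?case using trig.add[OF add.IH] by (simp add: distrib_left)
  qed
next
  case (add p r)
  then show ?case using trig.add[OF add.IH(1)[OF add.prems] add.IH(2)[OF add.prems]]
    by (simp add: distrib_right)
qed

lemma trig_cnj: "trig p \<Longrightarrow> trig (\<lambda>x. cnj (p x))"
proof (induction p rule: trig.induct)
  case (char u c)
  then show ?case using trig.char[OF dual_lattice_closed(3)[OF char], of "cnj c"]
    by (simp add: expi_minus_left)
next
  case (add p q)
  then show ?case using trig.add[OF add.IH] by simp
qed

lemma trig_sum: "(\<And>i. i \<in> I \<Longrightarrow> trig (f i)) \<Longrightarrow> trig (\<lambda>x. \<Sum>i\<in>I. f i x)"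
  by (induction I rule: infinite_finite_induct) (simp_all add: trig_const trig.add)

lemma trig_continuous: "trig p \<Longrightarrow> continuous_on UNIV p"
  by (induction rule: trig.induct) (auto intro!: continuous_intros)

lemma trig_bounded: "trig p \<Longrightarrow> \<exists>C. \<forall>x. norm (p x) \<le> C"
proof (induction rule: trig.induct)
  case (char u c)
  then show ?case by (intro exI[of _ "norm c"]) (simp add: norm_mult)
next
  case (add p q)
  then obtain C D where "\<forall>x. norm (p x) \<le> C" "\<forall>x. norm (q x) \<le> D" by blast
  then show ?case by (intro exI[of _ "C + D"]) (metis add_mono norm_triangle_le)
qed

lemma trig_mean_const: "trig p \<Longrightarrow> mean p x = mean p 0"
proof (induction rule: trig.induct)
  case (char u c)
  then show ?case using mean_mult[OF continuous_expi[OF continuous_on_id], of c u] by (simp add: mean_expi)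
next
  case (add p q)
  then show ?case using avg_add[OF trig_continuous[OF add.hyps(1)] trig_continuous[OF add.hyps(2)]]
    by (simp add: mean_def)
qed

text \<open>Realizes the quotient of the space by the lattice of the lam_i as a compact torus in
  complex coordinate space.\<close>

definition torus_map :: "real ^ 'n \<Rightarrow> complex ^ 'n" where
  "torus_map x = (\<chi> i. expi (w i) x)"

text \<open>Real polynomial functions are generated by real linear forms, that is, by real and
  imaginary parts of the coordinates; on the torus these are combinations of the characters of w_i
  and -w_i.\<close>

lemma trig_polynomial:
  "real_polynomial_function q \<Longrightarrow> trig (\<lambda>x. of_real (q (torus_map x)))"
proof (induction q rule: real_polynomial_function.induct)
  case (linear f)
  have f: "f z = (\<Sum>i\<in>UNIV. Re (z $ i) * f (axis i 1) + Im (z $ i) * f (axis i \<i>))" for z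
  proof -
    interpret bounded_linear f by fact
    have "z = (\<Sum>i\<in>UNIV. Re (z $ i) *\<^sub>R axis i 1 + Im (z $ i) *\<^sub>R axis i \<i>)"
    proof (subst vec_eq_iff, rule allI)
      fix j
      have "(\<Sum>i\<in>UNIV. Re (z $ i) *\<^sub>R axis i 1 + Im (z $ i) *\<^sub>R axis i \<i>) $ j
          = (\<Sum>i\<in>{j}. Re (z $ i) *\<^sub>R 1 + Im (z $ i) *\<^sub>R \<i>)"
        unfolding sum_component by (rule sum.mono_neutral_cong_right) (auto simp: axis_def)
      then show "z $ j = (\<Sum>i\<in>UNIV. Re (z $ i) *\<^sub>R axis i 1 + Im (z $ i) *\<^sub>R axis i \<i>) $ j"
        by (simp add: complex_eq_iff)
    qed
    then have "f z = f (\<Sum>i\<in>UNIV. Re (z $ i) *\<^sub>R axis i 1 + Im (z $ i) *\<^sub>R axis i \<i>)" by simp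
    then show ?thesis by (simp add: sum add scaleR)
  qed
  have re: "trig (\<lambda>x. of_real (Re (expi (w i) x)))" for i
  proof -
    have "complex_of_real (Re (expi (w i) x)) = (1/2) * expi (w i) x + (1/2) * expi (- w i) x" for x
      by (simp add: expi_minus_left complex_eq_iff)
    then show ?thesis by (simp only: trig.intros w_in_dual)
  qed
  have im: "trig (\<lambda>x. of_real (Im (expi (w i) x)))" for i
  proof -
    have "complex_of_real (Im (expi (w i) x)) = (- \<i>/2) * expi (w i) x + (\<i>/2) * expi (- w i) x" for x
      by (simp add: expi_minus_left complex_eq_iff)
    then show ?thesis by (simp only: trig.intros w_in_dual)
  qed
  have t: "trig (\<lambda>x. of_real (Re (expi (w i) x) * a + Im (expi (w i) x) * b))" for i a b
    unfolding of_real_add of_real_mult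
    by (rule trig.add[OF trig_mult[OF re trig_const] trig_mult[OF im trig_const]])
  have "(\<lambda>x. complex_of_real (f (torus_map x))) = (\<lambda>x. \<Sum>i\<in>UNIV.
      of_real (Re (expi (w i) x) * f (axis i 1) + Im (expi (w i) x) * f (axis i \<i>)))"
  proof
    show "complex_of_real (f (torus_map x)) = (\<Sum>i\<in>UNIV.
      of_real (Re (expi (w i) x) * f (axis i 1) + Im (expi (w i) x) * f (axis i \<i>)))" for x
      by (subst f) (simp only: of_real_sum torus_map_def vec_lambda_beta)
  qed
  moreover have "trig (\<lambda>x. \<Sum>i\<in>UNIV.
      of_real (Re (expi (w i) x) * f (axis i 1) + Im (expi (w i) x) * f (axis i \<i>)))"
    by (rule trig_sum, rule t)
  ultimately show ?case by (simp only:)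
qed (simp_all add: trig_const trig.add trig_mult)

lemma periodic_int: "periodic g \<Longrightarrow> g (x + of_int k *\<^sub>R lam i) = g x"
proof -
  assume g: "periodic g"
  have n: "g (x + of_nat n *\<^sub>R lam i) = g x" for n x
  proof (induction n)
    case (Suc n)
    have "g (x + of_nat (Suc n) *\<^sub>R lam i) = g ((x + of_nat n *\<^sub>R lam i) + lam i)"
      by (simp add: algebra_simps)
    then show ?case using g Suc by (simp add: periodic_def)
  qed simp
  show ?thesis
  proof (cases k rule: int_cases2)
    case (nonneg m)
    then show ?thesis using n by simp
  next
    case (nonpos m)
    then show ?thesis using n[of "x - of_nat m *\<^sub>R lam i" m] by simp
  qed
qed

lemma periodic_eqI:
  assumes "periodic g" "\<And>i. w i \<bullet> (x - y) \<in> \<int>"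
  shows "g x = g y"
proof -
  have "g (y + (\<Sum>i\<in>I. (w i \<bullet> (x - y)) *\<^sub>R lam i)) = g y" for I
  proof (induction I rule: infinite_finite_induct)
    case (insert i I)
    obtain k where "w i \<bullet> (x - y) = of_int k" using assms(2) by (metis Ints_cases)
    then show ?case using insert periodic_int[OF assms(1), of "y + (\<Sum>i\<in>I. (w i \<bullet> (x - y)) *\<^sub>R lam i)" k i]
      by (simp add: algebra_simps)
  qed simp_all
  from this[of UNIV] show ?thesis by (simp flip: expand)
qed

lemma torus_map_eq: "torus_map x = torus_map y \<longleftrightarrow> (\<forall>i. w i \<bullet> (x - y) \<in> \<int>)"
proof -
  have "expi (w i) x = expi (w i) y \<longleftrightarrow> expi (w i) (x - y) = 1" for i
    using expi_add[of "w i" "x - y" y] by auto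
  then show ?thesis by (simp add: torus_map_def vec_eq_iff expi_eq_1_iff)
qed

text \<open>A continuous periodic function descends to the compact torus, where Stone-Weierstrass
  applies.\<close>
lemma trig_approx:
  fixes g :: "real ^ 'n \<Rightarrow> complex"
  assumes g: "continuous_on UNIV g" "periodic g" and "e > 0"
  obtains p where "trig p" "\<And>x. norm (g x - p x) < e"
proof -
  \<comment> \<open>The closed fundamental parallelepiped. Replacing the coordinates w_i . x by
    their fractional parts shows that it maps onto the whole torus.\<close>
  define C where "C = (\<lambda>t. \<Sum>i\<in>UNIV. (t $ i) *\<^sub>R lam i) ` cbox (0 :: real ^ 'n) 1"
  have compC: "compact C"
    unfolding C_def by (intro compact_continuous_image compact_cbox continuous_intros)
  have contT: "continuous_on S torus_map" for S
    unfolding torus_map_def by (intro continuous_intros)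
  have cover: "\<exists>y\<in>C. torus_map y = torus_map x" for x
  proof -
    let ?y = "\<Sum>i\<in>UNIV. frac (w i \<bullet> x) *\<^sub>R lam i"
    have "w i \<bullet> (?y - x) \<in> \<int>" for i
    proof -
      have "w i \<bullet> ?y = frac (w i \<bullet> x)"
        by (simp add: inner_sum_right dual if_distrib cong: if_cong)
      then show ?thesis by (simp add: inner_diff_right frac_def)
    qed
    moreover have "?y \<in> C"
      unfolding C_def
      by (rule image_eqI[of _ _ "\<chi> i. frac (w i \<bullet> x)"])
        (auto simp: mem_box_cart frac_ge_0 less_imp_le[OF frac_lt_1])
    ultimately show ?thesis by (auto simp: torus_map_eq)
  qed
  define G where "G z = g (SOME x. torus_map x = z)" for z
  have G: "G (torus_map x) = g x" for x
  proof -
    have "torus_map (SOME y. torus_map y = torus_map x) = torus_map x" by (rule someI) simp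
    then show ?thesis unfolding G_def torus_map_eq by (intro periodic_eqI[OF g(2)]) blast
  qed
  have compK: "compact (torus_map ` C)" by (intro compact_continuous_image contT compC)
  have "continuous_on (torus_map ` C) G"
    unfolding continuous_on_closed_vimage[OF compact_imp_closed[OF compK]]
  proof (intro allI impI)
    fix B :: "complex set" assume "closed B"
    \<comment> \<open>The preimage of a closed set under G is the image of a compact part of C. This
      gives continuity although G is defined through arbitrary preimages.\<close>
    have "G -` B \<inter> torus_map ` C = torus_map ` (C \<inter> g -` B)" using G by auto
    moreover have "closed (g -` B)" using g(1) \<open>closed B\<close> by (simp add: closed_vimage continuous_on_eq_continuous_at)
    then have "compact (torus_map ` (C \<inter> g -` B))"
      by (intro compact_continuous_image contT compact_Int_closed compC)
    ultimately show "closed (G -` B \<inter> torus_map ` C)" by (simp add: compact_imp_closed)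
  qed
  from Stone_Weierstrass_polynomial_function[OF compK this \<open>e > 0\<close>]
  obtain q where q: "polynomial_function q" "\<And>z. z \<in> torus_map ` C \<Longrightarrow> norm (G z - q z) < e"
    by blast
  have "real_polynomial_function (Re \<circ> q)" "real_polynomial_function (Im \<circ> q)"
    using q(1) bounded_linear_Re bounded_linear_Im unfolding polynomial_function_def by blast+
  from this[THEN trig_polynomial]
  have "trig (\<lambda>x. of_real (Re (q (torus_map x))) + \<i> * of_real (Im (q (torus_map x))))"
    by (intro trig.add trig_mult trig_const) simp_all
  then have "trig (\<lambda>x. q (torus_map x))" by (simp flip: complex_eq)
  moreover have "norm (g x - q (torus_map x)) < e" for x
  proof -
    obtain y where "y \<in> C" "torus_map y = torus_map x" using cover by blast
    then show ?thesis using q(2)[of "torus_map x"] G[of x] by (metis image_eqI)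
  qed
  ultimately show thesis by (rule that)
qed

text \<open>Trigonometric polynomials have constant mean, and uniform approximation preserves
  this.\<close>

lemma mean_const:
  fixes g :: "real ^ 'n \<Rightarrow> complex"
  assumes g: "continuous_on UNIV g" "periodic g"
  shows "mean g x = mean g 0"
proof (rule ccontr)
  assume ne: "mean g x \<noteq> mean g 0"
  define e where "e = norm (mean g x - mean g 0) / 2"
  have "e > 0" using ne by (simp add: e_def)
  then obtain p where p: "trig p" "\<And>x. norm (g x - p x) < e / 2"
    using trig_approx[OF g, of "e/2"] by auto
  have "norm (mean (\<lambda>x. g x - p x) y) \<le> e / 2" for y
    unfolding mean_def by (intro avg_norm_le continuous_intros g trig_continuous p(1) less_imp_le[OF p(2)])
  then have d: "norm (mean g y - mean p y) \<le> e / 2" for y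
    unfolding mean_def by (simp add: avg_diff[OF g(1) trig_continuous[OF p(1)]])
  have "norm (mean g x - mean g 0) \<le> norm (mean g x - mean p x) + norm (mean g 0 - mean p 0)"
    using norm_triangle_ineq4[of "mean g x - mean p x" "mean g 0 - mean p 0"] trig_mean_const[OF p(1), of x]
    by simp
  also have "\<dots> \<le> e" using d[of x] d[of 0] by simp
  finally show False using \<open>e > 0\<close> by (simp add: e_def)
qed

text \<open>Vanishing coefficients make g orthogonal to every trigonometric polynomial.
  Approximating g itself by one gives mean 0 for |g|^2, and a nonnegative continuous function with
  mean 0 vanishes.\<close>

lemma fourier_unique:
  fixes g :: "real ^ 'n \<Rightarrow> complex"
  assumes g: "continuous_on UNIV g" "periodic g"
    and coeff: "\<And>u. u \<in> dual_lattice \<Longrightarrow> mean (\<lambda>x. expi (- u) x * g x) 0 = 0"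
  shows "g x = 0"
proof -
  have zero: "mean (\<lambda>x. p x * g x) 0 = 0" if "trig p" for p
    using that
  proof (induction p rule: trig.induct)
    case (char u c)
    have "continuous_on UNIV (\<lambda>x. expi u x * g x)" by (intro continuous_intros g)
    from mean_mult[OF this, of c] show ?case
      using coeff[OF dual_lattice_closed(3)[OF char]] by (simp add: mult.assoc)
  next
    case (add p q)
    then show ?case
      unfolding mean_def distrib_right
      by (subst avg_add) (intro continuous_intros g trig_continuous; assumption | simp)+
  qed
  \<comment> \<open>One approximation within distance 1 shows that g is bounded.\<close>
  obtain q where q: "trig q" "\<And>x. norm (g x - q x) < 1" using trig_approx[OF g, of 1] by auto
  obtain D where D: "\<And>x. norm (q x) \<le> D" using trig_bounded[OF q(1)] by blast
  have gb: "norm (g x) \<le> 1 + D" for x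
    using norm_triangle_ineq[of "g x - q x" "q x"] q(2)[of x] D[of x] by simp
  have D0: "1 + D > 0" using gb[of 0] D[of 0] norm_ge_zero[of "q 0"] by linarith
  define h where "h x = cnj (g x) * g x" for x
  have conth: "continuous_on UNIV h" unfolding h_def by (intro continuous_intros g)
  have "norm (mean h 0) \<le> e" if "e > 0" for e
  proof -
    have "e / (1 + D) > 0" using that D0 by simp
    then obtain p where p: "trig p" "\<And>x. norm (g x - p x) < e / (1 + D)"
      using trig_approx[OF g] by blast
    have contp: "continuous_on UNIV (\<lambda>x. cnj (p x) * g x)"
      by (intro continuous_intros g trig_continuous p)
    have "norm (mean (\<lambda>x. h x - cnj (p x) * g x) 0) \<le> e"
      unfolding mean_def
    proof (rule avg_norm_le)
      show "continuous_on UNIV (\<lambda>x. h x - cnj (p x) * g x)" by (intro continuous_intros conth contp)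
      fix x
      have "h x - cnj (p x) * g x = cnj (g x - p x) * g x" by (simp add: h_def left_diff_distrib)
      then have "norm (h x - cnj (p x) * g x) = norm (g x - p x) * norm (g x)"
        by (metis norm_mult complex_mod_cnj)
      also have "\<dots> \<le> e / (1 + D) * (1 + D)"
        by (rule mult_mono) (use less_imp_le[OF p(2)] gb that D0 in auto)
      finally show "norm (h x - cnj (p x) * g x) \<le> e" using D0 by simp
    qed
    moreover have "mean (\<lambda>x. h x - cnj (p x) * g x) 0 = mean h 0 - mean (\<lambda>x. cnj (p x) * g x) 0"
      unfolding mean_def by (simp only: avg_diff[OF conth contp])
    ultimately show ?thesis by (simp only: zero[OF trig_cnj[OF p(1)]] diff_0_right)
  qed
  then have "norm (mean h 0) \<le> 0" by (rule field_le_epsilon[of _ 0, simplified]) 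
  then have m0: "mean h 0 = 0" by simp
  have "periodic h" using g(2) by (simp add: periodic_def h_def)
  \<comment> \<open>\<open>avg_eq_0\<close> yields a zero only at the base point of the mean, so the
    base point has to be moved from 0 to x.\<close>
  then have mx: "mean h x = 0" using mean_const[OF conth] m0 by simp
  have contr: "continuous_on UNIV (\<lambda>x. Re (h x))" by (intro continuous_intros conth)
  have "mean (\<lambda>x. Re (h x)) x = Re (mean h x)"
    unfolding mean_def by (simp only: avg_linear[OF conth bounded_linear_Re])
  then have "mean (\<lambda>x. Re (h x)) x = 0" using mx by simp
  moreover have hr: "Re (h y) = (norm (g y))\<^sup>2" for y
    unfolding cmod_power2 by (simp add: h_def power2_eq_square)
  ultimately have "Re (h x) = 0"
    unfolding mean_def by (intro avg_eq_0[OF contr]) simp_all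
  then show ?thesis by (simp add: hr)
qed

end

section \<open>Vector-valued functions and the expansion of eigenfunctions\<close>

lemma scaleR_eq_smult: "r *\<^sub>R (x :: complex ^ 'k) = of_real r *s x"
  by (rule vec_eq_iff[THEN iffD2]) (simp add: scaleR_conv_of_real[where 'a = complex])

lemma bounded_linear_smult: "bounded_linear (\<lambda>v :: complex ^ 'k. z *s v)"
  unfolding linear_conv_bounded_linear[symmetric]
  by (rule linearI) (simp_all add: vec_eq_iff algebra_simps)

lemma bounded_linear_matrix: "bounded_linear ((*v) (A :: complex ^ 'k ^ 'l))"
  unfolding linear_conv_bounded_linear[symmetric]
  by (rule linearI) (simp_all add: matrix_vector_right_distrib scaleR_eq_smult vector_scalar_commute)

lemma bounded_bilinear_smult: "bounded_bilinear (\<lambda>z (v :: complex ^ 'k). z *s v)"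
proof
  show "\<exists>K. \<forall>(a :: complex) (b :: complex ^ 'k). norm (a *s b) \<le> norm a * norm b * K"
  proof (intro exI[of _ 1] allI)
    fix a :: complex and b :: "complex ^ 'k"
    have "norm (a *s b) = norm a * norm b"
      by (simp add: norm_vec_def norm_mult L2_set_right_distrib)
    then show "norm (a *s b) \<le> norm a * norm b * 1" by simp
  qed
qed (simp_all add: vec_eq_iff algebra_simps)

lemmas continuous_on_smult [continuous_intros] =
  bounded_bilinear.continuous_on[OF bounded_bilinear_smult]

context dual_bases
begin

lemma mean_bounded_linear:
  "continuous_on UNIV g \<Longrightarrow> bounded_linear h \<Longrightarrow> mean (\<lambda>x. h (g x)) y = h (mean g y)"
  unfolding mean_def by (simp add: avg_linear)

lemma mean_sum: "(\<And>i. i \<in> I \<Longrightarrow> continuous_on UNIV (g i)) \<Longrightarrow>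
    mean (\<lambda>x. \<Sum>i\<in>I. g i x) y = (\<Sum>i\<in>I. mean (g i) y)"
  unfolding mean_def by (simp add: avg_sum)

text \<open>u is determined by the integers u . lam_i, and these are bounded by |R| |lam_i|.\<close>

lemma finite_dual_sphere: "finite {u \<in> dual_lattice. norm u = R}"
proof -
  define N where "N = (\<lambda>i. \<lceil>\<bar>R\<bar> * norm (lam i)\<rceil>)"
  define \<Phi> where "\<Phi> u = (\<lambda>i. \<lfloor>u \<bullet> lam i\<rfloor>)" for u
  have fl: "u \<bullet> lam i = of_int \<lfloor>u \<bullet> lam i\<rfloor>" if "u \<in> dual_lattice" for u i
    using that by (simp add: dual_lattice_def)
  have "inj_on \<Phi> {u \<in> dual_lattice. norm u = R}"
  proof (rule inj_onI)
    fix u v assume "u \<in> {u \<in> dual_lattice. norm u = R}" "v \<in> {u \<in> dual_lattice. norm u = R}" "\<Phi> u = \<Phi> v"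
    then have "u \<bullet> lam i = v \<bullet> lam i" for i using fl[of u i] fl[of v i] by (simp add: \<Phi>_def fun_eq_iff)
    then show "u = v" by (rule dual_lattice_eqI)
  qed
  moreover have "\<Phi> ` {u \<in> dual_lattice. norm u = R} \<subseteq> PiE UNIV (\<lambda>i. {- N i..N i})"
  proof clarsimp
    fix u assume u: "u \<in> dual_lattice" "R = norm u"
    show "\<Phi> u \<in> (\<Pi>\<^sub>E i\<in>UNIV. {- N i..N i})"
    proof (intro PiE_I)
      fix i
      have "\<bar>u \<bullet> lam i\<bar> \<le> \<bar>R\<bar> * norm (lam i)" using Cauchy_Schwarz_ineq2[of u "lam i"] u(2) by simp
      then have "\<bar>of_int \<lfloor>u \<bullet> lam i\<rfloor>\<bar> \<le> \<bar>R\<bar> * norm (lam i)" using fl[OF u(1)] by simp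
      then have "\<bar>\<lfloor>u \<bullet> lam i\<rfloor>\<bar> \<le> N i" unfolding N_def by linarith
      then show "\<Phi> u i \<in> {- N i..N i}" by (simp add: \<Phi>_def abs_le_iff)
    qed simp
  qed
  moreover have "finite (PiE (UNIV :: 'n set) (\<lambda>i. {- N i..N i}))" by (intro finite_PiE) auto
  ultimately show ?thesis by (meson finite_imageD finite_subset)
qed

lemma mean_expi_smult:
  assumes "u \<in> dual_lattice" "v \<in> dual_lattice"
  shows "mean (\<lambda>x. expi (- u) x *s (expi v x *s c)) 0 = (if u = v then c else 0)"
proof -
  have "mean (\<lambda>x. expi (- u) x *s (expi v x *s c)) 0 = mean (\<lambda>x. expi (- u + v) x *s c) 0"
    by (simp only: expi_add_left vector_smult_assoc)
  also have "\<dots> = mean (expi (- u + v)) 0 *s c"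
    by (rule mean_bounded_linear[where h = "\<lambda>z. z *s c"])
      (auto intro!: continuous_intros bounded_bilinear.bounded_linear_left[OF bounded_bilinear_smult])
  also have "mean (expi (- u + v)) 0 = (if u = v then 1 else 0)"
    using mean_expi[OF dual_lattice_closed(2)[OF dual_lattice_closed(3)[OF assms(1)] assms(2)]]
    by (simp add: fun_eq_iff)
  finally show ?thesis by simp
qed

lemma mean_trig_sum:
  assumes "finite U" "U \<subseteq> dual_lattice" "v \<in> dual_lattice"
  shows "mean (\<lambda>x. expi (- v) x *s (\<Sum>u\<in>U. expi u x *s c u)) 0 = (if v \<in> U then c v else 0)"
proof -
  have "mean (\<lambda>x. expi (- v) x *s (\<Sum>u\<in>U. expi u x *s c u)) 0
      = mean (\<lambda>x. \<Sum>u\<in>U. expi (- v) x *s (expi u x *s c u)) 0"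
    by (simp add: vec.scale_sum_right)
  also have "\<dots> = (\<Sum>u\<in>U. mean (\<lambda>x. expi (- v) x *s (expi u x *s c u)) 0)"
    by (rule mean_sum) (intro continuous_intros)
  also have "\<dots> = (\<Sum>u\<in>U. if v = u then c u else 0)"
    using assms by (intro sum.cong refl mean_expi_smult) auto
  finally show ?thesis using assms(1) by simp
qed

lemma expi_independent:
  assumes "finite U" "U \<subseteq> dual_lattice" "\<And>x. (\<Sum>u\<in>U. expi u x *s c u) = 0" "v \<in> U"
  shows "c v = (0 :: complex ^ 'k)"
proof -
  have "v \<in> dual_lattice" using assms by blast
  from mean_trig_sum[OF assms(1,2) this, of c]
  have "c v = mean (\<lambda>x. 0) 0" using assms(4) by (simp only: assms(3) if_True vec.scale_zero_right)
  then show ?thesis by (simp add: mean_def)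
qed

text \<open>\<open>M u\<close> stands for Clifford multiplication by u. The eigenvalue equation
  passes to the coefficients and, applied twice, leaves only those with 2 pi |u| = |r|. The
  difference between F and the resulting finite sum has no nonzero coefficient.\<close>

lemma eigenfunction_expansion:
  fixes F :: "real ^ 'n \<Rightarrow> complex ^ 'k" and M :: "real ^ 'n \<Rightarrow> complex ^ 'k ^ 'k" and r :: real
  assumes diff: "\<And>x. F differentiable (at x)"
    and C1: "\<And>v. continuous_on UNIV (\<lambda>x. frechet_derivative F (at x) v)"
    and per: "periodic F"
    and lin: "\<And>u w. M u *v w = (\<Sum>j\<in>UNIV. of_real (u $ j) *s (M (axis j 1) *v w))"
    and sq: "\<And>u w. M u *v (M u *v w) = (- of_real (u \<bullet> u)) *s w"
    and eig: "\<And>x. (\<Sum>j\<in>UNIV. M (axis j 1) *v frechet_derivative F (at x) (axis j 1)) = of_real r *s F x"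
  defines "c \<equiv> \<lambda>u. mean (\<lambda>x. expi (- u) x *s F x) 0"
  shows "u \<in> dual_lattice \<Longrightarrow> (2 * of_real pi * \<i>) *s (M u *v c u) = of_real r *s c u"
    and "F x = (\<Sum>u | u \<in> dual_lattice \<and> norm u = \<bar>r\<bar> / (2 * pi). expi u x *s c u)"
proof -
  let ?D = "\<lambda>x. frechet_derivative F (at x)"
  have D: "(F has_derivative ?D x) (at x)" for x
    using diff by (simp add: frechet_derivative_works)
  have contF: "continuous_on UNIV F"
    using diff by (simp add: continuous_on_eq_continuous_at differentiable_imp_continuous_within)
  have contE: "continuous_on UNIV (\<lambda>x. expi u x *s g x)" if "continuous_on UNIV g" for u and g :: "real ^ 'n \<Rightarrow> complex ^ 'k"
    by (intro continuous_intros that)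
  \<comment> \<open>Integration by parts: the derivative of \<open>expi (- u) x *s F x\<close> has
    mean 0.\<close>
  have coeffD: "mean (\<lambda>x. expi (- u) x *s ?D x v) 0 = (2 * of_real pi * \<i> * of_real (u \<bullet> v)) *s c u"
    if u: "u \<in> dual_lattice" for u v
  proof -
    have mu: "- u \<in> dual_lattice" using u by (rule dual_lattice_closed)
    have perG: "periodic (\<lambda>x. expi (- u) x *s F x)"
      using expi_periodic[OF mu] per by (simp add: periodic_def)
    let ?G' = "\<lambda>x v. expi (- u) x *s ?D x v + (2 * of_real pi * \<i> * of_real (- u \<bullet> v) * expi (- u) x) *s F x"
    have "((\<lambda>x. expi (- u) x *s F x) has_derivative ?G' x) (at x)" for x
      by (rule bounded_bilinear.FDERIV[OF bounded_bilinear_smult expi_derivative D])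
    moreover have "continuous_on UNIV (\<lambda>x. ?G' x v)" for v
      by (intro continuous_intros C1 contF)
    ultimately have "mean (\<lambda>x. ?G' x v) = (\<lambda>x. 0)" by (rule mean_derivative[OF perG])
    then have "0 = mean (\<lambda>x. expi (- u) x *s ?D x v + (- (2 * of_real pi * \<i> * of_real (u \<bullet> v))) *s (expi (- u) x *s F x)) 0"
      by (simp add: vector_smult_assoc fun_eq_iff)
    also have "\<dots> = mean (\<lambda>x. expi (- u) x *s ?D x v) 0
        + mean (\<lambda>x. (- (2 * of_real pi * \<i> * of_real (u \<bullet> v))) *s (expi (- u) x *s F x)) 0"
      unfolding mean_def
      by (subst avg_add) (intro contE C1 contF bounded_linear.continuous_on[OF bounded_linear_smult] refl)+
    also have "mean (\<lambda>x. (- (2 * of_real pi * \<i> * of_real (u \<bullet> v))) *s (expi (- u) x *s F x)) 0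
        = (- (2 * of_real pi * \<i> * of_real (u \<bullet> v))) *s c u"
      unfolding c_def by (rule mean_bounded_linear[OF contE[OF contF] bounded_linear_smult])
    finally show ?thesis by (simp add: vec.scale_minus_left)
  qed
  show eigc: "(2 * of_real pi * \<i>) *s (M u *v c u) = of_real r *s c u" if u: "u \<in> dual_lattice" for u
  proof -
    have "of_real r *s c u = mean (\<lambda>x. of_real r *s (expi (- u) x *s F x)) 0"
      unfolding c_def by (rule mean_bounded_linear[symmetric, OF contE[OF contF] bounded_linear_smult])
    also have "(\<lambda>x. of_real r *s (expi (- u) x *s F x)) = (\<lambda>x. expi (- u) x *s (of_real r *s F x))"
      by (simp add: vector_smult_assoc mult.commute)
    also have "\<dots> = (\<lambda>x. \<Sum>j\<in>UNIV. M (axis j 1) *v (expi (- u) x *s ?D x (axis j 1)))"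
      by (simp only: eig[symmetric] vec.scale_sum_right vector_scalar_commute)
    also have "mean \<dots> 0 = (\<Sum>j\<in>UNIV. mean (\<lambda>x. M (axis j 1) *v (expi (- u) x *s ?D x (axis j 1))) 0)"
      by (rule mean_sum) (intro bounded_linear.continuous_on[OF bounded_linear_matrix] contE C1)
    also have "\<dots> = (\<Sum>j\<in>UNIV. M (axis j 1) *v mean (\<lambda>x. expi (- u) x *s ?D x (axis j 1)) 0)"
      by (intro sum.cong refl mean_bounded_linear[OF contE[OF C1] bounded_linear_matrix])
    also have "\<dots> = (\<Sum>j\<in>UNIV. (2 * of_real pi * \<i>) *s (of_real (u $ j) *s (M (axis j 1) *v c u)))"
      by (intro sum.cong refl) (simp add: coeffD[OF u] vector_scalar_commute inner_axis vector_smult_assoc)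
    also have "\<dots> = (2 * of_real pi * \<i>) *s (M u *v c u)"
      by (simp only: vec.scale_sum_right[symmetric] lin[symmetric])
    finally show ?thesis by simp
  qed
  let ?U = "{u. u \<in> dual_lattice \<and> norm u = \<bar>r\<bar> / (2 * pi)}"
  have finU: "finite ?U" by (rule finite_dual_sphere)
  \<comment> \<open>Applying the coefficient equation twice gives (2 pi |u|)^2 c_u = r^2
    c_u.\<close>
  have c0: "c u = 0" if u: "u \<in> dual_lattice" "u \<notin> ?U" for u
  proof -
    let ?z = "2 * complex_of_real pi * \<i>"
    have "?z *s (M u *v (?z *s (M u *v c u))) = ?z *s (M u *v (of_real r *s c u))"
      by (simp only: eigc[OF u(1)])
    also have "\<dots> = of_real r *s (?z *s (M u *v c u))"
      by (simp only: vector_scalar_commute vector_smult_assoc mult.commute)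
    also have "\<dots> = of_real r *s (of_real r *s c u)" by (simp only: eigc[OF u(1)])
    finally have "(?z * ?z * - of_real (u \<bullet> u)) *s c u = (of_real r * of_real r) *s c u"
      by (simp only: vector_scalar_commute vector_smult_assoc sq mult.assoc)
    moreover have "?z * ?z * - of_real (u \<bullet> u) = of_real ((2 * pi * norm u)\<^sup>2)"
      by (simp add: power2_eq_square dot_square_norm algebra_simps)
    ultimately have "of_real ((2 * pi * norm u)\<^sup>2) *s c u = (of_real r * of_real r) *s c u" by (simp only:)
    then have "(of_real ((2 * pi * norm u)\<^sup>2) - of_real r * of_real r) *s c u = 0"
      by (simp only: vector_sub_rdistrib diff_self)
    then have "of_real ((2 * pi * norm u)\<^sup>2 - r\<^sup>2) *s c u = 0"
      by (simp only: of_real_diff power2_eq_square[of r] of_real_mult)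
    moreover have "(2 * pi * norm u)\<^sup>2 - r\<^sup>2 \<noteq> 0"
    proof
      assume "(2 * pi * norm u)\<^sup>2 - r\<^sup>2 = 0"
      then have "sqrt ((2 * pi * norm u)\<^sup>2) = sqrt (r\<^sup>2)" by simp
      then have "\<bar>2 * pi * norm u\<bar> = \<bar>r\<bar>" by (simp only: real_sqrt_abs)
      then have "norm u = \<bar>r\<bar> / (2 * pi)" by (simp add: abs_mult field_simps)
      then show False using u by simp
    qed
    ultimately show ?thesis by (simp only: vec.scale_eq_0_iff of_real_eq_0_iff simp_thms)
  qed
  define H where "H x = F x - (\<Sum>u\<in>?U. expi u x *s c u)" for x
  have contS: "continuous_on UNIV (\<lambda>x. \<Sum>u\<in>?U. expi u x *s c u)" by (intro continuous_intros)
  have contH: "continuous_on UNIV H" unfolding H_def by (intro continuous_intros contF)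
  have "H x $ j = 0" for j
  proof (rule fourier_unique[of "\<lambda>x. H x $ j"])
    show "continuous_on UNIV (\<lambda>x. H x $ j)" by (intro continuous_intros contH)
    show "periodic (\<lambda>x. H x $ j)"
      using per expi_periodic by (simp add: periodic_def H_def)
    fix v assume v: "v \<in> dual_lattice"
    have "mean (\<lambda>x. expi (- v) x *s H x) 0
        = mean (\<lambda>x. expi (- v) x *s F x) 0 - mean (\<lambda>x. expi (- v) x *s (\<Sum>u\<in>?U. expi u x *s c u)) 0"
      unfolding mean_def H_def vector_ssub_ldistrib
      by (subst avg_diff) (intro contE contF contS refl)+
    also have "\<dots> = c v - (if v \<in> ?U then c v else 0)"
      using mean_trig_sum[OF finU _ v, of c] by (simp add: c_def)
    also have "\<dots> = 0" using c0[OF v] by simp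
    finally have "mean (\<lambda>x. expi (- v) x *s H x) 0 $ j = 0" by simp
    moreover have "mean (\<lambda>x. (expi (- v) x *s H x) $ j) 0 = mean (\<lambda>x. expi (- v) x *s H x) 0 $ j"
      by (rule mean_bounded_linear[OF contE[OF contH] bounded_linear_vec_nth])
    ultimately show "mean (\<lambda>x. expi (- v) x * H x $ j) 0 = 0" by simp
  qed
  then have "H x = 0" by (simp add: vec_eq_iff)
  then show "F x = (\<Sum>u\<in>?U. expi u x *s c u)" by (simp add: H_def)
qed

end

section \<open>Coordinates in the Clifford algebra\<close>

lemma sdiff_simps [simp]: "sdiff I (sdiff I K) = K" "sdiff (sdiff K I) I = K"
  "sdiff {} K = K" "sdiff K {} = K" "sdiff K K = {}"
  by (auto simp: sdiff_def)

lemma sdiff_commute: "sdiff I J = sdiff J I"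
  by (auto simp: sdiff_def)

lemma even_card_sdiff:
  "even (card (sdiff I J)) \<longleftrightarrow> (even (card I) \<longleftrightarrow> even (card (J :: 'a::finite set)))"
proof -
  have "card (sdiff I J) + 2 * card (I \<inter> J) = card I + card J"
    using card_Un_disjoint[of "I - J" "J - I"] card_Int_Diff[of I J] card_Int_Diff[of J I]
    by (simp add: sdiff_def Int_commute Diff_disjoint inf.commute disjoint_iff)
  then show ?thesis by presburger
qed

lemma coord_sum: "coord (\<Sum>i\<in>A. f i) K = (\<Sum>i\<in>A. coord (f i) K)"
  by (induction A rule: infinite_finite_induct) (simp_all add: zero_cliff.rep_eq plus_cliff.rep_eq)

lemmas coord_simps [simp] = zero_cliff.rep_eq one_cliff.rep_eq plus_cliff.rep_eq minus_cliff.rep_eq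
  uminus_cliff.rep_eq scaleR_cliff.rep_eq cbasis.rep_eq

lemma coord_of_real [simp]: "coord (of_real c) K = (if K = {} then c else 0)"
  by (simp add: of_real_def)

lemma cliff_eqI: "(\<And>K. coord a K = coord b K) \<Longrightarrow> a = b"
  by (simp add: coord_inject[symmetric] fun_eq_iff)

lemma cliff_expand: "a = (\<Sum>I\<in>UNIV. coord a I *\<^sub>R cbasis I)"
  by (rule cliff_eqI) (simp add: coord_sum if_distrib cong: if_cong)

lemma coord_mult: "coord (a * b) K = (\<Sum>I\<in>UNIV. csgn I (sdiff I K) * coord a I * coord b (sdiff I K))"
  by (simp add: times_cliff.rep_eq)

lemma coord_cbasis_mult: "coord (cbasis J * a) K = csgn J (sdiff J K) * coord a (sdiff J K)"
proof -
  have "coord (cbasis J * a) K = (\<Sum>I\<in>{J}. csgn I (sdiff I K) * coord a (sdiff I K))"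
    unfolding coord_mult by (rule sum.mono_neutral_cong_right) auto
  then show ?thesis by simp
qed

lemma coord_mult_cbasis: "coord (a * cbasis J) K = csgn (sdiff J K) J * coord a (sdiff J K)"
proof -
  have "(sdiff I K = J) = (I = sdiff J K)" for I by (auto simp: sdiff_def)
  then have "coord (a * cbasis J) K = (\<Sum>I\<in>{sdiff J K}. csgn I (sdiff I K) * coord a I)"
    unfolding coord_mult by (intro sum.mono_neutral_cong_right) auto
  moreover have "sdiff (sdiff J K) K = J" by (auto simp: sdiff_def)
  ultimately show ?thesis by simp
qed

lemma csgn_empty [simp]: "csgn {} J = 1" "csgn J {} = 1"
  by (simp_all add: csgn_def)

lemma csgn_sq [simp]: "csgn I J * csgn I J = 1"
  unfolding csgn_def prod.distrib[symmetric] by (intro prod.neutral ballI) auto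

lemma csgn_nonzero [simp]: "csgn I J \<noteq> 0"
  by (metis csgn_sq mult_zero_left zero_neq_one)

lemma csgn_eq_iff: "csgn I J = csgn K L \<longleftrightarrow> csgn I J * csgn K L = 1"
  using csgn_sq[of I J] csgn_sq[of K L] by (metis mult.assoc mult_1 mult_1_right)

text \<open>Of the two factors belonging to a pair (i, j) exactly one is -1 when i and j differ, and
  both are when they agree. The product tells whether e_I and e_J commute or anticommute.\<close>

lemma csgn_mult_swap: "csgn I J * csgn J I = (- 1) ^ (card I * card J + card (I \<inter> J))"
proof -
  have "csgn J I = (\<Prod>i\<in>I. \<Prod>j\<in>J. if i \<le> j then -1 else 1)"
    unfolding csgn_def by (rule prod.swap)
  then have "csgn I J * csgn J I = (\<Prod>i\<in>I. \<Prod>j\<in>J. (if j \<le> i then -1 else 1) * (if i \<le> j then -1 else 1))"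
    by (simp only: csgn_def prod.distrib)
  also have "\<dots> = (\<Prod>i\<in>I. \<Prod>j\<in>J. (- 1) * (if i = j then - 1 else 1))"
    by (intro prod.cong refl) auto
  also have "\<dots> = (\<Prod>i\<in>I. (- 1) ^ card J * (if i \<in> J then - 1 else 1))"
    by (intro prod.cong refl) (simp only: prod.distrib prod_constant prod.delta'[OF finite])
  also have "\<dots> = ((- 1) ^ card J) ^ card I * (\<Prod>i\<in>I. if i \<in> J then - 1 else 1)"
    by (simp only: prod.distrib prod_constant)
  also have "(\<Prod>i\<in>I. if i \<in> J then - 1 else 1 :: real) = (\<Prod>i\<in>I \<inter> J. - 1)"
    by (rule prod.mono_neutral_cong_right) auto
  also have "\<dots> = (- 1) ^ card (I \<inter> J)" by simp
  finally show ?thesis by (simp add: power_mult[symmetric] power_add mult.commute)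
qed

text \<open>Induction on the largest element m: e_m passes the smaller generators at the price of
  one sign each and squares to -1.\<close>

lemma csgn_diag: "csgn F F = (- 1) ^ (card F * (card F + 1) div 2)"
proof -
  have "finite F" by simp
  then show ?thesis
  proof (induction F rule: finite_linorder_max_induct)
    case (insert m F)
    have m: "m \<notin> F" using insert.hyps by auto
    have 1: "csgn (insert m F) J = csgn {m} J * csgn F J" for J
      using m by (simp add: csgn_def)
    have 2: "csgn I (insert m F) = csgn I {m} * csgn I F" for I
      using m by (simp add: csgn_def prod.distrib)
    have "csgn {m} F = (\<Prod>j\<in>F. if j \<le> m then - 1 else 1)" by (simp add: csgn_def)
    also have "\<dots> = (\<Prod>j\<in>F. - 1)" by (rule prod.cong) (use insert.hyps in auto)
    finally have "csgn {m} F = (\<Prod>j\<in>F. - 1)" .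
    moreover have "csgn F {m} = 1" unfolding csgn_def using insert.hyps by (auto intro!: prod.neutral)
    moreover have "csgn {m} {m} = - 1" by (simp add: csgn_def)
    ultimately have "csgn (insert m F) (insert m F) = (- 1) ^ (card F + 1) * csgn F F"
      by (subst 1) (simp add: 2[of "{m}"] 2[of F])
    also have "\<dots> = (- 1) ^ (card F + 1 + card F * (card F + 1) div 2)"
      by (simp only: insert.IH power_add)
    also have "card F + 1 + card F * (card F + 1) div 2 = (card F + 1) * (card F + 2) div 2"
    proof -
      have "(card F + 1) * (card F + 2) = card F * (card F + 1) + (card F + 1) * 2"
        by (simp add: algebra_simps)
      then show ?thesis by simp
    qed
    finally show ?case using m by simp
  qed simp
qed

text \<open>Left and right multiplication by e_J move the same coordinate of a to a given place,
  with signs \<open>csgn J I\<close> and \<open>csgn I J\<close>. Commutation is thus tested on the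
  basis elements that occur in a.\<close>

lemma commute_cbasis:
  assumes "\<And>I. coord a I \<noteq> 0 \<Longrightarrow> csgn I J = csgn J I"
  shows "a * cbasis J = cbasis J * a"
  by (rule cliff_eqI) (metis assms coord_cbasis_mult coord_mult_cbasis mult_eq_0_iff)

lemma commute_cbasisD:
  assumes "a * cbasis J = cbasis J * a" "coord a I \<noteq> 0"
  shows "csgn I J = csgn J I"
  using arg_cong[OF assms(1), of "\<lambda>a. coord a (sdiff J I)"] assms(2)
  by (simp add: coord_cbasis_mult coord_mult_cbasis)

lemma coord_empty_commute: "coord (a * b) {} = coord (b * a) {}"
  by (simp add: coord_mult mult_ac)

text \<open>For odd n one of I and its complement has even size, so the two basis elements commute.
  The top coordinate is therefore a trace functional, besides the coordinate at 1.\<close>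

lemma coord_top_commute:
  fixes a b :: "'n::{finite,linorder} cliff"
  assumes "odd CARD('n)"
  shows "coord (a * b) UNIV = coord (b * a) UNIV"
proof -
  have sd: "sdiff I UNIV = - I" for I :: "'n set" by (auto simp: sdiff_def)
  have c: "csgn I (- I) = csgn (- I) I" for I :: "'n set"
  proof -
    have "card I + card (- I) = CARD('n)"
      using card_Un_disjoint[of I "- I"] by simp
    then have "even (card I * card (- I))" using assms by (metis even_add even_mult_iff)
    then show ?thesis unfolding csgn_eq_iff csgn_mult_swap by simp
  qed
  have "coord (a * b) UNIV = (\<Sum>I\<in>UNIV. csgn (- I) I * coord a I * coord b (- I))"
    unfolding coord_mult sd c ..
  also have "\<dots> = (\<Sum>I\<in>UNIV. csgn I (- I) * coord a (- I) * coord b I)"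
    by (rule sum.reindex_bij_witness[of _ uminus uminus]) auto
  also have "\<dots> = coord (b * a) UNIV"
    unfolding coord_mult sd by (simp add: mult_ac)
  finally show ?thesis .
qed

text \<open>The two summands of the grading by degree modulo 2, \<open>True\<close> for even. Zero
  lies in both.\<close>

definition parity :: "bool \<Rightarrow> 'n::{finite,linorder} cliff \<Rightarrow> bool" where
  "parity p a \<longleftrightarrow> (\<forall>I. coord a I \<noteq> 0 \<longrightarrow> (even (card I) \<longleftrightarrow> p))"

lemma parity_mult: "parity p a \<Longrightarrow> parity q b \<Longrightarrow> parity (p \<longleftrightarrow> q) (a * b)"
  unfolding parity_def
proof (intro allI impI)
  fix K assume a: "\<forall>I. coord a I \<noteq> 0 \<longrightarrow> even (card I) = p" and b: "\<forall>I. coord b I \<noteq> 0 \<longrightarrow> even (card I) = q"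
    and "coord (a * b) K \<noteq> 0"
  then obtain I where "coord a I \<noteq> 0" "coord b (sdiff I K) \<noteq> 0"
    unfolding coord_mult by (metis (no_types, lifting) mult_zero_left mult_zero_right sum.neutral)
  then have "even (card I) = p" "even (card (sdiff I K)) = q" using a b by blast+
  then show "even (card K) = (p = q)" unfolding even_card_sdiff by auto
qed

lemma parity_1: "parity True 1"
  by (simp add: parity_def)

lemma parity_cvec: "parity False (cvec v)"
proof -
  have c: "coord (cvec v) I = (\<Sum>i\<in>UNIV. v $ i * (if I = {i} then 1 else 0))" for I
    by (simp add: cvec_def coord_sum)
  have "\<exists>i. I = {i}" if "coord (cvec v) I \<noteq> 0" for I
  proof (rule ccontr)
    assume "\<nexists>i. I = {i}"
    then show False using that by (simp add: c)
  qed
  then show ?thesis by (force simp: parity_def)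
qed

lemma parity_spin: "g \<in> spin \<Longrightarrow> parity True g"
proof -
  have "parity (even (length vs)) (prod_list (map cvec vs))" for vs :: "'a rvec list"
  proof (induction vs)
    case (Cons v vs)
    show ?case using parity_mult[OF parity_cvec[of v] Cons] by (simp add: eq_commute)
  qed (simp add: parity_1)
  then show "g \<in> spin \<Longrightarrow> parity True g" by (auto simp: spin_def) (metis (full_types))
qed

section \<open>The spin group\<close>

lemma spin_mult: "g \<in> spin \<Longrightarrow> h \<in> spin \<Longrightarrow> g * h \<in> spin"
proof -
  assume "g \<in> spin" "h \<in> spin"
  then obtain vs ws where "g = prod_list (map cvec vs)" "h = prod_list (map cvec ws)"
    "even (length vs)" "even (length ws)" "\<forall>v\<in>set vs. norm v = 1" "\<forall>v\<in>set ws. norm v = 1"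
    by (auto simp: spin_def)
  then show ?thesis unfolding spin_def by (auto intro!: exI[of _ "vs @ ws"])
qed

text \<open>A unit vector squares to -1, so its inverse is its negative; products are inverted by
  reversal.\<close>

lemma spin_inverse:
  assumes "g \<in> spin"
  shows "cinv g \<in> spin" "g * cinv g = 1" "cinv g * g = 1"
proof -
  obtain vs where g: "g = prod_list (map cvec vs)" "even (length vs)" "\<forall>v\<in>set vs. norm v = 1"
    using assms by (auto simp: spin_def)
  define h where "h = prod_list (map cvec (rev (map uminus vs)))"
  have neg: "cvec (- v) = - cvec v" for v :: "'a rvec" by (rule linear_neg[OF linear_cvec])
  have "prod_list (map cvec vs) * prod_list (map cvec (rev (map uminus vs))) = 1 \<and>
      prod_list (map cvec (rev (map uminus vs))) * prod_list (map cvec vs) = 1"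
    using g(3)
  proof (induction vs)
    case (Cons v vs)
    let ?p = "prod_list (map cvec vs)" and ?q = "prod_list (map cvec (rev (map uminus vs)))"
    have sq: "cvec v * cvec v = - 1" using Cons.prems by (simp add: cvec_unit_sq)
    have IH: "?p * ?q = 1" "?q * ?p = 1" using Cons by auto
    have "(cvec v * ?p) * (?q * - cvec v) = cvec v * (?p * ?q) * - cvec v" by (simp add: mult.assoc)
    then have 1: "(cvec v * ?p) * (?q * - cvec v) = 1" by (simp add: IH sq)
    have "(?q * - cvec v) * (cvec v * ?p) = ?q * (- (cvec v * cvec v)) * ?p" by (simp add: mult.assoc)
    then have 2: "(?q * - cvec v) * (cvec v * ?p) = 1" by (simp add: IH sq)
    have "prod_list (map cvec (rev (map uminus (v # vs)))) = ?q * - cvec v" by (simp add: neg)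
    then show ?case using 1 2 by (simp del: mult_minus_left mult_minus_right)
  qed simp
  then have gh: "g * h = 1" "h * g = 1" by (simp_all add: g(1) h_def)
  moreover have "h \<in> spin"
    unfolding spin_def h_def using g by (auto intro!: exI[of _ "rev (map uminus vs)"])
  ultimately show "cinv g \<in> spin" "g * cinv g = 1" "cinv g * g = 1"
    by (simp_all add: cinv_eqI[OF gh])
qed

lemma spin_cancel [simp]:
  assumes "g \<in> spin"
  shows "g * (cinv g * a) = a" "cinv g * (g * a) = a"
  using spin_inverse[OF assms] by (simp_all flip: mult.assoc)

lemma cinv_mult: "g \<in> spin \<Longrightarrow> h \<in> spin \<Longrightarrow> cinv (g * h) = cinv h * cinv g"
  by (rule cinv_eqI) (simp_all add: mult.assoc spin_inverse)

lemma cinv_cinv: "g \<in> spin \<Longrightarrow> cinv (cinv g) = g"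
  by (rule cinv_eqI) (simp_all add: spin_inverse)

lemma conj_mult: "g \<in> spin \<Longrightarrow> (g * a * cinv g) * (g * b * cinv g) = g * (a * b) * cinv g"
  by (simp add: mult.assoc)

lemma conj_commute:
  assumes "g \<in> spin" "a * b = b * a"
  shows "(g * a * cinv g) * (g * b * cinv g) = (g * b * cinv g) * (g * a * cinv g)"
  by (simp only: conj_mult[OF assms(1)] assms(2))

lemma coord_conj_empty: "g \<in> spin \<Longrightarrow> coord (g * a * cinv g) {} = coord a {}"
  by (subst coord_empty_commute) simp

lemma coord_conj_top:
  fixes g :: "'n::{finite,linorder} cliff"
  shows "odd CARD('n) \<Longrightarrow> g \<in> spin \<Longrightarrow> coord (g * a * cinv g) UNIV = coord a UNIV"
  by (subst coord_top_commute) simp_all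

lemma mu_fixes_iff: "g \<in> spin \<Longrightarrow> mu g *v u = u \<longleftrightarrow> g * cvec u = cvec u * g"
proof -
  assume g: "g \<in> spin"
  have "mu g *v u = u \<longleftrightarrow> g * cvec u * cinv g = cvec u"
    by (simp flip: mu_spin[OF g] add: cvec_inject)
  also have "\<dots> \<longleftrightarrow> g * cvec u = cvec u * g"
  proof
    assume "g * cvec u * cinv g = cvec u"
    then have "g * cvec u * cinv g * g = cvec u * g" by simp
    then show "g * cvec u = cvec u * g" by (simp only: mult.assoc spin_inverse[OF g] mult_1_right)
  next
    assume "g * cvec u = cvec u * g"
    then have "g * cvec u * cinv g = cvec u * g * cinv g" by simp
    then show "g * cvec u * cinv g = cvec u" by (simp only: mult.assoc spin_inverse[OF g] mult_1_right)
  qed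
  finally show ?thesis .
qed

lemma norm_cvec_eq:
  assumes "cvec v * cvec v = - 1"
  shows "norm v = 1"
proof -
  have "of_real (- 2 * (v \<bullet> v)) = (of_real (- 2) :: 'a cliff)"
    using clifford_relation[of v v] assms by simp
  then have "v \<bullet> v = 1" by (simp only: of_real_eq_iff)
  then show ?thesis by (simp add: norm_eq_sqrt_inner)
qed

lemma cvec_sq: "cvec v * cvec v = - ((norm v)\<^sup>2) *\<^sub>R 1"
proof -
  have "2 *\<^sub>R (cvec v * cvec v) = 2 *\<^sub>R (- ((norm v)\<^sup>2) *\<^sub>R 1)"
    using clifford_relation[of v v] by (simp add: dot_square_norm scaleR_2 of_real_def)
  then show ?thesis by (simp only: scaleR_cancel_left) simp
qed

text \<open>Left multiplication by a unit vector is an isometry for \<open>\<Sum>\<^sub>I a\<^sub>I\<^sup>2\<close>.\<close>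
lemma spin_coord_norm: "g \<in> spin \<Longrightarrow> (\<Sum>I\<in>UNIV. (coord g I)\<^sup>2) = 1"
proof -
  define Q where "Q a b = (\<Sum>I\<in>UNIV. coord a I * coord b I)" for a b :: "'a cliff"
  have Qsum: "Q (\<Sum>i\<in>A. f i) b = (\<Sum>i\<in>A. Q (f i) b)" "Q b (\<Sum>i\<in>A. f i) = (\<Sum>i\<in>A. Q b (f i))"
    for f :: "'a \<Rightarrow> 'a cliff" and A b
    unfolding Q_def coord_sum sum_distrib_left sum_distrib_right by (rule sum.swap)+
  have Qscale: "Q (c *\<^sub>R a) b = c * Q a b" "Q a (c *\<^sub>R b) = c * Q a b" for a b c
    by (simp_all add: Q_def sum_distrib_left mult_ac)
  have skew: "Q (cbasis {j} * a) b = - Q a (cbasis {j} * b)" for a b :: "'a cliff" and j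
  proof -
    \<comment> \<open>Adding j to I or removing it changes only the factor of the pair (j, j), which
      is -1.\<close>
    have s: "csgn {j} (sdiff {j} I) = - csgn {j} I" for I :: "'a set"
    proof (cases "j \<in> I")
      case True
      then have "sdiff {j} I = I - {j}" by (auto simp: sdiff_def)
      then show ?thesis using True
        by (simp add: csgn_def prod.remove[of I j])
    next
      case False
      then have "sdiff {j} I = insert j I" by (auto simp: sdiff_def)
      then show ?thesis using False by (simp add: csgn_def)
    qed
    have "Q (cbasis {j} * a) b = (\<Sum>K\<in>UNIV. csgn {j} (sdiff {j} K) * coord a (sdiff {j} K) * coord b K)"
      by (simp add: Q_def coord_cbasis_mult)
    also have "\<dots> = (\<Sum>K\<in>UNIV. csgn {j} K * coord a K * coord b (sdiff {j} K))"
      by (rule sum.reindex_bij_witness[of _ "sdiff {j}" "sdiff {j}"]) auto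
    also have "\<dots> = - Q a (cbasis {j} * b)"
      by (simp add: Q_def coord_cbasis_mult s sum_negf[symmetric] mult_ac)
    finally show ?thesis .
  qed
  have skewv: "Q (cvec v * a) b = - Q a (cvec v * b)" for v a b
    by (simp add: cvec_def sum_distrib_right Qsum Qscale skew sum_negf)
  have "Q (prod_list (map cvec vs)) (prod_list (map cvec vs)) = 1" if "\<forall>v\<in>set vs. norm v = 1" for vs :: "'a rvec list"
    using that
  proof (induction vs)
    case Nil
    have "Q 1 1 = (\<Sum>I\<in>{{} :: 'a set}. 1)" unfolding Q_def by (rule sum.mono_neutral_cong_right) auto
    then show ?case by simp
  next
    case (Cons v vs)
    let ?p = "prod_list (map cvec vs)"
    have "cvec v * (cvec v * ?p) = - ?p" using Cons.prems by (simp flip: mult.assoc add: cvec_unit_sq)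
    then have "Q (cvec v * ?p) (cvec v * ?p) = - Q ?p ((- 1) *\<^sub>R ?p)" by (simp add: skewv)
    then show ?case using Cons by (simp only: Qscale) simp
  qed
  then show "g \<in> spin \<Longrightarrow> (\<Sum>I\<in>UNIV. (coord g I)\<^sup>2) = 1"
    by (auto simp: spin_def Q_def power2_eq_square)
qed

text \<open>An element over the identity commutes with all vectors. If e_I occurs in it with I
  nonempty, then |I| is even and e_I anticommutes with e_j for j in I. Only a scalar remains, and
  the coordinate norm makes it 1 or -1.\<close>

lemma mu_eq_1:
  assumes "g \<in> spin" "mu g = mat 1"
  shows "g = 1 \<or> g = - 1"
proof -
  have "coord g I = 0" if ne: "I \<noteq> {}" for I
  proof (rule ccontr)
    assume I: "coord g I \<noteq> 0"
    then have ev: "even (card I)" using parity_spin[OF assms(1)] by (simp add: parity_def)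
    obtain j where j: "j \<in> I" using ne by blast
    have "g * cbasis {j} = cbasis {j} * g"
      using mu_fixes_iff[OF assms(1), of "axis j 1"] assms(2) by simp
    then have "csgn I {j} * csgn {j} I = 1" using commute_cbasisD[OF _ I] by (simp add: csgn_eq_iff)
    then show False using ev j unfolding csgn_mult_swap by simp
  qed
  then have g: "g = coord g {} *\<^sub>R 1" by (intro cliff_eqI) simp
  have "(\<Sum>I\<in>UNIV. (coord g I)\<^sup>2) = (\<Sum>I\<in>{{}}. (coord g I)\<^sup>2)"
    by (rule sum.mono_neutral_right) (use \<open>\<And>I. I \<noteq> {} \<Longrightarrow> coord g I = 0\<close> in auto)
  then have "(coord g {})\<^sup>2 = 1" using spin_coord_norm[OF assms(1)] by simp
  then have "coord g {} = 1 \<or> coord g {} = - 1" by (simp add: power2_eq_1_iff)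
  then show ?thesis using g by (metis scaleR_minus1_left scaleR_one)
qed

section \<open>Subalgebras and traces of Clifford modules\<close>

definition front :: "nat \<Rightarrow> 'n::{finite,linorder} set" where
  "front N = set (take N (sorted_list_of_set UNIV))"

lemma card_front: "N \<le> CARD('n) \<Longrightarrow> card (front N :: 'n::{finite,linorder} set) = N"
  unfolding front_def by (subst distinct_card) (auto simp: min_def)

lemma sorted_list_of_front: "sorted_list_of_set (front N :: 'n::{finite,linorder} set) = take N (sorted_list_of_set UNIV)"
  unfolding front_def
  by (rule sorted_list_of_set.idem_if_sorted_distinct) (auto intro: sorted_wrt_take)

lemma front_top: "front CARD('n) = (UNIV :: 'n::{finite,linorder} set)"
  by (simp add: front_def)

lemma front_eq_image: "N \<le> CARD('n) \<Longrightarrow> (front N :: 'n::{finite,linorder} set) = (\<lambda>j. sorted_list_of_set UNIV ! (j - 1)) ` {1..N}"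
proof -
  assume N: "N \<le> CARD('n)"
  have "(front N :: 'n set) = (\<lambda>i. sorted_list_of_set UNIV ! i) ` {0..<N}"
    unfolding front_def using N by (simp add: nth_image)
  also have "{0..<N} = (\<lambda>j. j - 1) ` {1..N}"
    by (auto simp: image_iff intro!: bexI[of _ "Suc _"])
  finally show ?thesis by (simp add: image_image)
qed

lemma eb_image: "N \<le> CARD('n) \<Longrightarrow> eb ` {1..N} = (\<lambda>i :: 'n::{finite,linorder}. axis i (1::real)) ` front N"
  by (simp add: front_eq_image image_image eb_def)

definition top_index :: "'n::{finite,linorder}" where
  "top_index = sorted_list_of_set UNIV ! (CARD('n) - 1)"

lemma eb_top: "eb CARD('n) = (axis top_index 1 :: 'n::{finite,linorder} rvec)"
  by (simp add: eb_def top_index_def)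

lemma front_insert_top: "insert top_index (front (CARD('n) - 1)) = (UNIV :: 'n::{finite,linorder} set)"
proof -
  have "take (Suc (CARD('n) - 1)) (sorted_list_of_set (UNIV :: 'n set))
      = take (CARD('n) - 1) (sorted_list_of_set UNIV) @ [top_index]"
    unfolding top_index_def by (rule take_Suc_conv_app_nth) (simp add: card_gt_0_iff)
  moreover have "Suc (CARD('n) - 1) = CARD('n)" using card_gt_0_iff[of "UNIV :: 'n set"] by simp
  ultimately show ?thesis unfolding front_def by (metis front_def front_top list.simps(15) rotate1.simps(2) set_rotate1 empty_set insert_def list.set(2) set_append Un_insert_right sup_bot_right)
qed

lemma top_notin_front: "(top_index :: 'n::{finite,linorder}) \<notin> front (CARD('n) - 1)"
proof
  assume "(top_index :: 'n) \<in> front (CARD('n) - 1)"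
  then have "(front (CARD('n) - 1) :: 'n set) = UNIV" using front_insert_top by (metis insert_absorb)
  then have "CARD('n) = CARD('n) - 1" using card_front[of "CARD('n) - 1", where 'n = 'n] by simp
  moreover have "CARD('n) > 0" by simp
  ultimately show False by linarith
qed

lemma less_top: "i \<in> front (CARD('n) - 1) \<Longrightarrow> i < (top_index :: 'n::{finite,linorder})"
proof -
  assume i: "i \<in> front (CARD('n) - 1)"
  have "i \<le> top_index"
  proof -
    obtain k where k: "k < CARD('n) - 1" "i = sorted_list_of_set UNIV ! k"
      using i unfolding front_def by (auto simp: in_set_conv_nth)
    then show ?thesis unfolding top_index_def
      by (simp add: sorted_nth_mono)
  qed
  moreover have "i \<noteq> top_index" using i top_notin_front by blast
  ultimately show ?thesis by simp
qed

lemma prod_eb: "N \<le> CARD('n) \<Longrightarrow>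
    prod_list (map (\<lambda>j. cvec (eb j)) [1..<N + 1]) = (cbasis (front N) :: 'n::{finite,linorder} cliff)"
proof -
  assume N: "N \<le> CARD('n)"
  have "map (\<lambda>j. cvec (eb j) :: 'n cliff) [1..<N + 1] = map (\<lambda>i. cvec (axis i 1)) (take N (sorted_list_of_set UNIV))"
    by (rule nth_equalityI) (use N in \<open>auto simp: eb_def simp del: upt_Suc\<close>)
  then show ?thesis by (simp only: cbasis_eq_prod sorted_list_of_front)
qed

text \<open>Turns membership in the subalgebra into a condition on the support of the coordinates,
  so that closure properties become statements about sets of indices.\<close>

lemma cl_eq:
  assumes N: "N \<le> CARD('n)"
  shows "cl N = {a :: 'n::{finite,linorder} cliff. \<forall>I. coord a I \<noteq> 0 \<longrightarrow> I \<subseteq> front N}"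
proof
  show "cl N \<subseteq> {a :: 'n cliff. \<forall>I. coord a I \<noteq> 0 \<longrightarrow> I \<subseteq> front N}"
    unfolding cl_def
  proof (rule span_minimal)
    show "subspace {a :: 'n cliff. \<forall>I. coord a I \<noteq> 0 \<longrightarrow> I \<subseteq> front N}"
      unfolding subspace_def
    proof (intro conjI ballI allI CollectI impI)
      fix a b :: "'n cliff" and I
      assume "a \<in> {a. \<forall>I. coord a I \<noteq> 0 \<longrightarrow> I \<subseteq> front N}" "b \<in> {a. \<forall>I. coord a I \<noteq> 0 \<longrightarrow> I \<subseteq> front N}" "coord (a + b) I \<noteq> 0"
      then show "I \<subseteq> front N" by (cases "coord a I = 0") auto
    qed auto
    have "coord (prod_list (map cvec vs)) I \<noteq> 0 \<Longrightarrow> I \<subseteq> front N" if "set vs \<subseteq> eb ` {1..N}" for vs :: "'n rvec list" and I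
      using that
    proof (induction vs arbitrary: I)
      case (Cons v vs)
      then obtain i where i: "i \<in> front N" "v = axis i 1" using eb_image[OF N] by auto
      then have "coord (prod_list (map cvec vs)) (sdiff {i} I) \<noteq> 0"
        using Cons.prems(1) by (simp add: coord_cbasis_mult)
      then have "sdiff {i} I \<subseteq> front N" using Cons by simp
      then show ?case using i by (auto simp: sdiff_def)
    qed (auto split: if_splits)
    then show "{prod_list (map cvec vs) |vs. set vs \<subseteq> eb ` {1..N}} \<subseteq> {a :: 'n cliff. \<forall>I. coord a I \<noteq> 0 \<longrightarrow> I \<subseteq> front N}"
      by blast
  qed
next
  show "{a :: 'n cliff. \<forall>I. coord a I \<noteq> 0 \<longrightarrow> I \<subseteq> front N} \<subseteq> cl N"
  proof
    fix a :: "'n cliff" assume "a \<in> {a. \<forall>I. coord a I \<noteq> 0 \<longrightarrow> I \<subseteq> front N}"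
    then have a: "coord a I \<noteq> 0 \<Longrightarrow> I \<subseteq> front N" for I by blast
    have "cbasis I \<in> cl N" if "I \<subseteq> front N" for I :: "'n set"
    proof -
      have "cbasis I = prod_list (map cvec (map (\<lambda>i. axis i 1) (sorted_list_of_set I)))"
        by (simp only: cbasis_eq_prod map_map o_def)
      moreover have "set (map (\<lambda>i. axis i 1) (sorted_list_of_set I)) \<subseteq> eb ` {1..N}"
        using that unfolding eb_image[OF N] by auto
      ultimately show ?thesis unfolding cl_def by (intro span_base) blast
    qed
    then have "coord a I *\<^sub>R cbasis I \<in> cl N" for I
      using a[of I] unfolding cl_def by (cases "coord a I = 0") (auto intro: span_scale span_zero)
    then have "(\<Sum>I\<in>UNIV. coord a I *\<^sub>R cbasis I) \<in> cl N"
      unfolding cl_def by (intro span_sum) auto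
    then show "a \<in> cl N" by (simp flip: cliff_expand)
  qed
qed

lemma cl_top: "cl CARD('n) = (UNIV :: 'n::{finite,linorder} cliff set)"
  by (simp add: cl_eq front_top)

lemma cl_add_scale: "a \<in> cl N \<Longrightarrow> b \<in> cl N \<Longrightarrow> a + b \<in> cl N" "a \<in> cl N \<Longrightarrow> c *\<^sub>R a \<in> cl N" "0 \<in> cl N"
  unfolding cl_def by (intro span_add span_scale span_zero; assumption)+

lemma cl_mult:
  fixes a b :: "'n::{finite,linorder} cliff"
  assumes "N \<le> CARD('n)" "a \<in> cl N" "b \<in> cl N"
  shows "a * b \<in> cl N"
  unfolding cl_eq[OF assms(1)]
proof (intro CollectI allI impI)
  fix K assume "coord (a * b) K \<noteq> 0"
  then obtain I where "coord a I \<noteq> 0" "coord b (sdiff I K) \<noteq> 0"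
    unfolding coord_mult by (metis (no_types, lifting) mult_zero_left mult_zero_right sum.neutral)
  then have "I \<subseteq> front N" "sdiff I K \<subseteq> front N" using assms by (auto simp: cl_eq)
  then show "K \<subseteq> front N" by (auto simp: sdiff_def)
qed

lemma trace_scaleR: "trace (c *\<^sub>R (A :: complex ^ 's ^ 's)) = of_real c * trace A"
  by (simp add: trace_def sum_distrib_left scaleR_conv_of_real[where 'a = complex])

lemma trace_neg: "trace (- (A :: complex ^ 's ^ 's)) = - trace A"
  by (simp add: trace_def sum_negf)

lemma trace_sum: "trace (\<Sum>i\<in>I. f i :: complex ^ 's ^ 's) = (\<Sum>i\<in>I. trace (f i))"
  by (induction I rule: infinite_finite_induct) (simp_all add: trace_def sum.distrib)

lemma matrix_neg_left: "(- A) ** B = - (A ** B :: complex ^ 's ^ 't)"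
  and matrix_neg_right: "A ** (- B) = - (A ** B :: complex ^ 's ^ 't)"
  by (simp_all add: vec_eq_iff matrix_matrix_mult_def sum_negf)

locale clifford_rep =
  fixes N :: nat and L :: "'n::{finite,linorder} cliff \<Rightarrow> complex ^ 's ^ 's"
  assumes rep: "cl_rep N L" and N: "N \<le> CARD('n)"
begin

lemma L_one: "L 1 = mat 1" using rep by (simp add: cl_rep_def)
lemma L_add: "a \<in> cl N \<Longrightarrow> b \<in> cl N \<Longrightarrow> L (a + b) = L a + L b" using rep by (simp add: cl_rep_def)
lemma L_mult: "a \<in> cl N \<Longrightarrow> b \<in> cl N \<Longrightarrow> L (a * b) = L a ** L b" using rep by (simp add: cl_rep_def)
lemma L_scale: "a \<in> cl N \<Longrightarrow> L (c *\<^sub>R a) = c *\<^sub>R L a" using rep by (simp add: cl_rep_def)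

lemma cl_iff: "(a :: 'n cliff) \<in> cl N \<longleftrightarrow> (\<forall>I. coord a I \<noteq> 0 \<longrightarrow> I \<subseteq> front N)"
  by (simp add: cl_eq[OF N])

lemma cbasis_cl: "I \<subseteq> front N \<Longrightarrow> (cbasis I :: 'n cliff) \<in> cl N"
  by (simp add: cl_iff)

lemma one_cl: "(1 :: 'n cliff) \<in> cl N"
  by (simp add: cl_iff)

lemma L_sum: "(\<And>i. i \<in> A \<Longrightarrow> f i \<in> cl N) \<Longrightarrow> L (sum f A) = (\<Sum>i\<in>A. L (f i)) \<and> sum f A \<in> cl N"
proof (induction A rule: infinite_finite_induct)
  case empty
  then show ?case using L_scale[OF one_cl, of 0] by (simp add: cl_add_scale)
next
  case (infinite A)
  then show ?case using L_scale[OF one_cl, of 0] by (simp add: cl_add_scale)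
next
  case (insert i A)
  then show ?case by (simp add: L_add cl_add_scale)
qed

lemma chi_expand:
  assumes "a \<in> cl N"
  shows "chi L a = (\<Sum>I\<in>Pow (front N). of_real (coord a I) * chi L (cbasis I))"
proof -
  have "(\<Sum>I\<in>UNIV. coord a I *\<^sub>R cbasis I) = (\<Sum>I\<in>Pow (front N). coord a I *\<^sub>R cbasis I)"
    by (rule sum.mono_neutral_right) (use assms in \<open>auto simp: cl_iff\<close>)
  then have a: "a = (\<Sum>I\<in>Pow (front N). coord a I *\<^sub>R cbasis I)" by (simp flip: cliff_expand)
  have "L a = (\<Sum>I\<in>Pow (front N). L (coord a I *\<^sub>R cbasis I))"
    by (subst a) (rule L_sum[THEN conjunct1], simp add: cl_add_scale cbasis_cl)
  then have "L a = (\<Sum>I\<in>Pow (front N). coord a I *\<^sub>R L (cbasis I))"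
    by (simp add: L_scale cbasis_cl)
  then show ?thesis by (simp add: chi_def trace_sum trace_scaleR)
qed

text \<open>If \<open>e\<^sub>j\<close> anticommutes with \<open>e\<^sub>I\<close>, then \<open>L(e\<^sub>I)\<close> is conjugate to \<open>-L(e\<^sub>I)\<close>.\<close>
lemma chi_cbasis_zero:
  assumes "I \<subseteq> front N" "j \<in> front N" "odd (card (I - {j}))"
  shows "chi L (cbasis I) = 0"
proof -
  have jj: "cbasis {j} \<in> cl N" "cbasis I \<in> cl N" using assms by (simp_all add: cbasis_cl)
  have "csgn I {j} * csgn {j} I = - 1"
  proof -
    have "card I + card (I \<inter> {j}) = card (I - {j}) + 2 * card (I \<inter> {j})"
      using card_Int_Diff[of I "{j}"] by simp
    then show ?thesis unfolding csgn_mult_swap using assms(3) by (simp add: uminus_power_if)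
  qed
  then have "csgn I {j} = - csgn {j} I" using csgn_sq[of "{j}" I] csgn_sq[of I "{j}"]
    by (metis mult.assoc mult_1_right mult_minus_left mult_1_left)
  then have "cbasis I * cbasis {j} = (- 1) *\<^sub>R (cbasis {j} * cbasis I)"
    by (simp add: cbasis_mult sdiff_commute)
  then have "L (cbasis I) ** L (cbasis {j}) = (- 1) *\<^sub>R (L (cbasis {j}) ** L (cbasis I))"
    using L_mult[OF jj(2,1)] L_mult[OF jj] L_scale[OF cl_mult[OF N jj], of "- 1"] by simp
  moreover have "cbasis {j} * cbasis {j} = (- 1) *\<^sub>R (1 :: 'n cliff)"
    by (simp add: cvec_unit_sq norm_axis_1 flip: cvec_axis)
  then have "L (cbasis {j}) ** L (cbasis {j}) = - mat 1"
    using L_mult[OF jj(1,1)] L_scale[OF one_cl, of "- 1"] by (simp add: L_one)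
  ultimately have "L (cbasis {j}) ** (L (cbasis I) ** L (cbasis {j})) = L (cbasis I)"
    by (simp add: matrix_mul_assoc matrix_neg_left matrix_neg_right)
  then have "trace (L (cbasis I)) = trace (L (cbasis {j}) ** (L (cbasis I) ** L (cbasis {j})))" by simp
  also have "\<dots> = trace ((L (cbasis I) ** L (cbasis {j})) ** L (cbasis {j}))" by (rule trace_mul_sym)
  also have "\<dots> = trace (- L (cbasis I))"
    using \<open>L (cbasis {j}) ** L (cbasis {j}) = - mat 1\<close>
    by (simp flip: matrix_mul_assoc add: matrix_neg_right)
  finally show ?thesis by (simp add: chi_def trace_neg)
qed

lemma chi_one: "chi L 1 = of_nat CARD('s)"
  by (simp add: chi_def L_one trace_I)

lemma cbasis_empty: "cbasis {} = (1 :: 'n cliff)"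
  by (rule cliff_eqI) simp

text \<open>A nonempty I of even size contains some j, and e_j anticommutes with e_I; only the
  coordinate at 1 survives.\<close>

lemma chi_even:
  assumes "a \<in> cl N" "parity True a"
  shows "chi L a = of_nat CARD('s) * of_real (coord a {})"
proof -
  have "chi L a = (\<Sum>I\<in>{{}}. of_real (coord a I) * chi L (cbasis I))"
    unfolding chi_expand[OF assms(1)]
  proof (rule sum.mono_neutral_right)
    show "\<forall>I\<in>Pow (front N) - {{}}. of_real (coord a I) * chi L (cbasis I) = 0"
    proof
      fix I :: "'n set" assume I: "I \<in> Pow (front N) - {{}}"
      then obtain j where j: "j \<in> I" by blast
      show "of_real (coord a I) * chi L (cbasis I) = 0"
      proof (cases "coord a I = 0")
        case False
        then have "even (card I)" using assms(2) by (simp add: parity_def)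
        moreover have "card I = Suc (card (I - {j}))" by (rule card.remove[OF finite j])
        ultimately have "odd (card (I - {j}))" by simp
        then show ?thesis using chi_cbasis_zero[of I j] I j by auto
      qed simp
    qed
  qed auto
  then show ?thesis by (simp add: cbasis_empty chi_one)
qed

text \<open>If I has odd size and misses some j of \<open>front N\<close>, then e_j anticommutes
  with e_I; only the product of all generators survives.\<close>

lemma chi_odd:
  assumes "a \<in> cl N" "parity False a"
  shows "chi L a = of_real (coord a (front N)) * chi L (cbasis (front N))"
proof -
  have "chi L a = (\<Sum>I\<in>{front N}. of_real (coord a I) * chi L (cbasis I))"
    unfolding chi_expand[OF assms(1)]
  proof (rule sum.mono_neutral_right)
    show "\<forall>I\<in>Pow (front N) - {front N}. of_real (coord a I) * chi L (cbasis I) = 0"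
    proof
      fix I :: "'n set" assume I: "I \<in> Pow (front N) - {front N}"
      then obtain j where j: "j \<in> front N" "j \<notin> I" by blast
      show "of_real (coord a I) * chi L (cbasis I) = 0"
      proof (cases "coord a I = 0")
        case False
        then have "odd (card (I - {j}))" using assms(2) j by (simp add: parity_def)
        then show ?thesis using chi_cbasis_zero[of I j] I j by auto
      qed simp
    qed
  qed auto
  then show ?thesis by simp
qed

lemma chi_odd_even_dim:
  assumes "a \<in> cl N" "parity False a" "even N"
  shows "chi L a = 0"
proof -
  have "coord a (front N) = 0"
    using assms(2,3) card_front[OF N] by (auto simp: parity_def)
  then show ?thesis by (simp add: chi_odd[OF assms(1,2)])
qed

end

section \<open>Complex multiples of matrices, eigenprojections and half-spin characters\<close>

definition smat :: "complex \<Rightarrow> complex ^ 's ^ 's \<Rightarrow> complex ^ 's ^ 's" where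
  "smat z A = (\<chi> i j. z * A $ i $ j)"

lemma smat_vector: "smat z A *v w = z *s (A *v w)"
  by (simp add: vec_eq_iff smat_def matrix_vector_mult_def sum_distrib_left mult.assoc)

lemma trace_smat: "trace (smat z A) = z * trace A"
  by (simp add: trace_def smat_def sum_distrib_left)

lemma smat_mult_left: "smat z A ** B = smat z (A ** B)"
  by (simp add: vec_eq_iff smat_def matrix_matrix_mult_def sum_distrib_left mult.assoc)

lemma smat_mult_right: "A ** smat z B = smat z (A ** B)"
  by (simp add: vec_eq_iff smat_def matrix_matrix_mult_def sum_distrib_left mult.left_commute)

lemma smat_smat: "smat z (smat y A) = smat (z * y) A"
  by (simp add: vec_eq_iff smat_def mult.assoc)

lemma smat_one [simp]: "smat 1 A = A"
  by (simp add: vec_eq_iff smat_def)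

lemma scaleR_eq_smat: "c *\<^sub>R A = smat (of_real c) A"
proof (rule vec_eq_iff[THEN iffD2], rule allI, rule vec_eq_iff[THEN iffD2], rule allI)
  show "(c *\<^sub>R A) $ i $ j = smat (of_real c) A $ i $ j" for i j
    by (simp add: smat_def scaleR_conv_of_real[where 'a = complex])
qed

lemma trace_smat_one: "trace (smat z (mat 1 :: complex ^ 's ^ 's)) = z * of_nat CARD('s)"
  by (simp add: trace_smat trace_I)

text \<open>The projection onto the eigenspace of \<open>A\<close> for the eigenvalue \<open>1 / z\<close> when \<open>(zA)\<^sup>2 = 1\<close>.\<close>
definition half_proj :: "complex \<Rightarrow> complex ^ 's ^ 's \<Rightarrow> complex ^ 's ^ 's" where
  "half_proj z A = smat (1/2) (mat 1 + smat z A)"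

lemma half_proj_vector: "half_proj z A *v w = (1/2) *s (w + z *s (A *v w))"
  by (simp add: half_proj_def smat_vector matrix_vector_mult_add_rdistrib)

lemma half_proj_eq_iff: "half_proj z A *v w = w \<longleftrightarrow> z *s (A *v w) = w"
proof
  assume "half_proj z A *v w = w"
  then have "2 *s ((1/2) *s (w + z *s (A *v w))) = 2 *s w" by (simp add: half_proj_vector)
  then show "z *s (A *v w) = w" by (simp add: vector_smult_assoc vec_eq_iff)
next
  assume "z *s (A *v w) = w"
  then show "half_proj z A *v w = w" by (simp add: half_proj_vector vec_eq_iff)
qed

lemma half_proj_eigen:
  assumes "smat (z * z) (A ** A) = mat 1"
  shows "z *s (A *v (half_proj z A *v w)) = half_proj z A *v w"
proof -
  have "(z * z) *s (A *v (A *v w)) = w"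
    using arg_cong[OF assms, of "\<lambda>M. M *v w"] by (simp add: smat_vector matrix_vector_mul_assoc)
  then have "(1/2) *s ((z * z) *s (A *v (A *v w))) = (1/2) *s w" by (simp only:)
  then show ?thesis
    by (simp add: half_proj_vector vector_scalar_commute matrix_vector_right_distrib vector_smult_assoc
        vec.scale_right_distrib mult.commute mult.left_commute add.commute)
qed

lemma half_proj_idem:
  assumes "smat (z * z) (A ** A) = mat 1"
  shows "half_proj z A ** half_proj z A = half_proj z A"
proof -
  have "(half_proj z A ** half_proj z A) *v w = half_proj z A *v w" for w
    unfolding matrix_vector_mul_assoc[symmetric] half_proj_eq_iff by (rule half_proj_eigen[OF assms])
  then show ?thesis by (simp add: matrix_eq)
qed

lemma trace_half_proj: "trace (A ** half_proj z B) = (trace A + z * trace (A ** B)) / 2"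
  by (simp add: half_proj_def smat_mult_right matrix_add_ldistrib trace_smat trace_add add_divide_distrib)

lemma cbasis_sq: "cbasis F * cbasis F = (- 1) ^ (card F * (card F + 1) div 2) *\<^sub>R (1 :: 'n::{finite,linorder} cliff)"
proof -
  have "cbasis {} = (1 :: 'n cliff)" by (rule cliff_eqI) simp
  then show ?thesis by (simp add: cbasis_mult csgn_diag)
qed

context clifford_rep
begin

text \<open>For even K the exponent K(K + 1)/2 has the parity of K/2. K may be smaller than N, since
  in odd dimension n the half-spin spaces come from K = n - 1.\<close>

lemma L_volume_sq:
  assumes "K \<le> N" "even K"
  shows "L (cbasis (front K)) ** L (cbasis (front K)) = smat ((- 1) ^ (K div 2)) (mat 1)"
proof -
  have F: "(front K :: 'n set) \<subseteq> front N"
    unfolding front_def by (rule set_take_subset_set_take[OF assms(1)])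
  have card: "card (front K :: 'n set) = K" using assms(1) N by (intro card_front) simp
  have p: "(- 1 :: real) ^ (K * (K + 1) div 2) = (- 1) ^ (K div 2)"
    using assms(2) by (auto elim!: evenE simp: uminus_power_if)
  have "L (cbasis (front K)) ** L (cbasis (front K)) = L (cbasis (front K) * cbasis (front K))"
    by (rule L_mult[symmetric]; rule cbasis_cl[OF F])
  also have "\<dots> = (- 1) ^ (K div 2) *\<^sub>R mat 1"
    by (simp only: cbasis_sq card p L_scale[OF one_cl] L_one)
  finally show ?thesis by (simp add: scaleR_eq_smat)
qed

text \<open>The half-spin spaces are eigenspaces of the volume element W, with which every even a
  commutes. The trace on one of them is (tr a + z tr aW)/2, and the coordinate of aW at 1 is that of
  a at W up to sign.\<close>

lemma chi_half_even:
  assumes "even N" "a \<in> cl N" "parity True a" "s = 1 \<or> s = - 1"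
  shows "chi_half N s L a = of_nat CARD('s) / 2 *
    (of_real (coord a {}) + of_real s * \<i> ^ (N div 2) * of_real (coord a (front N)))"
proof -
  define q where "q = N div 2"
  define W where "W = cbasis (front N :: 'n set)"
  \<comment> \<open>The inverse of the eigenvalue s i^q that defines the half-spin space.\<close>
  define z where "z = of_real s * (- \<i>) ^ q"
  have Wcl: "W \<in> cl N" unfolding W_def by (rule cbasis_cl) simp
  have WW: "L W ** L W = smat ((- 1) ^ q) (mat 1)"
    unfolding W_def q_def by (rule L_volume_sq[OF order_refl assms(1)])
  have ii: "(- \<i>) ^ q * \<i> ^ q = 1" by (simp flip: power_mult_distrib)
  have zi: "z * (of_real s * \<i> ^ q) = 1"
    using assms(4) ii by (auto simp: z_def mult_ac)
  have "(- \<i>) ^ q * (- \<i>) ^ q * (- 1) ^ q = 1"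
    by (simp flip: power_mult_distrib)
  then have zz: "smat (z * z) (L W ** L W) = mat 1"
    unfolding WW smat_smat using assms(4) by (auto simp: z_def mult_ac)
  have prod: "prod_list (map (\<lambda>j. cvec (eb j)) [1..<N + 1]) = W"
    unfolding W_def by (rule prod_eb[OF N])
  have comm: "a * W = W * a"
    unfolding W_def
  proof (rule commute_cbasis)
    fix I assume I: "coord a I \<noteq> 0"
    then have "I \<subseteq> front N" "even (card I)" using assms(2,3) by (auto simp: cl_iff parity_def)
    then show "csgn I (front N) = csgn (front N) I"
      unfolding csgn_eq_iff csgn_mult_swap by (simp add: Int_absorb2)
  qed
  have half: "half_spin N s L = {w. half_proj z (L W) *v w = w}"
    unfolding half_spin_def prod half_proj_eq_iff q_def[symmetric]
  proof (intro Collect_cong)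
    fix w
    show "L W *v w = (of_real s * \<i> ^ q) *s w \<longleftrightarrow> z *s (L W *v w) = w"
    proof
      assume "L W *v w = (of_real s * \<i> ^ q) *s w"
      then show "z *s (L W *v w) = w" by (simp add: vector_smult_assoc zi)
    next
      assume e: "z *s (L W *v w) = w"
      have "L W *v w = (of_real s * \<i> ^ q) *s (z *s (L W *v w))"
        using zi by (simp add: vector_smult_assoc mult.commute)
      then show "L W *v w = (of_real s * \<i> ^ q) *s w" by (simp only: e)
    qed
  qed
  have "chi_half N s L a = trace (L a ** half_proj z (L W))"
    unfolding chi_half_def
  proof (rule trace_on_eq_trace[OF half half_proj_idem[OF zz]])
    fix w assume "w \<in> half_spin N s L"
    then have "z *s (L W *v w) = w" by (simp add: half half_proj_eq_iff)
    then have "z *s (L W *v (L a *v w)) = L a *v w"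
      using comm L_mult[OF assms(2) Wcl] L_mult[OF Wcl assms(2)]
      by (metis matrix_vector_mul_assoc vector_scalar_commute)
    then show "L a *v w \<in> half_spin N s L" by (simp add: half half_proj_eq_iff)
  qed
  also have "\<dots> = (chi L a + z * chi L (a * W)) / 2"
    by (simp add: trace_half_proj chi_def L_mult[OF assms(2) Wcl])
  also have "chi L (a * W) = of_nat CARD('s) * of_real (coord (a * W) {})"
  proof (rule chi_even)
    show "a * W \<in> cl N" by (rule cl_mult[OF N assms(2) Wcl])
    have "parity True W" using assms(1) card_front[OF N] by (auto simp: parity_def W_def)
    then show "parity True (a * W)" using parity_mult[OF assms(3)] by fastforce
  qed
  also have "coord (a * W) {} = (- 1) ^ q * coord a (front N)"
  proof -
    have "(- 1 :: real) ^ (N * (N + 1) div 2) = (- 1) ^ q"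
      using assms(1) by (auto elim!: evenE simp: uminus_power_if q_def)
    then show ?thesis by (simp add: W_def coord_mult_cbasis csgn_diag card_front[OF N])
  qed
  also have "chi L a = of_nat CARD('s) * of_real (coord a {})" by (rule chi_even[OF assms(2,3)])
  also have "z * (of_nat CARD('s) * of_real ((- 1) ^ q * coord a (front N)))
      = of_nat CARD('s) * (of_real s * \<i> ^ q * of_real (coord a (front N)))"
  proof -
    have "z * (- 1) ^ q = of_real s * \<i> ^ q" by (simp add: z_def mult.assoc flip: power_mult_distrib)
    then show ?thesis by (simp add: algebra_simps)
  qed
  finally show ?thesis by (simp add: q_def algebra_simps add_divide_distrib)
qed

end

lemma front_mult_top: "cbasis (front (CARD('n) - 1)) * cbasis {top_index} = (cbasis UNIV :: 'n::{finite,linorder} cliff)"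
proof -
  have "csgn (front (CARD('n) - 1)) {top_index :: 'n} = 1"
    unfolding csgn_def by (intro prod.neutral ballI) (use less_top[where 'n = 'n] in \<open>simp add: not_le\<close>)
  moreover have "sdiff (front (CARD('n) - 1)) {top_index :: 'n} = UNIV"
    using front_insert_top[where 'n = 'n] top_notin_front[where 'n = 'n] by (auto simp: sdiff_def)
  ultimately show ?thesis by (simp add: cbasis_mult)
qed

text \<open>On the half-spin space of sign s, e_1 ... e_(n-1) acts by s i^q and e_n by -s i. The
  signs cancel, so the volume element acts by the same scalar on both halves; this is where the
  normalization of S_n for odd n enters.\<close>

lemma chi_volume_odd:
  fixes L :: "'n::{finite,linorder} cliff \<Rightarrow> complex ^ 's ^ 's"
  assumes L: "spin_rep CARD('n) L" and odd: "odd CARD('n)"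
  shows "chi L (cbasis UNIV) = - (\<i> ^ (CARD('n) div 2 + 1)) * of_nat CARD('s)"
proof -
  interpret clifford_rep "CARD('n)" L using L by unfold_locales (simp_all add: spin_rep_def)
  define q where "q = CARD('n) div 2"
  have q: "(CARD('n) - 1) div 2 = q" "even (CARD('n) - 1)" using odd by (auto elim!: oddE simp: q_def)
  define W where "W = cbasis (front (CARD('n) - 1) :: 'n set)"
  have WW: "L W *v (L W *v w) = (- 1) ^ q *s w" for w
    using L_volume_sq[of "CARD('n) - 1"] q
    by (simp add: W_def matrix_vector_mul_assoc smat_vector)
  have prod: "prod_list (map (\<lambda>j. cvec (eb j)) [1..<CARD('n) - 1 + 1]) = W"
    unfolding W_def by (rule prod_eb) simp
  have vol: "L (cbasis UNIV) *v w = L W *v (L (cvec (eb CARD('n))) *v w)" for w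
  proof -
    have "L (cbasis UNIV) = L W ** L (cvec (eb CARD('n)))"
      unfolding W_def front_mult_top[symmetric] eb_top cvec_axis by (rule L_mult) (simp_all add: cl_top)
    then show ?thesis by (simp add: matrix_vector_mul_assoc)
  qed
  have eig: "L (cbasis UNIV) *v (w + (of_real s * (- \<i>) ^ q) *s (L W *v w))
      = - (\<i> ^ (q + 1)) *s (w + (of_real s * (- \<i>) ^ q) *s (L W *v w))"
    if s: "s = 1 \<or> s = - 1" for s :: real and w
  proof -
    let ?v = "w + (of_real s * (- \<i>) ^ q) *s (L W *v w)"
    have ss: "complex_of_real s * of_real s = 1" using s by auto
    have i1: "(- \<i>) ^ q * (- 1) ^ q = \<i> ^ q" by (simp flip: power_mult_distrib)
    have i2: "\<i> ^ q * (- \<i>) ^ q = 1" by (simp flip: power_mult_distrib)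
    have "L W *v ?v = L W *v w + (of_real s * ((- \<i>) ^ q * (- 1) ^ q)) *s w"
      by (simp add: matrix_vector_right_distrib vector_scalar_commute WW vector_smult_assoc mult.assoc)
    also have "\<dots> = (of_real s * \<i> ^ q) *s ?v"
    proof -
      have "(of_real s * \<i> ^ q) * (of_real s * (- \<i>) ^ q) = (of_real s * of_real s) * (\<i> ^ q * (- \<i>) ^ q)"
        by (simp only: mult_ac)
      then have "(of_real s * \<i> ^ q) * (of_real s * (- \<i>) ^ q) = 1" by (simp only: ss i2 mult_1)
      then show ?thesis by (simp only: vec.scale_right_distrib vector_smult_assoc i1 vec.scale_one add.commute)
    qed
    finally have h: "L W *v ?v = (of_real s * \<i> ^ q) *s ?v" .
    then have "?v \<in> half_spin (CARD('n) - 1) s L" unfolding half_spin_def prod q(1) by blast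
    then have "L (cvec (eb CARD('n))) *v ?v = (- of_real s * \<i>) *s ?v"
      using L odd s unfolding spin_rep_def by blast
    then have "L (cbasis UNIV) *v ?v = ((- of_real s * \<i>) * (of_real s * \<i> ^ q)) *s ?v"
      by (simp only: vol vector_scalar_commute h vector_smult_assoc)
    also have "(- of_real s * \<i>) * (of_real s * \<i> ^ q) = - ((of_real s * of_real s) * \<i> ^ (q + 1))" by simp
    finally show ?thesis by (simp only: ss mult_1)
  qed
  \<comment> \<open>Every w is half the sum of a vector in each half-spin space.\<close>
  have "L (cbasis UNIV) *v w = - (\<i> ^ (q + 1)) *s w" for w
  proof -
    let ?x = "(- \<i>) ^ q *s (L W *v w)"
    have a: "L (cbasis UNIV) *v (w + ?x) = - (\<i> ^ (q + 1)) *s (w + ?x)" using eig[of 1 w] by simp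
    have b: "L (cbasis UNIV) *v (w - ?x) = - (\<i> ^ (q + 1)) *s (w - ?x)" using eig[of "- 1" w] by simp
    have "L (cbasis UNIV) *v ((w + ?x) + (w - ?x)) = - (\<i> ^ (q + 1)) *s ((w + ?x) + (w - ?x))"
      unfolding matrix_vector_right_distrib[of _ "w + ?x" "w - ?x"] a b
      by (rule vec.scale_right_distrib[symmetric])
    moreover have "(w + ?x) + (w - ?x) = 2 *s w" by (simp add: vec_eq_iff)
    ultimately have "2 *s (L (cbasis UNIV) *v w) = 2 *s (- (\<i> ^ (q + 1)) *s w)"
      by (simp only: vector_scalar_commute vector_smult_assoc mult.commute)
    then show ?thesis by (simp only: vec.scale_cancel_left) simp
  qed
  then have "L (cbasis UNIV) = smat (- (\<i> ^ (q + 1))) (mat 1)"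
    by (simp add: matrix_eq smat_vector)
  then show ?thesis by (simp only: chi_def trace_smat_one q_def)
qed

lemma torus_cl:
  assumes "N \<le> CARD('n)"
  shows "torus N \<subseteq> (cl N :: 'n::{finite,linorder} cliff set)"
proof
  fix y :: "'n cliff" assume y: "y \<in> torus N"
  have one: "1 \<in> (cl N :: 'n cliff set)" by (simp add: cl_eq[OF assms])
  have r: "of_real c \<in> (cl N :: 'n cliff set)" for c by (simp add: cl_eq[OF assms])
  have vec: "cvec (eb j) \<in> (cl N :: 'n cliff set)" if "j \<in> {1..N}" for j
  proof -
    have "eb j \<in> (\<lambda>i :: 'n. axis i (1::real)) ` front N" using eb_image[OF assms] that by blast
    then show ?thesis by (auto simp: cl_eq[OF assms] split: if_splits)
  qed
  have prod: "prod_list xs \<in> cl N" if "\<forall>a\<in>set xs. a \<in> cl N" for xs :: "'n cliff list"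
    using that by (induction xs) (auto simp: one cl_mult[OF assms])
  show "y \<in> cl N"
  proof (cases "N = 1")
    case True
    then have "y = 1 \<or> y = - 1" using y by (simp add: torus_def)
    then show ?thesis by (auto simp: cl_eq[OF assms] split: if_splits)
  next
    case False
    then obtain t where t: "y = torus_elt (N div 2) t" using y by (auto simp: torus_def)
    show ?thesis unfolding t torus_elt_def
    proof (intro prod ballI)
      fix a :: "'n cliff"
      assume "a \<in> set (map (\<lambda>j. of_real (cos (t j)) + sin (t j) *\<^sub>R (cvec (eb (2 * j - 1)) * cvec (eb (2 * j)))) [1..<N div 2 + 1])"
      then obtain j where j: "1 \<le> j" "j \<le> N div 2"
        "a = of_real (cos (t j)) + sin (t j) *\<^sub>R (cvec (eb (2 * j - 1)) * cvec (eb (2 * j)))" by auto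
      show "a \<in> cl N" unfolding j(3)
        by (intro cl_add_scale r cl_mult[OF assms] vec) (use j in auto)
    qed
  qed
qed

section \<open>Conjugacy in \<open>Spin(n - 1)\<close> for odd \<open>n\<close>\<close>

text \<open>Conjugation by \<open>a\<close> fixes \<open>y\<close> and negates \<open>b\<close>.\<close>
lemma coord_top_orthogonal:
  fixes a b :: "'n::{finite,linorder} rvec"
  assumes odd: "odd CARD('n)" and ab: "a \<noteq> 0" "a \<bullet> b = 0" and y: "y * cvec a = cvec a * y"
  shows "coord (y * cvec b) UNIV = 0"
proof -
  have ba: "cvec b * cvec a = - (cvec a * cvec b)"
    using clifford_relation[of a b] ab(2) by (simp add: eq_neg_iff_add_eq_0 add.commute)
  have "coord (cvec a * (y * cvec b * cvec a)) UNIV = coord (y * cvec b * cvec a * cvec a) UNIV"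
    by (rule coord_top_commute[OF odd])
  also have "y * cvec b * cvec a * cvec a = (y * cvec b) * (cvec a * cvec a)" by (simp add: mult.assoc)
  also have "\<dots> = (- (norm a)\<^sup>2) *\<^sub>R (y * cvec b)" by (simp add: cvec_sq)
  finally have 1: "coord (cvec a * (y * cvec b * cvec a)) UNIV = - (norm a)\<^sup>2 * coord (y * cvec b) UNIV"
    by simp
  have "cvec a * (y * cvec b * cvec a) = y * cvec a * (cvec b * cvec a)" by (simp add: y mult.assoc)
  also have "\<dots> = - (y * (cvec a * cvec a) * cvec b)" by (simp add: ba mult.assoc)
  also have "\<dots> = (norm a)\<^sup>2 *\<^sub>R (y * cvec b)" by (simp add: cvec_sq)
  finally have "(norm a)\<^sup>2 * coord (y * cvec b) UNIV = - (norm a)\<^sup>2 * coord (y * cvec b) UNIV"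
    using 1 by simp
  then show ?thesis using ab(1) by simp
qed

text \<open>Conjugation by a unit vector w is the half-turn x -> 2(w . x)w - x. With w bisecting the
  angle between u and e_n it carries the direction of u to e_n.\<close>

lemma exists_rotation_to_top:
  assumes "CARD('n) \<ge> 2" "u \<noteq> (0 :: 'n::{finite,linorder} rvec)"
  shows "\<exists>h\<in>spin. h * cvec u * cinv h = norm u *\<^sub>R cvec (eb CARD('n))"
proof -
  define e where "e = (eb CARD('n) :: 'n rvec)"
  have e: "norm e = 1" by (simp add: e_def eb_top)
  define v where "v = (1 / norm u) *\<^sub>R u"
  have v: "norm v = 1" "u = norm u *\<^sub>R v" using assms(2) by (simp_all add: v_def)
  \<comment> \<open>The bisector degenerates for v = -e. Any unit vector orthogonal to e does there,
    and one exists because the dimension is at least 2.\<close>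
  obtain w where w: "norm w = 1" "(2 * (w \<bullet> v)) *\<^sub>R w - v = e"
  proof (cases "v = - e")
    case True
    have "2 \<le> DIM('n rvec)" using assms(1) by simp
    then obtain x where x: "x \<noteq> 0" "orthogonal e x" using orthogonal_to_vector_exists by blast
    define w where "w = (1 / norm x) *\<^sub>R x"
    have "norm w = 1" "w \<bullet> v = 0"
      using x True by (simp_all add: w_def orthogonal_def inner_commute)
    then show ?thesis using that[of w] True by simp
  next
    case False
    define x where "x = v + e"
    have x0: "x \<noteq> 0" using False by (simp add: x_def eq_neg_iff_add_eq_0)
    define w where "w = (1 / norm x) *\<^sub>R x"
    have w: "norm w = 1" using x0 by (simp add: w_def)
    have xx: "x \<bullet> x = 2 * (x \<bullet> v)"
    proof -
      have "e \<bullet> e = 1" "v \<bullet> v = 1" using e v(1) by (simp_all add: dot_square_norm)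
      then show ?thesis by (simp add: x_def inner_add_left inner_add_right inner_commute)
    qed
    have "(2 * (w \<bullet> v)) *\<^sub>R w = ((2 * (x \<bullet> v)) / (x \<bullet> x)) *\<^sub>R x"
      by (simp add: w_def dot_square_norm power2_eq_square)
    also have "\<dots> = x" using x0 by (simp add: xx[symmetric])
    finally show ?thesis using that[OF w] by (simp add: x_def)
  qed
  \<comment> \<open>The second factor makes h even, and conjugation by e fixes e.\<close>
  define h where "h = cvec e * cvec w"
  have h: "h \<in> spin" unfolding spin_def h_def
    by (rule CollectI, rule exI[of _ "[e, w]"]) (use e w in simp)
  have vw: "cvec v * cvec w = of_real (- 2 * (w \<bullet> v)) - cvec w * cvec v"
    using clifford_relation[of v w] by (simp add: algebra_simps inner_commute)
  have "h * cvec v = cvec e * (cvec w * cvec v)" by (simp add: h_def mult.assoc)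
  also have "cvec w * cvec v = cvec e * cvec w"
  proof -
    have "cvec e = (2 * (w \<bullet> v)) *\<^sub>R cvec w - cvec v"
      by (simp only: w(2)[symmetric] linear_diff[OF linear_cvec] linear_scale[OF linear_cvec])
    then have "cvec e * cvec w = (2 * (w \<bullet> v)) *\<^sub>R (cvec w * cvec w) - cvec v * cvec w"
      by (simp add: left_diff_distrib)
    also have "\<dots> = cvec w * cvec v"
      by (simp add: vw cvec_unit_sq[OF w(1)] of_real_def)
    finally show ?thesis by simp
  qed
  also have "cvec e * (cvec e * cvec w) = cvec e * h" by (simp add: h_def)
  finally have "h * cvec v * cinv h = cvec e" using spin_inverse[OF h] by (simp add: mult.assoc)
  then have "h * cvec u * cinv h = norm u *\<^sub>R cvec e"
    by (subst v(2)) (simp add: linear_scale[OF linear_cvec])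
  then show ?thesis using h e_def by blast
qed

lemma h_elt:
  assumes "CARD('n) \<ge> 2" "u \<noteq> (0 :: 'n::{finite,linorder} rvec)"
  shows "h_elt u \<in> spin" "h_elt u * cvec u * cinv (h_elt u) = norm u *\<^sub>R cvec (eb CARD('n))"
proof -
  have "h_elt u \<in> spin \<and> h_elt u * cvec u * cinv (h_elt u) = norm u *\<^sub>R cvec (eb CARD('n))"
    unfolding h_elt_def by (rule someI_ex) (use exists_rotation_to_top[OF assms] in blast)
  then show "h_elt u \<in> spin" "h_elt u * cvec u * cinv (h_elt u) = norm u *\<^sub>R cvec (eb CARD('n))" by auto
qed

text \<open>Write \<open>y = p g' p\<inverse>\<close> with \<open>g' = h g h\<inverse>\<close> and \<open>v = p e\<^sub>n p\<inverse>\<close>. If \<open>v = e\<^sub>n\<close> then \<open>p\<close> lies in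
  \<open>Spin(n - 1)\<close>; if \<open>v = -e\<^sub>n\<close> the two top coordinates are opposite; otherwise \<open>y\<close> fixes a plane
  and both vanish.\<close>
lemma coord_top_sigma:
  fixes g y h :: "'n::{finite,linorder} cliff" and u :: "'n rvec"
  defines "e \<equiv> eb CARD('n) :: 'n rvec"
  assumes odd: "odd CARD('n)" and g: "g \<in> spin" "g * cvec u = cvec u * g"
    and y: "conj_in spin g y" "y * cvec e = cvec e * y"
    and h: "h \<in> spin" "h * cvec u * cinv h = norm u *\<^sub>R cvec e"
  shows "coord (g * cvec u) UNIV
    = norm u * ((if conj_in spin1 (h * g * cinv h) y then 1 else - 1) * coord (y * cvec e) UNIV)"
proof -
  define g' where "g' = h * g * cinv h"
  have g': "g' \<in> spin" unfolding g'_def by (intro spin_mult spin_inverse g h)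
  have "coord (g * cvec u) UNIV = coord (h * (g * cvec u) * cinv h) UNIV"
    by (rule coord_conj_top[symmetric, OF odd h(1)])
  also have "h * (g * cvec u) * cinv h = g' * (norm u *\<^sub>R cvec e)"
    unfolding g'_def by (simp only: conj_mult[OF h(1), symmetric] h(2))
  finally have gu: "coord (g * cvec u) UNIV = norm u * coord (g' * cvec e) UNIV" by simp
  show ?thesis
  proof (cases "conj_in spin1 g' y")
    case True
    then obtain k where k: "k \<in> spin1" "y = k * g' * cinv k" by (auto simp: conj_in_def)
    then have ks: "k \<in> spin" and "k * cvec e = cvec e * k"
      using mu_fixes_iff[of k] by (auto simp: spin1_def e_def)
    then have "k * cvec e * cinv k = cvec e" using spin_inverse[OF ks] by (simp add: mult.assoc)
    then have "y * cvec e = k * (g' * cvec e) * cinv k"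
      unfolding k(2) using conj_mult[OF ks, of g' "cvec e"] by simp
    then show ?thesis using True gu coord_conj_top[OF odd ks] by (simp add: g'_def)
  next
    case False
    obtain k where k: "k \<in> spin" "y = k * g * cinv k" using y(1) by (auto simp: conj_in_def)
    define p where "p = k * cinv h"
    have p: "p \<in> spin" unfolding p_def by (intro spin_mult spin_inverse k h)
    have "p * g' * cinv p = y"
      unfolding p_def g'_def k(2) using h(1) k(1)
      by (simp add: cinv_mult cinv_cinv spin_inverse mult.assoc)
    then have yp: "y = p * g' * cinv p" by simp
    define v where "v = mu p *v e"
    have v: "cvec v = p * cvec e * cinv p" unfolding v_def by (rule mu_spin[OF p])
    have "norm e = 1" by (simp add: e_def eb_top)
    then have "cvec v * cvec v = - 1"
      unfolding v conj_mult[OF p] cvec_unit_sq[OF \<open>norm e = 1\<close>] using spin_inverse[OF p] by simp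
    then have nv: "norm v = 1" by (rule norm_cvec_eq)
    have "v \<noteq> e"
    proof
      assume "v = e"
      then have "p \<in> spin1" using p by (simp add: spin1_def v_def e_def)
      then show False using False yp by (auto simp: conj_in_def)
    qed
    have yv: "y * cvec v = p * (g' * cvec e) * cinv p"
      unfolding yp v by (rule conj_mult[OF p])
    then have c: "coord (g' * cvec e) UNIV = coord (y * cvec v) UNIV"
      using coord_conj_top[OF odd p] by simp
    have ge: "g' * cvec e = cvec e * g'" if "norm u \<noteq> 0"
    proof -
      have "g' * (norm u *\<^sub>R cvec e) = (norm u *\<^sub>R cvec e) * g'"
        using conj_commute[OF h(1) g(2)] by (simp only: g'_def h(2))
      then show ?thesis using that by simp
    qed
    have "norm u * coord (y * cvec v) UNIV = - (norm u * coord (y * cvec e) UNIV)"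
    \<comment> \<open>Both sides vanish for u = 0. Otherwise g' commutes with e, hence y commutes
      with v.\<close>
    proof (cases "norm u = 0")
      case nu: False
      have yv': "y * cvec v = cvec v * y"
        unfolding yp v using conj_commute[OF p ge[OF nu]] .
      define w where "w = v - (v \<bullet> e) *\<^sub>R e"
      have we: "e \<bullet> w = 0"
        using \<open>norm e = 1\<close> by (simp add: w_def inner_diff_right inner_commute dot_square_norm)
      have vw: "v = (v \<bullet> e) *\<^sub>R e + w" by (simp add: w_def)
      have cw: "cvec w = cvec v - (v \<bullet> e) *\<^sub>R cvec e"
        by (simp add: w_def linear_diff[OF linear_cvec] linear_scale[OF linear_cvec])
      have yw: "y * cvec w = cvec w * y" by (simp add: cw algebra_simps yv' y(2))
      have yvc: "coord (y * cvec v) UNIV = (v \<bullet> e) * coord (y * cvec e) UNIV + coord (y * cvec w) UNIV"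
        by (simp add: cw right_diff_distrib)
      show ?thesis
      proof (cases "w = 0")
        case True
        then have "v = (v \<bullet> e) *\<^sub>R e" using vw by simp
        then have "\<bar>v \<bullet> e\<bar> = 1" using nv \<open>norm e = 1\<close> by (metis mult_1_right norm_scaleR)
        then have "v \<bullet> e = - 1"
          using \<open>v \<noteq> e\<close> \<open>v = (v \<bullet> e) *\<^sub>R e\<close> by (metis abs_eq_iff abs_one scaleR_one abs_1)
        moreover have "cvec w = 0" unfolding True by (rule linear_0[OF linear_cvec])
        ultimately show ?thesis using yvc by simp
      next
        case wn: False
        have "coord (y * cvec e) UNIV = 0"
          by (rule coord_top_orthogonal[OF odd wn _ yw]) (use we in \<open>simp add: inner_commute\<close>)
        moreover have "coord (y * cvec w) UNIV = 0"
          by (rule coord_top_orthogonal[OF odd _ we y(2)]) (use \<open>norm e = 1\<close> in auto)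
        ultimately show ?thesis by (simp add: yvc)
      qed
    qed simp
    then show ?thesis using False gu c by (simp add: g'_def)
  qed
qed

section \<open>Kronecker products\<close>

lemma kron_mult: "kron A B ** kron C D = kron (A ** C) (B ** D)"
proof (rule vec_eq_iff[THEN iffD2], rule allI, rule vec_eq_iff[THEN iffD2], rule allI)
  fix p q
  have "(kron A B ** kron C D) $ p $ q
      = (\<Sum>k\<in>UNIV \<times> UNIV. (A $ fst p $ fst k * C $ fst k $ fst q) * (B $ snd p $ snd k * D $ snd k $ snd q))"
    by (simp add: kron_def matrix_matrix_mult_def mult_ac)
  also have "\<dots> = kron (A ** C) (B ** D) $ p $ q"
    by (simp add: kron_def matrix_matrix_mult_def sum_product sum.cartesian_product case_prod_beta)
  finally show "(kron A B ** kron C D) $ p $ q = kron (A ** C) (B ** D) $ p $ q" .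
qed

lemma kron_one: "kron (mat 1) (mat 1) = mat 1"
  by (auto simp: kron_def mat_def vec_eq_iff prod_eq_iff)

lemma trace_kron: "trace (kron A B) = trace A * trace B"
proof -
  have "trace (kron A B) = (\<Sum>p\<in>UNIV \<times> UNIV. A $ fst p $ fst p * B $ snd p $ snd p)"
    by (simp add: trace_def kron_def)
  also have "\<dots> = trace A * trace B"
    by (simp add: trace_def sum_product sum.cartesian_product case_prod_beta)
  finally show ?thesis .
qed

lemma kron_add_left: "kron (A + A') B = kron A B + kron A' B"
  by (simp add: kron_def vec_eq_iff algebra_simps)

lemma kron_smat_left: "kron (smat z A) B = smat z (kron A B)"
  by (simp add: kron_def smat_def vec_eq_iff algebra_simps)

section \<open>The action of the group on spinors with values in V\<close>

locale flat_spin_bundle =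
  fixes \<Gamma> :: "'n::{finite,linorder} isometry set"
    and \<epsilon> :: "'n isometry \<Rightarrow> 'n cliff"
    and \<rho> :: "'n isometry \<Rightarrow> complex ^ 'v ^ 'v"
    and L :: "'n cliff \<Rightarrow> complex ^ 's ^ 's"
  assumes Gamma: "bieberbach \<Gamma>"
    and eps: "spin_structure \<Gamma> \<epsilon>"
    and rho: "\<rho> \<in> hom (grp \<Gamma>) unitary_group" "\<forall>l\<in>transl_lattice \<Gamma>. \<rho> (transl l) = mat 1"
    and L: "cl_rep CARD('n) L"

sublocale flat_spin_bundle \<subseteq> isometry_group \<Gamma>
  by (rule isometry_group.intro) (use Gamma in \<open>simp add: bieberbach_def\<close>)

sublocale flat_spin_bundle \<subseteq> clifford_rep "CARD('n)" L
  using L by unfold_locales simp_all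

context flat_spin_bundle
begin

lemma L_mult_all: "L (a * b) = L a ** L b" and L_add_all: "L (a + b) = L a + L b"
  and L_scale_all: "L (c *\<^sub>R a) = c *\<^sub>R L a"
  by (simp_all add: L_mult L_add L_scale cl_top)

abbreviation "\<Lambda> \<equiv> transl_lattice \<Gamma>"
abbreviation "F \<equiv> holonomy \<Gamma>"

lemma disc: "discrete_group \<Gamma>" and coc: "compact_space (orbit_space \<Gamma>)"
  using Gamma by (simp_all add: bieberbach_def)

lemma finite_F: "finite F"
  by (rule finite_holonomy[OF disc coc])

lemma transl_in: "l \<in> \<Lambda> \<longleftrightarrow> transl l \<in> \<Gamma>"
  by (simp add: transl_lattice_def)

lemma Lambda_closed: "0 \<in> \<Lambda>" "l \<in> \<Lambda> \<Longrightarrow> k \<in> \<Lambda> \<Longrightarrow> l + k \<in> \<Lambda>" "l \<in> \<Lambda> \<Longrightarrow> - l \<in> \<Lambda>"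
proof -
  show "0 \<in> \<Lambda>" using id_in by (simp add: transl_in transl_0)
  show "l + k \<in> \<Lambda>" if "l \<in> \<Lambda>" "k \<in> \<Lambda>"
    using comp_in[of "transl l" "transl k"] that by (simp add: transl_in transl_comp)
  show "- l \<in> \<Lambda>" if "l \<in> \<Lambda>"
  proof -
    have l: "transl l \<in> \<Gamma>" using that by (simp add: transl_in)
    have "transl l 0 = l" "transl (- l) 0 = - l" by (simp_all add: transl_def)
    then have "inv_into UNIV (transl l) = transl (- l)"
      using rot_inv[OF l] inv_apply_0[OF l]
      by (intro isom_eqI[OF in_isom[OF inv_in[OF l]] transl_in_isom]) simp_all
    then show ?thesis using inv_in[OF l] by (simp add: transl_in)
  qed
qed

lemma eps_spin: "\<gamma> \<in> \<Gamma> \<Longrightarrow> \<epsilon> \<gamma> \<in> spin"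
  using eps by (auto simp: spin_structure_def hom_def spin_group_def)

lemma eps_comp: "\<gamma> \<in> \<Gamma> \<Longrightarrow> \<delta> \<in> \<Gamma> \<Longrightarrow> \<epsilon> (\<gamma> \<circ> \<delta>) = \<epsilon> \<gamma> * \<epsilon> \<delta>"
  using eps by (auto simp: spin_structure_def hom_def spin_group_def isom_def)

lemma mu_eps: "\<gamma> \<in> \<Gamma> \<Longrightarrow> mu (\<epsilon> \<gamma>) = rot \<gamma>"
  using eps by (auto simp: spin_structure_def)

lemma rho_comp: "\<gamma> \<in> \<Gamma> \<Longrightarrow> \<delta> \<in> \<Gamma> \<Longrightarrow> \<rho> (\<gamma> \<circ> \<delta>) = \<rho> \<gamma> ** \<rho> \<delta>"
  using rho(1) by (auto simp: hom_def unitary_group_def isom_def)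

lemma eps_cvec: "\<gamma> \<in> \<Gamma> \<Longrightarrow> \<epsilon> \<gamma> * cvec u = cvec (rot \<gamma> *v u) * \<epsilon> \<gamma>"
  using mu_spin[OF eps_spin, of \<gamma> u] spin_inverse[OF eps_spin, of \<gamma>]
  by (simp add: mu_eps mult.assoc)

lemma eps_fix_iff: "\<gamma> \<in> \<Gamma> \<Longrightarrow> \<epsilon> \<gamma> * cvec u = cvec u * \<epsilon> \<gamma> \<longleftrightarrow> rot \<gamma> *v u = u"
  using mu_fixes_iff[OF eps_spin] mu_eps by metis

lemma delta_pm:
  assumes "l \<in> \<Lambda>"
  shows "delta \<epsilon> l = 1 \<or> delta \<epsilon> l = - 1" "\<epsilon> (transl l) = of_real (delta \<epsilon> l)"
proof -
  have t: "transl l \<in> \<Gamma>" using assms by (simp add: transl_in)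
  have "\<epsilon> (transl l) = 1 \<or> \<epsilon> (transl l) = - 1"
    by (rule mu_eq_1[OF eps_spin[OF t]]) (simp add: mu_eps[OF t])
  then have "\<epsilon> (transl l) = of_real 1 \<or> \<epsilon> (transl l) = of_real (- 1)" by simp
  then obtain c :: real where c: "c = 1 \<or> c = - 1" "\<epsilon> (transl l) = of_real c" by blast
  have "delta \<epsilon> l = c" unfolding delta_def c(2) by (rule the_equality) simp_all
  then show "delta \<epsilon> l = 1 \<or> delta \<epsilon> l = - 1" "\<epsilon> (transl l) = of_real (delta \<epsilon> l)" using c by auto
qed

lemma delta_sq: "l \<in> \<Lambda> \<Longrightarrow> delta \<epsilon> l * delta \<epsilon> l = 1"
  using delta_pm(1)[of l] by auto

text \<open>Conjugation by \<gamma> turns the translation by l into the one by Bl, and its image 1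
  or -1 under \<epsilon> is central. Hence holonomy permutes the shifted dual lattice.\<close>

lemma delta_rot: "\<gamma> \<in> \<Gamma> \<Longrightarrow> l \<in> \<Lambda> \<Longrightarrow> delta \<epsilon> (rot \<gamma> *v l) = delta \<epsilon> l"
proof -
  assume g: "\<gamma> \<in> \<Gamma>" and l: "l \<in> \<Lambda>"
  have rl: "rot \<gamma> *v l \<in> \<Lambda>" by (rule rot_lattice[OF g l])
  have "\<epsilon> (\<gamma> \<circ> transl l) = \<epsilon> (transl (rot \<gamma> *v l) \<circ> \<gamma>)" by (simp only: comp_transl[OF in_isom[OF g]])
  then have "\<epsilon> \<gamma> * of_real (delta \<epsilon> l) = of_real (delta \<epsilon> (rot \<gamma> *v l)) * \<epsilon> \<gamma>"
    using g l rl by (simp add: eps_comp flip: transl_in delta_pm(2))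
  then have "of_real (delta \<epsilon> l) * (\<epsilon> \<gamma> * cinv (\<epsilon> \<gamma>)) = of_real (delta \<epsilon> (rot \<gamma> *v l)) * (\<epsilon> \<gamma> * cinv (\<epsilon> \<gamma>))"
    by (simp only: mult.assoc[symmetric] of_real_def mult_scaleR_right mult_scaleR_left mult_1_left mult_1_right)
  then show ?thesis by (simp only: spin_inverse[OF eps_spin[OF g]] mult_1_right of_real_eq_iff)
qed

definition kap :: "'n isometry \<Rightarrow> complex ^ ('s \<times> 'v) ^ ('s \<times> 'v)" where
  "kap \<gamma> = kron (L (\<epsilon> \<gamma>)) (\<rho> \<gamma>)"

definition M :: "'n rvec \<Rightarrow> complex ^ ('s \<times> 'v) ^ ('s \<times> 'v)" where
  "M u = kron (L (cvec u)) (mat 1)"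

lemma kap_comp: "\<gamma> \<in> \<Gamma> \<Longrightarrow> \<delta> \<in> \<Gamma> \<Longrightarrow> kap (\<gamma> \<circ> \<delta>) = kap \<gamma> ** kap \<delta>"
  by (simp add: kap_def eps_comp rho_comp kron_mult L_mult_all)

lemma kap_transl: "l \<in> \<Lambda> \<Longrightarrow> kap (transl l) = smat (of_real (delta \<epsilon> l)) (mat 1)"
  using rho(2) by (simp add: kap_def delta_pm(2) of_real_def L_scale_all L_one scaleR_eq_smat kron_smat_left kron_one)

text \<open>Equivariance of Clifford multiplication; \<rho>(\<gamma>) acts on the other tensor
  factor and commutes with it.\<close>

lemma kap_M: "\<gamma> \<in> \<Gamma> \<Longrightarrow> kap \<gamma> ** M u = M (rot \<gamma> *v u) ** kap \<gamma>"
  by (simp add: kap_def M_def kron_mult eps_cvec flip: L_mult_all)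

lemma M_linear: "M u *v w = (\<Sum>j\<in>UNIV. of_real (u $ j) *s (M (axis j 1) *v w))"
proof -
  have "L (cvec u) = (\<Sum>j\<in>UNIV. L (u $ j *\<^sub>R cbasis {j}))"
    unfolding cvec_def by (rule L_sum[THEN conjunct1]) (simp add: cl_top)
  also have "\<dots> = (\<Sum>j\<in>UNIV. smat (of_real (u $ j)) (L (cvec (axis j 1))))"
    by (simp add: L_scale_all scaleR_eq_smat)
  finally have Lu: "L (cvec u) = \<dots>" .
  have "kron (\<Sum>j\<in>J. smat (of_real (u $ j)) (L (cvec (axis j 1)))) (mat 1) *v w
      = (\<Sum>j\<in>J. of_real (u $ j) *s (M (axis j 1) *v w))" for J
  proof (induction J rule: infinite_finite_induct)
    case (insert j J)
    then show ?case
      by (simp add: kron_add_left matrix_vector_mult_add_rdistrib M_def kron_smat_left smat_vector del: cvec_axis)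
  qed (simp_all add: kron_def matrix_vector_mult_def vec_eq_iff)
  then show ?thesis unfolding M_def[of u] Lu .
qed

lemma M_sq: "M u *v (M u *v w) = (- of_real (u \<bullet> u)) *s w"
proof -
  have "M u ** M u = kron (L (cvec u * cvec u)) (mat 1)"
    by (simp add: M_def kron_mult L_mult_all)
  also have "\<dots> = smat (- of_real (u \<bullet> u)) (mat 1)"
    by (simp only: cvec_sq L_scale_all L_one scaleR_eq_smat kron_smat_left kron_one dot_square_norm of_real_minus)
  finally show ?thesis by (simp add: matrix_vector_mul_assoc smat_vector)
qed

lemma dirac_eq: "dirac L f x = (\<Sum>j\<in>UNIV. M (axis j 1) *v frechet_derivative f (at x) (axis j 1))"
proof -
  have "bij_betw (\<lambda>j. sorted_list_of_set UNIV ! (j - 1)) {1..CARD('n)} (UNIV :: 'n set)"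
  proof (rule bij_betw_imageI)
    show im: "(\<lambda>j. sorted_list_of_set UNIV ! (j - 1)) ` {1..CARD('n)} = (UNIV :: 'n set)"
      using front_eq_image[of "CARD('n)", where 'n = 'n] front_top[where 'n = 'n] by simp
    show "inj_on (\<lambda>j. sorted_list_of_set (UNIV :: 'n set) ! (j - 1)) {1..CARD('n)}"
      by (rule eq_card_imp_inj_on) (simp_all only: finite_atLeastAtMost im card_atLeastAtMost)
  qed
  from sum.reindex_bij_betw[OF this, of "\<lambda>j. M (axis j 1) *v frechet_derivative f (at x) (axis j 1)"]
  show ?thesis by (simp add: dirac_def M_def eb_def)
qed

text \<open>Twice a basis of \<open>\<Lambda> \<otimes> \<real>\<close> in \<open>\<Lambda>\<close> spans a lattice on which \<open>\<delta>\<close> is trivial.\<close>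
lemma obtain_dual_bases:
  obtains lam w l where "dual_bases lam w" "\<And>i. l i \<in> \<Lambda>" "\<And>i. lam i = l i + l i"
proof -
  obtain Bs where Bs: "Bs \<subseteq> \<Lambda>" "independent Bs" "\<Lambda> \<subseteq> span Bs"
    using maximal_independent_subset by blast
  have span: "span Bs = UNIV"
    using Bs span_transl_lattice[OF disc coc] by (metis span_mono span_span top.extremum_unique)
  have fin: "finite Bs" by (rule independent_imp_finite[OF Bs(2)])
  have "card Bs = DIM('n rvec)" using Bs(2) span by (metis dim_UNIV dim_eq_card_independent dim_span)
  then have "card (UNIV :: 'n set) = card Bs" by simp
  then obtain l where l: "bij_betw l (UNIV :: 'n set) Bs"
    using fin by (metis finite finite_same_card_bij)
  define lam where "lam i = l i + l i" for i
  \<comment> \<open>The columns of A are the lam_i; the rows of its inverse then form the dual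
    basis.\<close>
  define A where "A = (\<chi> i j. lam j $ i)"
  have col: "column j A = lam j" for j by (simp add: A_def column_def vec_eq_iff)
  have "span (columns A) = UNIV"
  proof -
    have "l j \<in> span (columns A)" for j
    proof -
      have "lam j \<in> span (columns A)" by (rule span_base) (auto simp: columns_def col[symmetric])
      then have "(1/2) *\<^sub>R lam j \<in> span (columns A)" by (rule span_scale)
      then show ?thesis by (simp add: lam_def scaleR_2[symmetric])
    qed
    then have "Bs \<subseteq> span (columns A)" using l by (auto simp: bij_betw_def)
    then have "span Bs \<subseteq> span (columns A)" by (simp add: span_minimal)
    then show ?thesis using span by auto
  qed
  then have "\<exists>W. A ** W = mat 1" by (simp only: matrix_right_invertible_span_columns span_vec_eq)
  then obtain W where W: "A ** W = mat 1" by blast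
  then have W': "W ** A = mat 1" by (simp only: matrix_left_right_inverse)
  define w where "w i = row i W" for i
  have wx: "w i \<bullet> x = (W *v x) $ i" for i x
    by (simp add: w_def row_def matrix_vector_mult_def inner_vec_def)
  have "dual_bases lam w"
  proof
    fix i j
    have "w i \<bullet> lam j = (W ** A) $ i $ j"
      by (simp add: wx matrix_matrix_mult_def matrix_vector_mult_def A_def)
    then show "w i \<bullet> lam j = (if i = j then 1 else 0)" by (simp add: W' mat_def)
  next
    fix x
    have "x = A *v (W *v x)" by (simp add: matrix_vector_mul_assoc W)
    also have "\<dots> = (\<Sum>i\<in>UNIV. (w i \<bullet> x) *\<^sub>R lam i)"
    proof (rule vec_eq_iff[THEN iffD2], rule allI)
      have e: "(A *v y) $ j = (\<Sum>i\<in>UNIV. A $ j $ i * y $ i)" for y j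
        by (simp add: matrix_vector_mult_def)
      show "(A *v (W *v x)) $ j = (\<Sum>i\<in>UNIV. (w i \<bullet> x) *\<^sub>R lam i) $ j" for j
        unfolding wx e by (simp add: A_def mult.commute)
    qed
    finally show "x = (\<Sum>i\<in>UNIV. (w i \<bullet> x) *\<^sub>R lam i)" .
  qed
  moreover have "l i \<in> \<Lambda>" for i using l Bs(1) by (auto simp: bij_betw_def)
  ultimately show thesis using that lam_def by blast
qed

end

section \<open>Eigenspinors and their Fourier coefficients\<close>

lemma cfun_scale_apply [simp]: "cfun_scale z f x = z *s f x"
  by (simp add: cfun_scale_def)

definition synth :: "('a::real_inner) set \<Rightarrow> ('a \<Rightarrow> complex ^ 'k) \<Rightarrow> 'a \<Rightarrow> complex ^ 'k" where
  "synth U c x = (\<Sum>u\<in>U. expi u x *s c u)"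

lemma synth_derivative:
  "(synth U c has_derivative (\<lambda>v. synth U (\<lambda>u. (2 * of_real pi * \<i> * of_real (u \<bullet> v)) *s c u) x)) (at x)"
proof -
  have "(synth U c has_derivative (\<lambda>v. \<Sum>u\<in>U. (2 * of_real pi * \<i> * of_real (u \<bullet> v) * expi u x) *s c u)) (at x)"
    unfolding synth_def[abs_def]
    by (rule has_derivative_sum)
      (rule bounded_linear.has_derivative[OF bounded_bilinear.bounded_linear_left[OF bounded_bilinear_smult] expi_derivative])
  then show ?thesis by (simp add: synth_def vector_smult_assoc mult_ac)
qed

lemma synth_frechet: "frechet_derivative (synth U c) (at x) v
    = synth U (\<lambda>u. (2 * of_real pi * \<i> * of_real (u \<bullet> v)) *s c u) x"
  by (simp only: frechet_derivative_at[OF synth_derivative, symmetric])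

text \<open>A directional derivative of a finite Fourier sum is again one, with other coefficients;
  hence the induction is over all coefficient families at once.\<close>

lemma synth_smooth: "smooth (synth U c)"
proof -
  have "Ck k (synth U c)" for k
  proof (induction k arbitrary: c)
    case 0
    show ?case unfolding Ck.simps synth_def by (intro continuous_intros)
  next
    case (Suc k)
    have "synth U c differentiable_on UNIV"
      unfolding differentiable_on_def differentiable_def using synth_derivative by blast
    then show ?case unfolding Ck.simps synth_frechet using Suc by simp
  qed
  then show ?thesis by (simp add: smooth_def)
qed

lemma synth_add: "synth U (\<lambda>u. c u + d u) x = synth U c x + synth U d x"
  by (simp add: synth_def vec.scale_right_distrib sum.distrib)

lemma synth_scale: "synth U (\<lambda>u. z *s c u) x = z *s synth U c x"
  by (simp add: synth_def vec.scale_sum_right vector_smult_assoc mult.commute)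

lemma matrix_synth: "A *v synth U c x = synth U (\<lambda>u. A *v c u) x"
proof -
  have "A *v (\<Sum>u\<in>V. expi u x *s c u) = (\<Sum>u\<in>V. expi u x *s (A *v c u))" for V
    by (induction V rule: infinite_finite_induct) (simp_all add: matrix_vector_right_distrib vector_scalar_commute)
  then show ?thesis by (simp add: synth_def)
qed

context flat_spin_bundle
begin

abbreviation "U m \<equiv> dual_set \<Gamma> \<epsilon> m"

lemma dual_set_iff: "u \<in> U m \<longleftrightarrow> norm u = m \<and> (\<forall>l\<in>\<Lambda>. expi u l = of_real (delta \<epsilon> l))"
proof -
  have "exp (2 * of_real pi * \<i> * of_real (u \<bullet> l)) = expi u l" for l
    by (simp add: expi_def cis_conv_exp mult_ac)
  then show ?thesis by (auto simp: dual_set_def)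
qed

lemma inner_rot: "\<gamma> \<in> \<Gamma> \<Longrightarrow> (rot \<gamma> *v u) \<bullet> v = u \<bullet> (transpose (rot \<gamma>) *v v)"
  using dot_lmul_matrix[of v "rot \<gamma>" u] by (simp add: transpose_matrix_vector inner_commute)

lemma rot_dual_set: "\<gamma> \<in> \<Gamma> \<Longrightarrow> u \<in> U m \<Longrightarrow> rot \<gamma> *v u \<in> U m"
proof -
  assume g: "\<gamma> \<in> \<Gamma>" and u: "u \<in> U m"
  have "expi (rot \<gamma> *v u) l = of_real (delta \<epsilon> l)" if l: "l \<in> \<Lambda>" for l
  proof -
    let ?k = "transpose (rot \<gamma>) *v l"
    have k: "?k \<in> \<Lambda>" using rot_lattice[OF inv_in[OF g] l] by (simp add: rot_inv[OF g])
    have "expi (rot \<gamma> *v u) l = expi u ?k" by (simp add: expi_def inner_rot[OF g])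
    also have "\<dots> = of_real (delta \<epsilon> ?k)" using u k by (simp add: dual_set_iff)
    also have "delta \<epsilon> ?k = delta \<epsilon> l" using delta_rot[OF g k] orthogonal_rot[OF g] by simp
    finally show ?thesis .
  qed
  then show ?thesis using u by (simp add: dual_set_iff orthogonal_matrix_norm[OF orthogonal_rot[OF g]])
qed

lemma transpose_dual_set: "\<gamma> \<in> \<Gamma> \<Longrightarrow> u \<in> U m \<Longrightarrow> transpose (rot \<gamma>) *v u \<in> U m"
  using rot_dual_set[OF inv_in, of \<gamma> u m] by (simp add: rot_inv)

lemma rot_dual_set_bij: "\<gamma> \<in> \<Gamma> \<Longrightarrow> bij_betw ((*v) (rot \<gamma>)) (U m) (U m)"
  by (rule bij_betwI[where g = "(*v) (transpose (rot \<gamma>))"])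
    (auto simp: rot_dual_set transpose_dual_set orthogonal_rot)

text \<open>For f = \<open>synth (U m) c\<close> these are the Fourier coefficients of kap(\<gamma>)
  f(\<gamma>^(-1) x), so the families fixed by all \<gamma> are those of equivariant spinors. The
  value 0 outside \<open>U m\<close> keeps the families finitely supported.\<close>

definition K :: "real \<Rightarrow> 'n isometry \<Rightarrow> ('n rvec \<Rightarrow> complex ^ ('s \<times> 'v)) \<Rightarrow> 'n rvec \<Rightarrow> complex ^ ('s \<times> 'v)" where
  "K m \<gamma> c u = (if u \<in> U m then expi (- u) (\<gamma> 0) *s (kap \<gamma> *v c (transpose (rot \<gamma>) *v u)) else 0)"

text \<open>The failure of equivariance is itself one Fourier sum over \<open>U m\<close>, so it
  vanishes exactly when its coefficients do.\<close>

lemma synth_equivariant_iff: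
  assumes g: "\<gamma> \<in> \<Gamma>"
  shows "synth (U m) c (\<gamma> x) - kap \<gamma> *v synth (U m) c x
    = synth (U m) (\<lambda>v. expi (rot \<gamma> *v v) (\<gamma> 0) *s c (rot \<gamma> *v v) - kap \<gamma> *v c v) x"
proof -
  have "synth (U m) c (\<gamma> x) = (\<Sum>u\<in>U m. expi u (\<gamma> x) *s c u)" by (simp add: synth_def)
  also have "\<dots> = (\<Sum>v\<in>U m. expi (rot \<gamma> *v v) (\<gamma> x) *s c (rot \<gamma> *v v))"
    by (rule sum.reindex_bij_betw[OF rot_dual_set_bij[OF g], symmetric])
  also have "\<dots> = (\<Sum>v\<in>U m. expi v x *s (expi (rot \<gamma> *v v) (\<gamma> 0) *s c (rot \<gamma> *v v)))"
  proof (intro sum.cong refl)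
    fix v
    have "\<gamma> x = rot \<gamma> *v x + \<gamma> 0" by (rule isom_apply(2)[OF in_isom[OF g]])
    then have "expi (rot \<gamma> *v v) (\<gamma> x) = expi (rot \<gamma> *v v) (rot \<gamma> *v x + \<gamma> 0)" by simp
    also have "\<dots> = expi v x * expi (rot \<gamma> *v v) (\<gamma> 0)"
      unfolding expi_add using orthogonal_rot[OF g] by (simp add: expi_def inner_rot[OF g])
    finally show "expi (rot \<gamma> *v v) (\<gamma> x) *s c (rot \<gamma> *v v)
        = expi v x *s (expi (rot \<gamma> *v v) (\<gamma> 0) *s c (rot \<gamma> *v v))"
      by (simp add: vector_smult_assoc)
  qed
  finally show ?thesis
    unfolding matrix_synth by (simp add: synth_def vec.scale_right_diff_distrib sum_subtractf)
qed

definition coeff_space :: "real \<Rightarrow> real \<Rightarrow> ('n rvec \<Rightarrow> complex ^ ('s \<times> 'v)) set" where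
  "coeff_space m r = {c. (\<forall>u. u \<notin> U m \<longrightarrow> c u = 0) \<and>
     (\<forall>u\<in>U m. (2 * of_real pi * \<i>) *s (M u *v c u) = of_real r *s c u) \<and> (\<forall>\<gamma>\<in>\<Gamma>. K m \<gamma> c = c)}"

lemma synth_in_eigenspace:
  assumes c: "c \<in> coeff_space m r"
  shows "synth (U m) c \<in> eigenspace \<Gamma> \<epsilon> \<rho> L r"
proof -
  have "synth (U m) c (\<gamma> x) = kap \<gamma> *v synth (U m) c x" if g: "\<gamma> \<in> \<Gamma>" for \<gamma> x
  proof -
    have "expi (rot \<gamma> *v v) (\<gamma> 0) *s c (rot \<gamma> *v v) - kap \<gamma> *v c v = 0" if v: "v \<in> U m" for v
    proof -
      have "c (rot \<gamma> *v v) = K m \<gamma> c (rot \<gamma> *v v)" using c g by (simp add: coeff_space_def)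
      then have "c (rot \<gamma> *v v) = expi (- (rot \<gamma> *v v)) (\<gamma> 0) *s (kap \<gamma> *v c v)"
        using rot_dual_set[OF g v] orthogonal_rot[OF g] by (simp add: K_def)
      then show ?thesis by (simp add: vector_smult_assoc)
    qed
    then show ?thesis using synth_equivariant_iff[OF g, of m c x] by (simp add: synth_def)
  qed
  moreover have "dirac L (synth (U m) c) x = of_real r *s synth (U m) c x" for x
  proof -
    have "dirac L (synth (U m) c) x
        = (\<Sum>j\<in>UNIV. \<Sum>u\<in>U m. expi u x *s (M (axis j 1) *v ((2 * of_real pi * \<i> * of_real (u \<bullet> axis j 1)) *s c u)))"
      by (simp only: dirac_eq synth_frechet matrix_synth) (simp only: synth_def)
    also have "\<dots> = (\<Sum>u\<in>U m. \<Sum>j\<in>UNIV. expi u x *s (M (axis j 1) *v ((2 * of_real pi * \<i> * of_real (u \<bullet> axis j 1)) *s c u)))"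
      by (rule sum.swap)
    also have "\<dots> = (\<Sum>u\<in>U m. expi u x *s ((2 * of_real pi * \<i>) *s (M u *v c u)))"
    proof (intro sum.cong refl)
      fix u
      have "(\<Sum>j\<in>UNIV. expi u x *s (M (axis j 1) *v ((2 * of_real pi * \<i> * of_real (u \<bullet> axis j 1)) *s c u)))
          = (\<Sum>j\<in>UNIV. expi u x *s ((2 * of_real pi * \<i>) *s (of_real (u $ j) *s (M (axis j 1) *v c u))))"
        by (simp add: vector_scalar_commute inner_axis vector_smult_assoc)
      then show "(\<Sum>j\<in>UNIV. expi u x *s (M (axis j 1) *v ((2 * of_real pi * \<i> * of_real (u \<bullet> axis j 1)) *s c u)))
          = expi u x *s ((2 * of_real pi * \<i>) *s (M u *v c u))"
        by (simp only: vec.scale_sum_right[symmetric] M_linear[symmetric])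
    qed
    also have "\<dots> = (\<Sum>u\<in>U m. expi u x *s (of_real r *s c u))"
      using c by (intro sum.cong refl) (simp add: coeff_space_def)
    also have "\<dots> = of_real r *s synth (U m) c x"
      unfolding synth_scale[symmetric] by (simp add: synth_def)
    finally show ?thesis .
  qed
  ultimately show ?thesis
    by (simp add: eigenspace_def spinor_fields_def synth_smooth kap_def)
qed

text \<open>On the doubled vectors lam_i the sign \<delta> is a square, hence 1. So the twisted set
  \<open>U m\<close> lies in an ordinary dual lattice, where finiteness and uniqueness of
  coefficients are known.\<close>

lemma dual_set_subset:
  assumes "dual_bases lam w" "\<And>i. l i \<in> \<Lambda>" "\<And>i. lam i = l i + l i"
  shows "U m \<subseteq> {u \<in> dual_bases.dual_lattice lam. norm u = m}"
proof -
  interpret dual_bases lam w by fact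
  show ?thesis
  proof
    fix u assume u: "u \<in> U m"
    have "expi u (lam i) = 1" for i
    proof -
      have "expi u (lam i) = expi u (l i) * expi u (l i)" by (simp only: assms(3) expi_add)
      also have "\<dots> = of_real (delta \<epsilon> (l i) * delta \<epsilon> (l i))"
        using u assms(2) by (simp add: dual_set_iff)
      finally show ?thesis by (simp add: delta_sq[OF assms(2)])
    qed
    then show "u \<in> {u \<in> dual_lattice. norm u = m}"
      using u by (simp add: dual_lattice_def expi_eq_1_iff dual_set_iff)
  qed
qed

lemma finite_dual_set: "finite (U m)"
proof -
  obtain lam w l where b: "dual_bases lam w" "\<And>i. l i \<in> \<Lambda>" "\<And>i. lam i = l i + l i"
    using obtain_dual_bases by blast
  interpret dual_bases lam w by fact
  show ?thesis using dual_set_subset[OF b] finite_dual_sphere finite_subset by blast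
qed

lemma synth_injective:
  assumes "\<And>x. synth (U m) c x = 0" "u \<in> U m"
  shows "c u = 0"
proof -
  obtain lam w l where b: "dual_bases lam w" "\<And>i. l i \<in> \<Lambda>" "\<And>i. lam i = l i + l i"
    using obtain_dual_bases by blast
  interpret dual_bases lam w by fact
  show ?thesis
    by (rule expi_independent[where U = "U m" and c = c and v = u])
      (use dual_set_subset[OF b] finite_dual_set assms in \<open>auto simp: synth_def\<close>)
qed

lemma eigenspace_eq_synth:
  assumes m: "\<bar>r\<bar> = 2 * pi * m"
  shows "eigenspace \<Gamma> \<epsilon> \<rho> L r = synth (U m) ` coeff_space m r"
proof
  show "synth (U m) ` coeff_space m r \<subseteq> eigenspace \<Gamma> \<epsilon> \<rho> L r"
    using synth_in_eigenspace by blast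
  show "eigenspace \<Gamma> \<epsilon> \<rho> L r \<subseteq> synth (U m) ` coeff_space m r"
  proof
    fix f assume f: "f \<in> eigenspace \<Gamma> \<epsilon> \<rho> L r"
    have equi: "f (\<gamma> x) = kap \<gamma> *v f x" if "\<gamma> \<in> \<Gamma>" for \<gamma> x
      using f that by (simp add: eigenspace_def spinor_fields_def kap_def)
    have "Ck 1 f" using f by (simp add: eigenspace_def spinor_fields_def smooth_def)
    then have diff: "\<And>x. f differentiable (at x)" and C1: "\<And>v. continuous_on UNIV (\<lambda>x. frechet_derivative f (at x) v)"
      by (simp_all add: differentiable_on_def)
    obtain lam w l where b: "dual_bases lam w" "\<And>i. l i \<in> \<Lambda>" "\<And>i. lam i = l i + l i"
      using obtain_dual_bases by blast
    interpret dual_bases lam w by fact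
    have ft: "f (x + k) = of_real (delta \<epsilon> k) *s f x" if "k \<in> \<Lambda>" for x k
      using equi[of "transl k" x] that by (simp add: kap_transl smat_vector transl_in[symmetric]) (simp add: transl_def)
    have "periodic f"
      unfolding periodic_def
    proof (intro allI)
      fix i x
      have "f (x + lam i) = f (x + l i + l i)" by (simp only: b(3) add.assoc)
      also have "\<dots> = of_real (delta \<epsilon> (l i) * delta \<epsilon> (l i)) *s f x"
        by (simp only: ft[OF b(2)] vector_smult_assoc of_real_mult)
      finally show "f (x + lam i) = f x" by (simp add: delta_sq[OF b(2)])
    qed
    define c where "c u = mean (\<lambda>x. expi (- u) x *s f x) 0" for u
    have "(\<Sum>j\<in>UNIV. M (axis j 1) *v frechet_derivative f (at x) (axis j 1)) = of_real r *s f x" for x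
      using f by (simp add: eigenspace_def dirac_eq)
    note E = eigenfunction_expansion[where M = M, OF diff C1 \<open>periodic f\<close> M_linear M_sq this, folded c_def]
    let ?S = "{u \<in> dual_lattice. norm u = m}"
    have "\<bar>r\<bar> / (2 * pi) = m" using m by simp
    then have fE: "f x = (\<Sum>u\<in>?S. expi u x *s c u)" for x using E(2)[of x] by simp
    have US: "U m \<subseteq> ?S" by (rule dual_set_subset[OF b])
    have finS: "finite ?S" by (rule finite_dual_sphere)
    have c0: "c u = 0" if u: "u \<in> ?S" "u \<notin> U m" for u
    proof -
      obtain k where k: "k \<in> \<Lambda>" "expi u k \<noteq> of_real (delta \<epsilon> k)" using u by (auto simp: dual_set_iff)
      \<comment> \<open>This is the Fourier sum of f(x + k) - \<delta>(k) f(x), which vanishes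
        because the full lattice \<Lambda> acts by \<delta>.\<close>
      have "(\<Sum>u\<in>?S. expi u x *s ((expi u k - of_real (delta \<epsilon> k)) *s c u)) = 0" for x
      proof -
        have "(\<Sum>u\<in>?S. expi u x *s ((expi u k - of_real (delta \<epsilon> k)) *s c u))
            = (\<Sum>u\<in>?S. expi u (x + k) *s c u - of_real (delta \<epsilon> k) *s (expi u x *s c u))"
          by (intro sum.cong refl) (simp add: expi_add vector_smult_assoc vector_sub_rdistrib vec.scale_right_diff_distrib algebra_simps)
        also have "\<dots> = f (x + k) - of_real (delta \<epsilon> k) *s f x"
          by (simp only: sum_subtractf vec.scale_sum_right[symmetric] fE)
        finally show ?thesis by (simp add: ft[OF k(1)])
      qed
      from expi_independent[where c = "\<lambda>u. (expi u k - of_real (delta \<epsilon> k)) *s c u", OF finS _ this u(1)]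
      have "(expi u k - of_real (delta \<epsilon> k)) *s c u = 0" by blast
      then show ?thesis using k(2) by simp
    qed
    \<comment> \<open>\<open>c\<close> is defined for all u, also outside the dual lattice, where
      nothing is known about it; \<open>coeff_space\<close> demands support in
      \<open>U m\<close>.\<close>
    define d where "d u = (if u \<in> U m then c u else 0)" for u
    have fd: "f = synth (U m) d"
    proof
      fix x
      have "f x = (\<Sum>u\<in>U m. expi u x *s c u)"
        unfolding fE by (rule sum.mono_neutral_right[OF finS US]) (use c0 in auto)
      then show "f x = synth (U m) d x" by (simp add: synth_def d_def)
    qed
    have "d \<in> coeff_space m r"
      unfolding coeff_space_def
    proof (intro CollectI conjI allI impI ballI)
      show "d u = 0" if "u \<notin> U m" for u using that by (simp add: d_def)
      show "(2 * of_real pi * \<i>) *s (M u *v d u) = of_real r *s d u" if "u \<in> U m" for u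
        using E(1)[of u] that US by (auto simp: d_def)
      fix \<gamma> assume g: "\<gamma> \<in> \<Gamma>"
      have "synth (U m) (\<lambda>v. expi (rot \<gamma> *v v) (\<gamma> 0) *s d (rot \<gamma> *v v) - kap \<gamma> *v d v) x = 0" for x
        using synth_equivariant_iff[OF g, of m d x] equi[OF g, of x] unfolding fd[symmetric] by simp
      note synth_injective[OF this]
      then have z: "expi (rot \<gamma> *v v) (\<gamma> 0) *s d (rot \<gamma> *v v) = kap \<gamma> *v d v" if "v \<in> U m" for v
        using that by (simp only: right_minus_eq)
      show "K m \<gamma> d = d"
      proof
        fix u
        show "K m \<gamma> d u = d u"
        proof (cases "u \<in> U m")
          case True
          let ?v = "transpose (rot \<gamma>) *v u"
          have "expi u (\<gamma> 0) *s d u = kap \<gamma> *v d ?v"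
            using z[OF transpose_dual_set[OF g True]] orthogonal_rot[OF g] by simp
          then have "K m \<gamma> d u = expi (- u) (\<gamma> 0) *s (expi u (\<gamma> 0) *s d u)" using True by (simp add: K_def)
          then show ?thesis by (simp add: vector_smult_assoc)
        qed (simp add: K_def d_def)
      qed
    qed
    then show "f \<in> synth (U m) ` coeff_space m r" using fd by blast
  qed
qed

end

section \<open>The standard basis of finitely supported families\<close>

lemma matrix_axis_nth: "((A :: complex ^ 'k ^ 'l) *v axis j 1) $ i = A $ i $ j"
  by (simp add: matrix_vector_mult_def axis_nth_if if_distrib cong: if_cong)

lemma fun_sum_apply: "(\<Sum>i\<in>A. f i) x = (\<Sum>i\<in>A. f i x)" for f :: "'i \<Rightarrow> 'a \<Rightarrow> 'b::comm_monoid_add"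
  by (induction A rule: infinite_finite_induct) simp_all

definition point_mass :: "'a \<Rightarrow> 'k \<Rightarrow> 'a \<Rightarrow> complex ^ 'k" where
  "point_mass u p = (\<lambda>x. if x = u then axis p 1 else 0)"

definition point_masses :: "'a set \<Rightarrow> ('a \<Rightarrow> complex ^ 'k) set" where
  "point_masses S = (\<lambda>(u, p). point_mass u p) ` (S \<times> UNIV)"

lemma point_mass_inj: "inj_on (\<lambda>(u, p). point_mass u p :: 'a \<Rightarrow> complex ^ 'k) A"
proof (rule inj_onI, clarify)
  fix u v p q assume e: "(point_mass u p :: 'a \<Rightarrow> complex ^ 'k) = point_mass v q"
  from fun_cong[OF e, of u] show "u = v \<and> p = q"
    by (auto simp: point_mass_def axis_eq_axis axis_eq_0_iff split: if_splits)
qed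

lemma sum_point_masses:
  assumes "finite S"
  shows "(\<Sum>b\<in>point_masses S. h b) = (\<Sum>u\<in>S. \<Sum>p\<in>UNIV. h (point_mass u p))"
  unfolding point_masses_def sum.reindex[OF point_mass_inj] sum.cartesian_product
  by (simp add: o_def case_prod_beta)

lemma finite_point_masses: "finite S \<Longrightarrow> finite (point_masses S :: ('a \<Rightarrow> complex ^ 'k) set)"
  by (simp add: point_masses_def)

lemma point_mass_sum_apply:
  assumes "finite S" "v \<in> S"
  shows "(\<Sum>b\<in>point_masses S. cfun_scale (k b) b) v $ q = k (point_mass v q :: 'a \<Rightarrow> complex ^ 'k)"
proof -
  have "(\<Sum>b\<in>point_masses S. cfun_scale (k b) b) v $ q
      = (\<Sum>u\<in>S. \<Sum>p\<in>UNIV. k (point_mass u p) * (if v = u then if q = p then 1 else 0 else 0))"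
    unfolding sum_point_masses[OF assms(1)] fun_sum_apply sum_component
    by (intro sum.cong refl) (auto simp: point_mass_def axis_nth_if)
  also have "\<dots> = (\<Sum>u\<in>S. if v = u then (\<Sum>p\<in>UNIV. if q = p then k (point_mass u p) else 0) else 0)"
    by (intro sum.cong refl) (auto simp: mult_delta_right)
  finally show ?thesis using assms by simp
qed

lemma independent_point_masses:
  assumes "finite S"
  shows "cfun.independent (point_masses S :: ('a \<Rightarrow> complex ^ 'k) set)"
proof (rule cfun.independent_if_scalars_zero[OF finite_point_masses[OF assms]])
  fix k :: "('a \<Rightarrow> complex ^ 'k) \<Rightarrow> complex" and b :: "'a \<Rightarrow> complex ^ 'k"
  assume z: "(\<Sum>x\<in>point_masses S. cfun_scale (k x) x) = 0" and "b \<in> point_masses S"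
  then obtain u p where "u \<in> S" "b = point_mass u p" by (auto simp: point_masses_def)
  then show "k b = 0" using point_mass_sum_apply[OF assms, of u k p] by (simp add: z)
qed

lemma span_point_masses:
  assumes "finite S"
  shows "cfun.span (point_masses S :: ('a \<Rightarrow> complex ^ 'k) set) = {c. \<forall>u. u \<notin> S \<longrightarrow> c u = 0}"
proof
  have "cfun.subspace {c :: 'a \<Rightarrow> complex ^ 'k. \<forall>u. u \<notin> S \<longrightarrow> c u = 0}"
    by (simp add: cfun.subspace_def)
  then show "cfun.span (point_masses S) \<subseteq> {c :: 'a \<Rightarrow> complex ^ 'k. \<forall>u. u \<notin> S \<longrightarrow> c u = 0}"
    by (intro cfun.span_minimal) (auto simp: point_masses_def point_mass_def)
next
  show "{c. \<forall>u. u \<notin> S \<longrightarrow> c u = 0} \<subseteq> cfun.span (point_masses S :: ('a \<Rightarrow> complex ^ 'k) set)"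
  proof
    fix c :: "'a \<Rightarrow> complex ^ 'k" assume c: "c \<in> {c. \<forall>u. u \<notin> S \<longrightarrow> c u = 0}"
    \<comment> \<open>Reads a coefficient off the label (u, p) of a basis vector; at most one term
      can be nonzero because point masses determine their labels.\<close>
    define k where "k b = (\<Sum>u\<in>S. \<Sum>p\<in>UNIV. if b = point_mass u p then c u $ p else 0)" for b :: "'a \<Rightarrow> complex ^ 'k"
    have k: "k (point_mass v q) = c v $ q" if "v \<in> S" for v q
    proof -
      have "(point_mass v q = (point_mass u p :: 'a \<Rightarrow> complex ^ 'k)) = (u = v \<and> p = q)" for u p
        using inj_onD[OF point_mass_inj[of UNIV], of "(v, q)" "(u, p)"] by auto
      then have "k (point_mass v q) = (\<Sum>u\<in>S. if u = v then (\<Sum>p\<in>UNIV. if p = q then c u $ p else 0) else 0)"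
        unfolding k_def by (intro sum.cong refl) simp
      then show ?thesis using that assms by simp
    qed
    let ?s = "\<Sum>b\<in>point_masses S. cfun_scale (k b) b"
    have "c u = ?s u" for u
    proof (cases "u \<in> S")
      case True
      then show ?thesis by (simp add: vec_eq_iff point_mass_sum_apply[OF assms] k)
    next
      case False
      have "?s u = 0" unfolding fun_sum_apply
        by (rule sum.neutral) (use False in \<open>auto simp: point_masses_def point_mass_def\<close>)
      then show ?thesis using c False by simp
    qed
    then have "c = ?s" by (rule ext)
    moreover have "?s \<in> cfun.span (point_masses S)"
      by (intro cfun.span_sum cfun.span_scale cfun.span_base)
    ultimately show "c \<in> cfun.span (point_masses S)" by simp
  qed
qed

lemma representation_point_masses:
  fixes c :: "'a \<Rightarrow> complex ^ 'k"
  assumes "finite S" "\<And>u. u \<notin> S \<Longrightarrow> c u = 0" "u \<in> S"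
  shows "cfun.representation (point_masses S) c (point_mass u p) = c u $ p"
proof -
  have "(\<Sum>b\<in>point_masses S. cfun_scale (cfun.representation (point_masses S) c b) b) = c"
    by (rule cfun.sum_representation_eq[OF independent_point_masses[OF assms(1)] _ finite_point_masses[OF assms(1)]])
      (use assms(2) in \<open>auto simp: span_point_masses[OF assms(1)]\<close>)
  then show ?thesis
    using point_mass_sum_apply[OF assms(1,3), of "cfun.representation (point_masses S) c" p] by simp
qed

section \<open>The holonomy action on coefficients and the trace of its average\<close>

context flat_spin_bundle
begin

lemma inner_transpose: "u \<bullet> (A *v v) = (transpose A *v u) \<bullet> (v :: 'n rvec)"
  by (simp add: transpose_matrix_vector dot_lmul_matrix)

lemma expi_rot: "expi (- u) (A *v v) = expi (- (transpose A *v u)) (v :: 'n rvec)"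
  by (simp only: expi_def inner_minus_left inner_transpose[of u])

lemma K_outside: "u \<notin> U m \<Longrightarrow> K m \<gamma> c u = 0"
  by (simp add: K_def)

lemma K_comp:
  assumes "\<gamma> \<in> \<Gamma>" "\<delta> \<in> \<Gamma>"
  shows "K m (\<gamma> \<circ> \<delta>) c = K m \<gamma> (K m \<delta> c)"
proof
  fix u
  show "K m (\<gamma> \<circ> \<delta>) c u = K m \<gamma> (K m \<delta> c) u"
  proof (cases "u \<in> U m")
    case True
    have "(\<gamma> \<circ> \<delta>) 0 = rot \<gamma> *v \<delta> 0 + \<gamma> 0"
      using isom_apply(2)[OF in_isom[OF assms(1)], of "\<delta> 0"] by simp
    then have "expi (- u) ((\<gamma> \<circ> \<delta>) 0) = expi (- u) (\<gamma> 0) * expi (- (transpose (rot \<gamma>) *v u)) (\<delta> 0)"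
      by (simp only: expi_add expi_rot mult.commute)
    moreover have "transpose (rot (\<gamma> \<circ> \<delta>)) *v u = transpose (rot \<delta>) *v (transpose (rot \<gamma>) *v u)"
      using assms by (simp add: rot_comp in_isom matrix_transpose_mul matrix_vector_mul_assoc del: comp_apply)
    ultimately show ?thesis
      using True transpose_dual_set[OF assms(1) True]
      by (simp add: K_def kap_comp[OF assms] vector_scalar_commute vector_smult_assoc matrix_vector_mul_assoc[symmetric] del: comp_apply)
  qed (simp add: K_outside)
qed

lemma same_rot:
  assumes "\<gamma> \<in> \<Gamma>" "\<gamma>' \<in> \<Gamma>" "rot \<gamma> = rot \<gamma>'"
  obtains l where "l \<in> \<Lambda>" "\<gamma>' = transl l \<circ> \<gamma>"
proof -
  let ?t = "\<gamma>' \<circ> inv_into UNIV \<gamma>"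
  have t: "?t \<in> \<Gamma>" by (intro comp_in inv_in assms)
  have "rot ?t = mat 1"
    using assms by (simp add: rot_comp in_isom inv_in rot_inv orthogonal_matrix_mul_transpose[OF orthogonal_rot] del: comp_apply)
  then have "?t = transl (?t 0)" by (rule isom_transl[OF in_isom[OF t]])
  then have "?t 0 \<in> \<Lambda>" "?t \<circ> \<gamma> = transl (?t 0) \<circ> \<gamma>" using t by (simp_all only: transl_in)
  moreover have "?t \<circ> \<gamma> = \<gamma>'" using inv_comp(1)[OF assms(1)] by (simp add: comp_assoc)
  ultimately show thesis using that by simp
qed

lemma expi_dual: "u \<in> U m \<Longrightarrow> l \<in> \<Lambda> \<Longrightarrow> expi (- u) l = of_real (delta \<epsilon> l)"
  unfolding expi_minus_left by (simp add: dual_set_iff)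

text \<open>A translation by l contributes \<delta>(l) twice, once from the phase at u in the
  shifted dual lattice and once from \<epsilon>. The square is 1, so the action depends on the
  rotational part alone and averaging over the finite F makes sense.\<close>

lemma K_cong_rot:
  assumes "\<gamma> \<in> \<Gamma>" "\<gamma>' \<in> \<Gamma>" "rot \<gamma> = rot \<gamma>'"
  shows "K m \<gamma>' c = K m \<gamma> c"
proof -
  obtain l where l: "l \<in> \<Lambda>" "\<gamma>' = transl l \<circ> \<gamma>" by (rule same_rot[OF assms])
  have t: "transl l \<in> \<Gamma>" using l(1) by (simp add: transl_in)
  have "K m (transl l) d u = d u" if "u \<notin> U m \<Longrightarrow> d u = 0" for d u
  proof (cases "u \<in> U m")
    case True
    have "transl l 0 = l" by (simp add: transl_def)
    then have "K m (transl l) d u = of_real (delta \<epsilon> l * delta \<epsilon> l) *s d u"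
      using True l(1) by (simp add: K_def expi_dual kap_transl smat_vector vector_smult_assoc)
    then show ?thesis by (simp add: delta_sq[OF l(1)])
  qed (use that in \<open>simp add: K_outside\<close>)
  then have "K m (transl l) (K m \<gamma> c) = K m \<gamma> c" by (intro ext) (simp add: K_outside)
  then show ?thesis unfolding l(2) K_comp[OF t assms(1)] .
qed

lemma holonomy_mult: "\<gamma> \<in> \<Gamma> \<Longrightarrow> B \<in> F \<Longrightarrow> rot \<gamma> ** B \<in> F"
  using comp_in by (auto simp: holonomy_def rot_comp[OF in_isom in_isom, symmetric])

lemma holonomy_mult_bij: "\<gamma> \<in> \<Gamma> \<Longrightarrow> bij_betw (\<lambda>B. rot \<gamma> ** B) F F"
proof (rule bij_betwI[where g = "\<lambda>B. transpose (rot \<gamma>) ** B"])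
  assume g: "\<gamma> \<in> \<Gamma>"
  show "(\<lambda>B. rot \<gamma> ** B) \<in> F \<rightarrow> F" using holonomy_mult[OF g] by blast
  show "(\<lambda>B. transpose (rot \<gamma>) ** B) \<in> F \<rightarrow> F"
    using holonomy_mult[OF inv_in[OF g]] by (simp add: rot_inv[OF g])
  show "transpose (rot \<gamma>) ** (rot \<gamma> ** B) = B" "rot \<gamma> ** (transpose (rot \<gamma>) ** B) = B" for B
    using orthogonal_matrix_mul_transpose[OF orthogonal_rot[OF g]] by (simp_all add: matrix_mul_assoc)
qed

lemma card_F: "card F > 0"
  using finite_F id_in by (auto simp: card_gt_0_iff holonomy_def)

lemma matrix_vector_sum: "A *v (\<Sum>i\<in>I. f i) = (\<Sum>i\<in>I. A *v f i)" for A :: "complex ^ 'k ^ 'l"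
  by (induction I rule: infinite_finite_induct) (simp_all add: matrix_vector_right_distrib)

text \<open>The multiplicity is the trace of the projection onto the invariant coefficient families:
  project fibrewise with \<open>Q\<close> and average over \<open>F\<close>.\<close>
lemma multiplicity_formula:
  assumes r: "\<bar>r\<bar> = 2 * pi * m"
    and Q: "\<And>u. u \<in> U m \<Longrightarrow> Q u ** Q u = Q u"
    and QM: "\<And>u w. u \<in> U m \<Longrightarrow> (2 * of_real pi * \<i>) *s (M u *v w) = of_real r *s w \<longleftrightarrow> Q u *v w = w"
    and Qk: "\<And>\<gamma> u. \<gamma> \<in> \<Gamma> \<Longrightarrow> u \<in> U m \<Longrightarrow> kap \<gamma> ** Q u = Q (rot \<gamma> *v u) ** kap \<gamma>"
    and g: "\<And>B. B \<in> F \<Longrightarrow> g B \<in> \<Gamma> \<and> rot (g B) = B"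
  obtains d where "eigenvalue_mult \<Gamma> \<epsilon> \<rho> L r d"
    "of_nat d = 1 / of_nat (card F) *
      (\<Sum>B\<in>F. \<Sum>u | u \<in> U m \<and> B *v u = u. expi (- u) (g B 0) * trace (kap (g B) ** Q u))"
proof -
  define E where "E c = (\<lambda>u. Q u *v c u)" for c
  define P where "P c = (\<lambda>u. (1 / of_nat (card F)) *s (\<Sum>B\<in>F. K m (g B) (E c) u))" for c
  define V where "V = coeff_space m r"
  define B0 where "B0 = (point_masses (U m) :: ('n rvec \<Rightarrow> complex ^ ('s \<times> 'v)) set)"
  have finU: "finite (U m)" by (rule finite_dual_set)
  note B0 = finite_point_masses[OF finU] independent_point_masses[OF finU] span_point_masses[OF finU]
  have N0: "complex_of_nat (card F) \<noteq> 0" using card_F by simp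
  have K_lin: "K m \<gamma> (c + d) u = K m \<gamma> c u + K m \<gamma> d u" "K m \<gamma> (cfun_scale z c) u = z *s K m \<gamma> c u" for \<gamma> c d u z
    by (simp_all add: K_def matrix_vector_right_distrib vec.scale_right_distrib vector_scalar_commute vector_smult_assoc mult.commute)
  have E_lin: "E (c + d) = E c + E d" "E (cfun_scale z c) = cfun_scale z (E c)" for c d z
    by (auto simp: E_def matrix_vector_right_distrib vector_scalar_commute fun_eq_iff)
  have P_lin: "Vector_Spaces.linear cfun_scale cfun_scale P"
  proof unfold_locales
    show "P (c + d) = P c + P d" for c d
      by (simp add: P_def E_lin K_lin sum.distrib vec.scale_right_distrib fun_eq_iff)
    show "P (cfun_scale z c) = cfun_scale z (P c)" for z c
      by (simp add: P_def E_lin K_lin fun_eq_iff vec.scale_sum_right vector_smult_assoc mult.commute)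
  qed
  have subV: "cfun.subspace V"
    unfolding cfun.subspace_def
  proof (intro conjI ballI allI)
    have "K m \<gamma> 0 = 0" for \<gamma> by (simp add: K_def fun_eq_iff)
    then show "0 \<in> V" by (simp add: V_def coeff_space_def)
    show "c + d \<in> V" if "c \<in> V" "d \<in> V" for c d
      using that by (simp add: V_def coeff_space_def matrix_vector_right_distrib vec.scale_right_distrib K_lin fun_eq_iff)
    show "cfun_scale z c \<in> V" if "c \<in> V" for z c
      using that by (simp add: V_def coeff_space_def vector_scalar_commute K_lin fun_eq_iff)
        (metis vector_smult_assoc mult.commute)
  qed
  \<comment> \<open>By equivariance of Q the action maps fibrewise projected families to such
    families, so the average stays in the required eigenspaces.\<close>
  have E_K: "Q u *v K m \<gamma> (E c) u = K m \<gamma> (E c) u" if u: "u \<in> U m" and \<gamma>: "\<gamma> \<in> \<Gamma>" for u \<gamma> c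
  proof -
    let ?v = "transpose (rot \<gamma>) *v u"
    have v: "?v \<in> U m" by (rule transpose_dual_set[OF \<gamma> u])
    have "Q u ** kap \<gamma> = kap \<gamma> ** Q ?v" using Qk[OF \<gamma> v] orthogonal_rot[OF \<gamma>] by simp
    then have "Q u *v (kap \<gamma> *v (Q ?v *v c ?v)) = kap \<gamma> *v ((Q ?v ** Q ?v) *v c ?v)"
      by (simp only: matrix_vector_mul_assoc matrix_mul_assoc)
    then show ?thesis using u by (simp add: K_def E_def vector_scalar_commute Q[OF v])
  qed
  have P_V: "P c \<in> V" for c
    unfolding V_def coeff_space_def
  proof (intro CollectI conjI allI impI ballI)
    show "P c u = 0" if "u \<notin> U m" for u using that by (simp add: P_def K_outside)
    show "(2 * of_real pi * \<i>) *s (M u *v P c u) = of_real r *s P c u" if u: "u \<in> U m" for u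
    proof (rule QM[OF u, THEN iffD2])
      show "Q u *v P c u = P c u"
        using E_K[OF u] g by (simp add: P_def vector_scalar_commute matrix_vector_sum)
    qed
    fix \<gamma> assume \<gamma>: "\<gamma> \<in> \<Gamma>"
    show "K m \<gamma> (P c) = P c"
    proof
      fix u
      have "K m \<gamma> (P c) u = (1 / of_nat (card F)) *s (\<Sum>B\<in>F. K m \<gamma> (K m (g B) (E c)) u)"
      proof (cases "u \<in> U m")
        case True
        then show ?thesis
          by (simp add: K_def[of m \<gamma>] P_def vector_scalar_commute matrix_vector_sum vec.scale_sum_right
              vector_smult_assoc mult.commute)
      qed (simp add: K_outside)
      also have "(\<Sum>B\<in>F. K m \<gamma> (K m (g B) (E c)) u) = (\<Sum>B\<in>F. K m (g (rot \<gamma> ** B)) (E c) u)"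
      proof (rule sum.cong[OF refl])
        fix B assume B: "B \<in> F"
        have gB: "g B \<in> \<Gamma>" "rot (g B) = B" "g (rot \<gamma> ** B) \<in> \<Gamma>" "rot (g (rot \<gamma> ** B)) = rot \<gamma> ** B"
          using g[OF B] g[OF holonomy_mult[OF \<gamma> B]] by auto
        have "K m (g (rot \<gamma> ** B)) (E c) = K m (\<gamma> \<circ> g B) (E c)"
          by (rule K_cong_rot[OF comp_in[OF \<gamma> gB(1)] gB(3)])
            (simp only: rot_comp[OF in_isom[OF \<gamma>] in_isom[OF gB(1)]] gB)
        then show "K m \<gamma> (K m (g B) (E c)) u = K m (g (rot \<gamma> ** B)) (E c) u"
          by (simp only: K_comp[OF \<gamma> gB(1)])
      qed
      also have "\<dots> = (\<Sum>B\<in>F. K m (g B) (E c) u)"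
        by (rule sum.reindex_bij_betw[OF holonomy_mult_bij[OF \<gamma>]])
      finally show "K m \<gamma> (P c) u = P c u" by (simp add: P_def)
    qed
  qed
  have P_id: "P c = c" if c: "c \<in> V" for c
  proof -
    have supp: "c u = 0" if "u \<notin> U m" for u using c that by (simp add: V_def coeff_space_def)
    have "E c u = c u" for u
    proof (cases "u \<in> U m")
      case True
      then show ?thesis using QM[OF True, of "c u"] c by (simp add: E_def V_def coeff_space_def)
    qed (simp add: E_def supp)
    then have "E c = c" by (rule ext)
    moreover have "K m (g B) c = c" if "B \<in> F" for B using c g[OF that] by (simp add: V_def coeff_space_def)
    ultimately have "P c u = (1 / of_nat (card F)) *s (\<Sum>B\<in>F. c u)" for u by (simp add: P_def)
    moreover have "(\<Sum>B\<in>F. c u) = of_nat (card F) *s c u" for u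
      by (simp only: vec_eq_iff sum_component) simp
    ultimately show ?thesis using N0 by (simp add: fun_eq_iff vector_smult_assoc)
  qed
  \<comment> \<open>A basis of the invariant families. It is finite because all of them are
    supported in the finite set \<open>U m\<close>.\<close>
  obtain A0 where A0: "A0 \<subseteq> V" "cfun.independent A0" "V \<subseteq> cfun.span A0"
    using cfun.maximal_independent_subset by blast
  have spanA0: "cfun.span A0 = V" using A0 subV by (simp add: cfun.span_subspace)
  have VB0: "V \<subseteq> cfun.span B0" unfolding B0_def B0(3) by (auto simp: V_def coeff_space_def)
  have finA0: "finite A0"
    using cfun.independent_span_bound[of B0 A0] A0(1,2) VB0 B0(1) by (auto simp: B0_def)
  have "of_nat (card A0) = (\<Sum>b\<in>B0. cfun.representation B0 (P b) b)"
    by (rule cfun.trace_projection_eq_card[symmetric, OF _ finA0 _ A0(2) P_lin])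
      (use B0 P_V P_id VB0 in \<open>auto simp: B0_def spanA0\<close>)
  also have "\<dots> = (\<Sum>u\<in>U m. \<Sum>p\<in>UNIV. P (point_mass u p) u $ p)"
    unfolding B0_def sum_point_masses[OF finU]
    by (intro sum.cong refl representation_point_masses finU) (auto simp: P_def K_outside)
  also have "\<dots> = (\<Sum>u\<in>U m. \<Sum>p\<in>UNIV. 1 / of_nat (card F) *
      (\<Sum>B\<in>F. if B *v u = u then expi (- u) (g B 0) * (kap (g B) ** Q u) $ p $ p else 0))"
  proof (intro sum.cong refl)
    fix u p assume u: "u \<in> U m"
    \<comment> \<open>The action carries a mass at u to Bu; on the diagonal only the u with Bu = u
      remain.\<close>
    have "K m (g B) (E (point_mass u p)) u $ p
        = (if B *v u = u then expi (- u) (g B 0) * (kap (g B) ** Q u) $ p $ p else 0)" if B: "B \<in> F" for B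
    proof -
      have oB: "orthogonal_matrix B" using orthogonal_rot g[OF B] by metis
      have "transpose B *v u = u \<longleftrightarrow> B *v u = u" using oB by (metis orthogonal_matrix_cancel)
      moreover have "((kap (g B) ** Q u) *v axis p 1) $ p = (kap (g B) ** Q u) $ p $ p"
        by (rule matrix_axis_nth)
      ultimately show ?thesis
        using u g[OF B] by (cases "B *v u = u") (simp_all add: K_def E_def point_mass_def matrix_vector_mul_assoc)
    qed
    then show "P (point_mass u p) u $ p = 1 / of_nat (card F) *
        (\<Sum>B\<in>F. if B *v u = u then expi (- u) (g B 0) * (kap (g B) ** Q u) $ p $ p else 0)"
      by (simp add: P_def)
  qed
  also have "\<dots> = 1 / of_nat (card F) * (\<Sum>u\<in>U m. \<Sum>p\<in>UNIV.
      (\<Sum>B\<in>F. if B *v u = u then expi (- u) (g B 0) * (kap (g B) ** Q u) $ p $ p else 0))"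
    by (simp only: sum_distrib_left)
  also have "(\<Sum>u\<in>U m. \<Sum>p\<in>UNIV. (\<Sum>B\<in>F. if B *v u = u then expi (- u) (g B 0) * (kap (g B) ** Q u) $ p $ p else 0))
      = (\<Sum>u\<in>U m. \<Sum>B\<in>F. if B *v u = u then expi (- u) (g B 0) * trace (kap (g B) ** Q u) else 0)"
    by (intro sum.cong refl, subst sum.swap) (auto simp: trace_def sum_distrib_left intro!: sum.cong)
  also have "\<dots> = (\<Sum>B\<in>F. \<Sum>u\<in>U m. if B *v u = u then expi (- u) (g B 0) * trace (kap (g B) ** Q u) else 0)"
    by (rule sum.swap)
  also have "\<dots> = (\<Sum>B\<in>F. \<Sum>u | u \<in> U m \<and> B *v u = u. expi (- u) (g B 0) * trace (kap (g B) ** Q u))"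
    using finU by (simp add: sum.inter_filter)
  finally have card: "of_nat (card A0) = 1 / of_nat (card F) *
      (\<Sum>B\<in>F. \<Sum>u | u \<in> U m \<and> B *v u = u. expi (- u) (g B 0) * trace (kap (g B) ** Q u))" .
  \<comment> \<open>Synthesis is linear and injective on the invariant families, hence carries their
    basis to a basis of the eigenspace.\<close>
  define S where "S = (synth (U m) :: ('n rvec \<Rightarrow> complex ^ ('s \<times> 'v)) \<Rightarrow> _)"
  interpret vector_space_pair "cfun_scale :: complex \<Rightarrow> ('n rvec \<Rightarrow> complex ^ ('s \<times> 'v)) \<Rightarrow> _"
    "cfun_scale :: complex \<Rightarrow> ('n rvec \<Rightarrow> complex ^ ('s \<times> 'v)) \<Rightarrow> _" by unfold_locales
  have S_lin: "Vector_Spaces.linear cfun_scale cfun_scale S"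
  proof unfold_locales
    show "S (c + d) = S c + S d" for c d
      using synth_add[of "U m" c d] by (simp add: S_def fun_eq_iff plus_fun_def)
    show "S (cfun_scale z c) = cfun_scale z (S c)" for z c
      using synth_scale[of "U m" z c] by (simp add: S_def fun_eq_iff cfun_scale_def)
  qed
  have S_inj: "inj_on S V"
  proof (rule inj_onI)
    fix c d assume cd: "c \<in> V" "d \<in> V" "S c = S d"
    then have "synth (U m) c x = synth (U m) d x" for x by (metis S_def)
    then have "synth (U m) (\<lambda>u. c u - d u) x = 0" for x
      by (simp add: synth_def vec.scale_right_diff_distrib sum_subtractf)
    from synth_injective[OF this] have "c u - d u = 0" if "u \<in> U m" for u using that .
    moreover have "c u = 0" "d u = 0" if "u \<notin> U m" for u using cd that by (simp_all add: V_def coeff_space_def)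
    ultimately have "c u = d u" for u by (cases "u \<in> U m") auto
    then show "c = d" by (rule ext)
  qed
  have "eigenvalue_mult \<Gamma> \<epsilon> \<rho> L r (card A0)"
    unfolding eigenvalue_mult_def
  proof (intro exI conjI)
    show "finite (S ` A0)" using finA0 by simp
    show "cfun.independent (S ` A0)"
      by (rule linear_independent_injective_image[OF S_lin A0(2)]) (use S_inj spanA0 in simp)
    show "cfun.span (S ` A0) = eigenspace \<Gamma> \<epsilon> \<rho> L r"
      unfolding linear_span_image[OF S_lin] spanA0 eigenspace_eq_synth[OF r] by (simp add: S_def V_def)
    show "card (S ` A0) = card A0"
      by (rule card_image) (use S_inj A0(1) in \<open>blast intro: inj_on_subset\<close>)
  qed
  then show thesis using card by (rule that)
qed

end

section \<open>Cosets and characters\<close>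

text \<open>Relates the top coordinate in the trace over S_n to the coordinate at e_1 ... e_(n-1),
  which separates the two half-spin characters of S_(n-1).\<close>

lemma coord_top_front:
  "coord (y * cvec (eb CARD('n))) UNIV = coord (y :: 'n::{finite,linorder} cliff) (front (CARD('n) - 1))"
proof -
  have sd: "sdiff {top_index :: 'n} UNIV = front (CARD('n) - 1)"
    using front_insert_top[where 'n = 'n] top_notin_front[where 'n = 'n] by (auto simp: sdiff_def)
  have "csgn (front (CARD('n) - 1)) {top_index :: 'n} = 1"
    unfolding csgn_def by (intro prod.neutral ballI) (use less_top[where 'n = 'n] in \<open>simp add: not_le\<close>)
  then show ?thesis by (simp add: eb_top coord_mult_cbasis sd)
qed

lemma torus_conj_facts:
  fixes \<epsilon> :: "'n::{finite,linorder} isometry \<Rightarrow> 'n cliff"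
  assumes "torus_conj \<epsilon> \<gamma> y" "\<epsilon> \<gamma> \<in> spin"
  shows "y \<in> spin" "y \<in> cl (CARD('n) - 1)" "parity True y" "coord y {} = coord (\<epsilon> \<gamma>) {}"
proof -
  obtain k where k: "k \<in> spin" "y = k * \<epsilon> \<gamma> * cinv k"
    using assms(1) by (auto simp: torus_conj_def conj_in_def)
  show "y \<in> spin" unfolding k(2) by (intro spin_mult spin_inverse k assms)
  then show "parity True y" by (rule parity_spin)
  show "coord y {} = coord (\<epsilon> \<gamma>) {}" unfolding k(2) by (rule coord_conj_empty[OF k(1)])
  show "y \<in> cl (CARD('n) - 1)"
    using torus_cl[of "CARD('n) - 1", where 'n = 'n] assms(1) by (auto simp: torus_conj_def)
qed

context flat_spin_bundle
begin

lemma cosets_iff: "c \<in> cosets \<Gamma> \<longleftrightarrow> (\<exists>a\<in>\<Gamma>. c = {transl l \<circ> a | l. l \<in> \<Lambda>})"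
  unfolding cosets_def RCOSETS_def r_coset_def
  by (auto simp: isom_def)

lemma coset_elem: "c \<in> cosets \<Gamma> \<Longrightarrow> \<gamma> \<in> c \<Longrightarrow> \<gamma> \<in> \<Gamma>"
  by (auto simp: cosets_iff transl_in intro: comp_in)

lemma coset_rot: "c \<in> cosets \<Gamma> \<Longrightarrow> \<gamma> \<in> c \<Longrightarrow> \<gamma>' \<in> c \<Longrightarrow> rot \<gamma> = rot \<gamma>'"
  by (auto simp: cosets_iff rot_comp in_isom transl_in_isom simp del: comp_apply)

lemma rep_bij:
  assumes rep: "\<forall>c\<in>cosets \<Gamma>. rep c \<in> c"
  shows "bij_betw (\<lambda>c. rot (rep c)) (cosets \<Gamma>) F"
proof (rule bij_betw_imageI)
  show "inj_on (\<lambda>c. rot (rep c)) (cosets \<Gamma>)"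
  proof (rule inj_onI)
    fix c c' assume c: "c \<in> cosets \<Gamma>" "c' \<in> cosets \<Gamma>" "rot (rep c) = rot (rep c')"
    obtain a a' where a: "a \<in> \<Gamma>" "c = {transl l \<circ> a | l. l \<in> \<Lambda>}" "a' \<in> \<Gamma>" "c' = {transl l \<circ> a' | l. l \<in> \<Lambda>}"
      using c(1,2) by (auto simp: cosets_iff)
    have "a \<in> c" "a' \<in> c'" using a Lambda_closed(1) by (auto simp: transl_0 intro!: exI[of _ 0])
    then have "rot a = rot (rep c)" "rot a' = rot (rep c')"
      using coset_rot[OF c(1)] coset_rot[OF c(2)] rep c(1,2) by blast+
    then have "rot a = rot a'" using c(3) by simp
    then obtain k where k: "k \<in> \<Lambda>" "a' = transl k \<circ> a" by (rule same_rot[OF a(1,3)])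
    have "transl l \<circ> a = transl (l - k) \<circ> a'" "transl l \<circ> a' = transl (l + k) \<circ> a" for l
      by (simp_all add: k(2) transl_comp flip: comp_assoc)
    moreover have "l - k \<in> \<Lambda>" "l + k \<in> \<Lambda>" if "l \<in> \<Lambda>" for l
      using Lambda_closed(2)[OF that Lambda_closed(3)[OF k(1)]] Lambda_closed(2)[OF that k(1)] by simp_all
    ultimately show "c = c'" unfolding a by (auto intro: exI[of _ "_ - k"] exI[of _ "_ + k"])
  qed
  show "(\<lambda>c. rot (rep c)) ` cosets \<Gamma> = F"
  proof
    show "(\<lambda>c. rot (rep c)) ` cosets \<Gamma> \<subseteq> F" using rep coset_elem by (auto simp: holonomy_def)
    show "F \<subseteq> (\<lambda>c. rot (rep c)) ` cosets \<Gamma>"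
    proof
      fix B assume "B \<in> F"
      then obtain a where a: "a \<in> \<Gamma>" "B = rot a" by (auto simp: holonomy_def)
      let ?c = "{transl l \<circ> a | l. l \<in> \<Lambda>}"
      have c: "?c \<in> cosets \<Gamma>" using a(1) by (auto simp: cosets_iff)
      have "a \<in> ?c" using Lambda_closed(1) by (auto simp: transl_0 intro!: exI[of _ 0])
      then have "B = rot (rep ?c)" unfolding a(2) by (rule coset_rot[OF c _ bspec[OF rep c]])
      then show "B \<in> (\<lambda>c. rot (rep c)) ` cosets \<Gamma>" using c by blast
    qed
  qed
qed

text \<open>The contribution of \<gamma> to the trace of the averaging projection. Neither
  x_\<gamma> nor h_u occurs in it, and by \<open>T_cong\<close> it is constant on cosets.\<close>

definition T :: "('n rvec \<Rightarrow> complex ^ ('s \<times> 'v) ^ ('s \<times> 'v)) \<Rightarrow> real \<Rightarrow> 'n isometry \<Rightarrow> complex" where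
  "T Q m \<gamma> = (\<Sum>u\<in>dual_fix \<Gamma> \<epsilon> m \<gamma>. expi (- u) (\<gamma> 0) * trace (kap \<gamma> ** Q u))"

lemma multiplicity_cosets:
  assumes r: "\<bar>r\<bar> = 2 * pi * m"
    and Q: "\<And>u. u \<in> U m \<Longrightarrow> Q u ** Q u = Q u"
    and QM: "\<And>u w. u \<in> U m \<Longrightarrow> (2 * of_real pi * \<i>) *s (M u *v w) = of_real r *s w \<longleftrightarrow> Q u *v w = w"
    and Qk: "\<And>\<gamma> u. \<gamma> \<in> \<Gamma> \<Longrightarrow> u \<in> U m \<Longrightarrow> kap \<gamma> ** Q u = Q (rot \<gamma> *v u) ** kap \<gamma>"
    and rep: "\<forall>c\<in>cosets \<Gamma>. rep c \<in> c"
  shows "\<exists>d. eigenvalue_mult \<Gamma> \<epsilon> \<rho> L r d \<and> of_nat d = 1 / of_nat (card F) * (\<Sum>c\<in>cosets \<Gamma>. T Q m (rep c))"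
proof -
  note bij = rep_bij[OF rep]
  \<comment> \<open>Picks for B the given representative of the coset with rotational part B, so
    that the sum over F becomes the sum over cosets of the statement.\<close>
  define g where "g B = rep (inv_into (cosets \<Gamma>) (\<lambda>c. rot (rep c)) B)" for B
  have g: "g B \<in> \<Gamma> \<and> rot (g B) = B" if "B \<in> F" for B
    using that bij_betw_inv_into_right[OF bij that] rep
      coset_elem[OF bij_betwE[OF bij_betw_inv_into[OF bij], rule_format, OF that]]
      bij_betwE[OF bij_betw_inv_into[OF bij], rule_format, OF that]
    by (auto simp: g_def)
  have grep: "g (rot (rep c)) = rep c" if "c \<in> cosets \<Gamma>" for c
    using bij_betw_inv_into_left[OF bij that] by (simp add: g_def)
  obtain d where d: "eigenvalue_mult \<Gamma> \<epsilon> \<rho> L r d"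
    "of_nat d = 1 / of_nat (card F) *
      (\<Sum>B\<in>F. \<Sum>u | u \<in> U m \<and> B *v u = u. expi (- u) (g B 0) * trace (kap (g B) ** Q u))"
    using multiplicity_formula[OF r Q QM Qk g] by blast
  have "(\<Sum>B\<in>F. \<Sum>u | u \<in> U m \<and> B *v u = u. expi (- u) (g B 0) * trace (kap (g B) ** Q u))
      = (\<Sum>c\<in>cosets \<Gamma>. T Q m (rep c))"
    unfolding sum.reindex_bij_betw[OF bij, symmetric] by (intro sum.cong refl) (simp add: grep T_def dual_fix_def)
  then show ?thesis using d by auto
qed

section \<open>Eigenprojections and the summands of the formulas\<close>

lemma M_matrix_sq: "M u ** M u = smat (- of_real (u \<bullet> u)) (mat 1)"
  by (simp add: matrix_eq smat_vector M_sq flip: matrix_vector_mul_assoc)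

lemma matrix_mult_add_left: "(A + B) ** C = A ** C + (B ** C :: complex ^ 'k ^ 'l)"
  by (simp add: matrix_matrix_mult_def vec_eq_iff distrib_right sum.distrib)

lemma kap_half_proj: "\<gamma> \<in> \<Gamma> \<Longrightarrow> kap \<gamma> ** half_proj z (M u) = half_proj z (M (rot \<gamma> *v u)) ** kap \<gamma>"
  by (simp add: half_proj_def smat_mult_left smat_mult_right matrix_add_ldistrib matrix_mult_add_left kap_M)

text \<open>Since s^2 = 1, 2 pi i = 2 pi s m (i s / m); so Clifford multiplication by u has the
  eigenvalue belonging to 2 pi s m exactly where (i s / m) u acts as 1.\<close>

definition eigen_proj :: "real \<Rightarrow> real \<Rightarrow> 'n rvec \<Rightarrow> complex ^ ('s \<times> 'v) ^ ('s \<times> 'v)" where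
  "eigen_proj s m u = half_proj (\<i> * of_real (s / m)) (M u)"

lemma multiplicity_pos:
  assumes "m > 0" "s = 1 \<or> s = - 1" "\<forall>c\<in>cosets \<Gamma>. rep c \<in> c"
  shows "\<exists>d. eigenvalue_mult \<Gamma> \<epsilon> \<rho> L (s * (2 * pi * m)) d \<and>
    of_nat d = 1 / of_nat (card F) * (\<Sum>c\<in>cosets \<Gamma>. T (eigen_proj s m) m (rep c))"
proof (rule multiplicity_cosets[OF _ _ _ _ assms(3)])
  let ?z = "\<i> * complex_of_real (s / m)"
  have ss: "s * s = 1" using assms(2) by auto
  show "\<bar>s * (2 * pi * m)\<bar> = 2 * pi * m" using assms by (auto simp: abs_mult)
  show "eigen_proj s m u ** eigen_proj s m u = eigen_proj s m u" if "u \<in> U m" for u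
    unfolding eigen_proj_def
  proof (rule half_proj_idem)
    have "u \<bullet> u = m * m" using that by (simp add: dual_set_iff dot_square_norm power2_eq_square)
    moreover have "?z * ?z * - of_real (m * m) = of_real (s * s)"
      using assms(1) by (simp add: field_simps)
    ultimately show "smat (?z * ?z) (M u ** M u) = mat 1"
      by (simp only: M_matrix_sq smat_smat ss) simp
  qed
  show "(2 * of_real pi * \<i>) *s (M u *v w) = of_real (s * (2 * pi * m)) *s w \<longleftrightarrow> eigen_proj s m u *v w = w" for u w
  proof -
    have "of_real (s * (2 * pi * m)) * ?z = of_real (s * s) * (2 * of_real pi * \<i>)"
      using assms(1) by (simp add: field_simps)
    then have "2 * of_real pi * \<i> = of_real (s * (2 * pi * m)) * ?z" by (simp only: ss) simp
    then have "(2 * of_real pi * \<i>) *s (M u *v w) = of_real (s * (2 * pi * m)) *s (?z *s (M u *v w))"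
      by (simp only: vector_smult_assoc)
    moreover have "s * (2 * pi * m) \<noteq> 0" using assms by auto
    ultimately show ?thesis
      unfolding eigen_proj_def half_proj_eq_iff by (simp only: vec.scale_cancel_left of_real_eq_0_iff simp_thms)
  qed
  show "kap \<gamma> ** eigen_proj s m u = eigen_proj s m (rot \<gamma> *v u) ** kap \<gamma>" if "\<gamma> \<in> \<Gamma>" for \<gamma> u
    unfolding eigen_proj_def by (rule kap_half_proj[OF that])
qed

text \<open>Translating by l multiplies both the phase and the matrix by \<delta>(l), and these
  signs cancel.\<close>

lemma T_cong:
  assumes "\<gamma> \<in> \<Gamma>" "\<gamma>' \<in> \<Gamma>" "rot \<gamma> = rot \<gamma>'"
  shows "T Q m \<gamma>' = T Q m \<gamma>"
proof -
  obtain l where l: "l \<in> \<Lambda>" "\<gamma>' = transl l \<circ> \<gamma>" by (rule same_rot[OF assms])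
  have t: "transl l \<in> \<Gamma>" using l(1) by (simp add: transl_in)
  have k: "kap \<gamma>' = smat (of_real (delta \<epsilon> l)) (kap \<gamma>)"
    unfolding l(2) by (simp add: kap_comp[OF t assms(1)] kap_transl[OF l(1)] smat_mult_left del: comp_apply)
  have "\<gamma>' 0 = \<gamma> 0 + l" by (simp add: l(2) transl_def)
  then have "expi (- u) (\<gamma>' 0) * trace (kap \<gamma>' ** Q u)
      = of_real (delta \<epsilon> l * delta \<epsilon> l) * (expi (- u) (\<gamma> 0) * trace (kap \<gamma> ** Q u))" if "u \<in> U m" for u
    using that by (simp add: k smat_mult_left trace_smat expi_add expi_dual l(1))
  then have "expi (- u) (\<gamma>' 0) * trace (kap \<gamma>' ** Q u) = expi (- u) (\<gamma> 0) * trace (kap \<gamma> ** Q u)" if "u \<in> U m" for u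
    using that by (simp add: delta_sq[OF l(1)])
  then show ?thesis
    unfolding T_def dual_fix_def assms(3) by (intro sum.cong refl) simp
qed

text \<open>Reconciles the b of the statement with \<gamma> 0 = Bb: they have the same inner product
  with a vector fixed by B.\<close>

lemma exp_tvec:
  assumes "\<gamma> \<in> \<Gamma>" "u \<in> dual_fix \<Gamma> \<epsilon> m \<gamma>"
  shows "exp (- 2 * of_real pi * \<i> * of_real (u \<bullet> tvec \<gamma>)) = expi (- u) (\<gamma> 0)"
proof -
  have "rot \<gamma> *v u = u" using assms(2) by (simp add: dual_fix_def)
  then have "transpose (rot \<gamma>) *v u = u" using orthogonal_rot[OF assms(1)] by (metis orthogonal_matrix_cancel(1))
  then have "u \<bullet> \<gamma> 0 = u \<bullet> tvec \<gamma>"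
    using isom_apply(3)[OF in_isom[OF assms(1)]] by (simp add: inner_transpose)
  then show ?thesis by (simp add: expi_def cis_conv_exp mult_ac)
qed

lemma trace_kap: "trace (kap \<gamma>) = trace (\<rho> \<gamma>) * chi L (\<epsilon> \<gamma>)"
  by (simp add: kap_def trace_kron chi_def)

lemma trace_eigen_proj: "trace (kap \<gamma> ** eigen_proj s m u)
    = trace (\<rho> \<gamma>) * (chi L (\<epsilon> \<gamma>) + \<i> * of_real (s / m) * chi L (\<epsilon> \<gamma> * cvec u)) / 2"
proof -
  have "kap \<gamma> ** M u = kron (L (\<epsilon> \<gamma> * cvec u)) (\<rho> \<gamma>)"
    by (simp add: kap_def M_def kron_mult L_mult_all)
  then have "trace (kap \<gamma> ** M u) = trace (\<rho> \<gamma>) * chi L (\<epsilon> \<gamma> * cvec u)"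
    by (simp add: trace_kron chi_def)
  then show ?thesis by (simp add: eigen_proj_def trace_half_proj trace_kap algebra_simps)
qed

lemma parity_eps_cvec: "\<gamma> \<in> \<Gamma> \<Longrightarrow> parity False (\<epsilon> \<gamma> * cvec u)"
  using parity_mult[OF parity_spin[OF eps_spin] parity_cvec] by simp

text \<open>For even \<open>n\<close> the element \<open>\<epsilon>(\<gamma>)u\<close> is odd and has trace \<open>0\<close>.\<close>
lemma term_even_eq_T:
  fixes L' :: "'n cliff \<Rightarrow> complex ^ 't ^ 't"
  assumes "even CARD('n)" "spin_rep CARD('n) L" "spin_rep (CARD('n) - 1) L'"
    and g: "\<gamma> \<in> \<Gamma>" and y: "torus_conj \<epsilon> \<gamma> y"
  shows "term_even \<Gamma> \<epsilon> \<rho> L' m \<gamma> y = T (eigen_proj s m) m \<gamma>"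
proof -
  interpret L': clifford_rep "CARD('n) - 1" L'
    using assms(3) by unfold_locales (simp_all add: spin_rep_def)
  note yf = torus_conj_facts[OF y eps_spin[OF g]]
  obtain k where k: "CARD('n) = 2 * Suc k"
  proof -
    have "0 < CARD('n)" by simp
    then show ?thesis using assms(1) that by (metis evenE gr0_implies_Suc mult_0_right not_gr_zero)
  qed
  \<comment> \<open>For even n the dimension halves from S_n to S_(n-1), which accounts for the 1/2
    in the eigenprojection.\<close>
  have "CARD('s) = 2 ^ Suc k" "CARD('t) = 2 ^ k"
    using assms(2,3) by (simp_all add: spin_rep_def k)
  then have "chi L (\<epsilon> \<gamma>) / 2 = chi L' y"
    using chi_even[of "\<epsilon> \<gamma>"] L'.chi_even[OF yf(2,3)] parity_spin[OF eps_spin[OF g]] yf(4) by (simp add: cl_top)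
  moreover have "chi L (\<epsilon> \<gamma> * cvec u) = 0" for u
    by (rule chi_odd_even_dim[OF _ parity_eps_cvec[OF g] assms(1)]) (simp add: cl_top)
  ultimately have "trace (kap \<gamma> ** eigen_proj s m u) = trace (\<rho> \<gamma>) * chi L' y" for u
    by (simp add: trace_eigen_proj)
  moreover have "e_sum \<Gamma> \<epsilon> m \<gamma> = (\<Sum>u\<in>dual_fix \<Gamma> \<epsilon> m \<gamma>. expi (- u) (\<gamma> 0))"
    unfolding e_sum_def by (rule sum.cong[OF refl exp_tvec[OF g]])
  ultimately show ?thesis by (simp add: term_even_def T_def sum_distrib_left sum_distrib_right mult_ac)
qed

text \<open>Let a be the coordinate of x_\<gamma> at e_1 ... e_(n-1). The top coordinate of
  \<epsilon>(\<gamma>) u is m \<sigma> a, so the odd trace supplies the volume term of the half-spin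
  character of sign s \<sigma>. If B fixes more than a line, a vanishes and both half-spin
  characters agree.\<close>

lemma odd_trace:
  fixes L' :: "'n cliff \<Rightarrow> complex ^ 't ^ 't"
  assumes n: "CARD('n) \<ge> 2" "odd CARD('n)" and L: "spin_rep CARD('n) L" "spin_rep (CARD('n) - 1) L'"
    and g: "\<gamma> \<in> \<Gamma>" and y: "torus_conj \<epsilon> \<gamma> y" and m: "m > 0" and s: "s = 1 \<or> s = - 1"
    and u: "u \<in> dual_fix \<Gamma> \<epsilon> m \<gamma>"
  shows "trace (kap \<gamma> ** eigen_proj s m u)
      = trace (\<rho> \<gamma>) * chi_half (CARD('n) - 1) (s * sigma \<epsilon> \<gamma> u y) L' y"
    and "rot \<gamma> \<notin> F1 \<Gamma> \<Longrightarrow> chi_half (CARD('n) - 1) (s * sigma \<epsilon> \<gamma> u y) L' y = chi_half (CARD('n) - 1) s L' y"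
proof -
  interpret L': clifford_rep "CARD('n) - 1" L'
    using L(2) by unfold_locales (simp_all add: spin_rep_def)
  define e where "e = (eb CARD('n) :: 'n rvec)"
  define q where "q = CARD('n) div 2"
  have q: "(CARD('n) - 1) div 2 = q" "even (CARD('n) - 1)" using n(2) by (auto elim!: oddE simp: q_def)
  have cards: "CARD('s) = CARD('t)" using L q(1) by (simp add: spin_rep_def q_def)
  have gs: "\<epsilon> \<gamma> \<in> spin" by (rule eps_spin[OF g])
  note yf = torus_conj_facts[OF y gs]
  have nu: "norm u = m" "rot \<gamma> *v u = u" using u by (simp_all add: dual_fix_def dual_set_def)
  then have u0: "u \<noteq> 0" using m by auto
  have gu: "\<epsilon> \<gamma> * cvec u = cvec u * \<epsilon> \<gamma>" using eps_fix_iff[OF g] nu(2) by blast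
  have ye: "y * cvec e = cvec e * y"
    unfolding e_def eb_top cvec_axis
  proof (rule commute_cbasis)
    fix I assume I: "coord y I \<noteq> 0"
    then have "I \<subseteq> front (CARD('n) - 1)" "even (card I)"
      using yf(3) L'.cl_iff[of y] yf(2) unfolding parity_def by blast+
    then have "I \<inter> {top_index} = {}" using top_notin_front[where 'n = 'n] by auto
    then show "csgn I {top_index} = csgn {top_index} I"
      unfolding csgn_eq_iff csgn_mult_swap using \<open>even (card I)\<close> by simp
  qed
  define a where "a = coord (y * cvec e) UNIV"
  have aF: "a = coord y (front (CARD('n) - 1))" unfolding a_def e_def by (rule coord_top_front)
  define \<sigma> where "\<sigma> = sigma \<epsilon> \<gamma> u y"
  have \<sigma>: "\<sigma> = 1 \<or> \<sigma> = - 1" by (simp add: \<sigma>_def sigma_def)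
  have gua: "coord (\<epsilon> \<gamma> * cvec u) UNIV = m * (\<sigma> * a)"
    unfolding \<sigma>_def sigma_def a_def nu(1)[symmetric] e_def
    by (rule coord_top_sigma[OF n(2) gs gu _ ye[unfolded e_def] h_elt[OF n(1) u0]])
      (use y in \<open>simp add: torus_conj_def\<close>)
  have half: "chi_half (CARD('n) - 1) s' L' y = of_nat CARD('s) / 2 * (of_real (coord (\<epsilon> \<gamma>) {}) + of_real s' * \<i> ^ q * of_real a)"
    if "s' = 1 \<or> s' = - 1" for s'
    using L'.chi_half_even[OF q(2) yf(2,3) that] by (simp only: q(1) yf(4) aF cards)
  have s\<sigma>: "s * \<sigma> = 1 \<or> s * \<sigma> = - 1" using s \<sigma> by auto
  have "chi L (\<epsilon> \<gamma>) = of_nat CARD('s) * of_real (coord (\<epsilon> \<gamma>) {})"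
    by (rule chi_even) (simp_all add: cl_top parity_spin[OF gs])
  moreover have "chi L (\<epsilon> \<gamma> * cvec u) = of_real (m * (\<sigma> * a)) * (- (\<i> ^ (q + 1)) * of_nat CARD('s))"
    using chi_odd[OF _ parity_eps_cvec[OF g, of u]] chi_volume_odd[OF L(1) n(2)]
    by (simp add: cl_top front_top gua q_def)
  \<comment> \<open>The scalars combine by i (-i^(q + 1)) = i^q.\<close>
  ultimately have "chi L (\<epsilon> \<gamma>) + \<i> * of_real (s / m) * chi L (\<epsilon> \<gamma> * cvec u)
      = of_nat CARD('s) * (of_real (coord (\<epsilon> \<gamma>) {}) + of_real (s * \<sigma>) * \<i> ^ q * of_real a)"
    using m by (simp add: field_simps)
  then have "(chi L (\<epsilon> \<gamma>) + \<i> * of_real (s / m) * chi L (\<epsilon> \<gamma> * cvec u)) / 2 = chi_half (CARD('n) - 1) (s * \<sigma>) L' y"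
    unfolding half[OF s\<sigma>] by simp
  then show "trace (kap \<gamma> ** eigen_proj s m u)
      = trace (\<rho> \<gamma>) * chi_half (CARD('n) - 1) (s * sigma \<epsilon> \<gamma> u y) L' y"
    unfolding trace_eigen_proj \<sigma>_def by (metis times_divide_eq_right)
  assume F1: "rot \<gamma> \<notin> F1 \<Gamma>"
  define S where "S = {x. (rot \<gamma> - mat 1) *v x = 0}"
  have S: "x \<in> S \<longleftrightarrow> rot \<gamma> *v x = x" for x
    by (simp add: S_def matrix_vector_mult_diff_rdistrib)
  have "dim S \<noteq> 1" using F1 g by (auto simp: F1_def S_def holonomy_def)
  \<comment> \<open>B fixes u, so a fixed space of dimension other than 1 contains a nonzero vector
    orthogonal to u.\<close>
  have "\<exists>v\<in>S. v \<noteq> 0 \<and> v \<bullet> u = 0"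
  proof (rule ccontr)
    assume no: "\<not> (\<exists>v\<in>S. v \<noteq> 0 \<and> v \<bullet> u = 0)"
    have "S = span {u}"
    proof
      show "span {u} \<subseteq> S"
        using nu(2) by (auto simp: span_singleton S matrix_vector_mult_scaleR)
      show "S \<subseteq> span {u}"
      proof
        fix x assume x: "x \<in> S"
        let ?v = "x - ((x \<bullet> u) / (u \<bullet> u)) *\<^sub>R u"
        have "?v \<in> S" using x nu(2) by (simp add: S matrix_vector_mult_diff_distrib matrix_vector_mult_scaleR)
        moreover have "?v \<bullet> u = 0" using u0 by (simp add: inner_diff_left)
        ultimately have "?v = 0" using no by blast
        then show "x \<in> span {u}" by (auto simp: span_singleton)
      qed
    qed
    then show False using \<open>dim S \<noteq> 1\<close> u0 by simp
  qed
  then obtain v where v: "rot \<gamma> *v v = v" "v \<noteq> 0" "v \<bullet> u = 0" using S by blast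
  have "\<epsilon> \<gamma> * cvec v = cvec v * \<epsilon> \<gamma>" using eps_fix_iff[OF g] v(1) by blast
  from coord_top_orthogonal[OF n(2) v(2,3) this] have "m * (\<sigma> * a) = 0" by (simp only: gua)
  then have "a = 0" using m \<sigma> by auto
  then show "chi_half (CARD('n) - 1) (s * sigma \<epsilon> \<gamma> u y) L' y = chi_half (CARD('n) - 1) s L' y"
    unfolding \<sigma>_def[symmetric] half[OF s] half[OF s\<sigma>] by simp
qed

lemma term_odd_eq_T:
  fixes L' :: "'n cliff \<Rightarrow> complex ^ 't ^ 't"
  assumes n: "CARD('n) \<ge> 2" "odd CARD('n)" and L: "spin_rep CARD('n) L" "spin_rep (CARD('n) - 1) L'"
    and g: "\<gamma> \<in> \<Gamma>" and y: "torus_conj \<epsilon> \<gamma> y" and m: "m > 0" and s: "s = 1 \<or> s = - 1"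
  shows "term_F1 \<Gamma> \<epsilon> \<rho> L' s m \<gamma> y = T (eigen_proj s m) m \<gamma>"
    and "rot \<gamma> \<notin> F1 \<Gamma> \<Longrightarrow> term_gen \<Gamma> \<epsilon> \<rho> L' s m \<gamma> y = T (eigen_proj s m) m \<gamma>"
proof -
  note tr = odd_trace[OF n L g y m s]
  have "T (eigen_proj s m) m \<gamma> = (\<Sum>u\<in>dual_fix \<Gamma> \<epsilon> m \<gamma>. expi (- u) (\<gamma> 0) *
      (trace (\<rho> \<gamma>) * chi_half (CARD('n) - 1) (s * sigma \<epsilon> \<gamma> u y) L' y))"
    unfolding T_def by (intro sum.cong refl) (simp only: tr(1))
  also have "\<dots> = term_F1 \<Gamma> \<epsilon> \<rho> L' s m \<gamma> y"
    unfolding term_F1_def sum_distrib_left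
  proof (rule sum.cong[OF refl])
    fix u assume "u \<in> dual_fix \<Gamma> \<epsilon> m \<gamma>"
    from exp_tvec[OF g this]
    show "expi (- u) (\<gamma> 0) * (trace (\<rho> \<gamma>) * chi_half (CARD('n) - 1) (s * sigma \<epsilon> \<gamma> u y) L' y)
        = trace (\<rho> \<gamma>) * (exp (- 2 * of_real pi * \<i> * of_real (u \<bullet> tvec \<gamma>)) *
          chi_half (CARD('n) - 1) (s * sigma \<epsilon> \<gamma> u y) L' y)"
      by (simp only: mult.left_commute)
  qed
  finally show F: "term_F1 \<Gamma> \<epsilon> \<rho> L' s m \<gamma> y = T (eigen_proj s m) m \<gamma>" by simp
  assume F1: "rot \<gamma> \<notin> F1 \<Gamma>"
  have "term_F1 \<Gamma> \<epsilon> \<rho> L' s m \<gamma> y = term_gen \<Gamma> \<epsilon> \<rho> L' s m \<gamma> y"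
    unfolding term_F1_def term_gen_def e_sum_def mult.assoc sum_distrib_right
    by (intro arg_cong2[where f = "(*)"] sum.cong refl) (simp only: tr(2)[OF _ F1])
  then show "term_gen \<Gamma> \<epsilon> \<rho> L' s m \<gamma> y = T (eigen_proj s m) m \<gamma>" using F by simp
qed

section \<open>The kernel of the Dirac operator\<close>

lemma delta_eq_1_iff: "l \<in> \<Lambda> \<Longrightarrow> delta \<epsilon> l = 1 \<longleftrightarrow> \<epsilon> (transl l) = 1"
  using delta_pm(2)[of l] by simp

lemma dual_set_0: "U 0 = (if \<forall>l\<in>\<Lambda>. \<epsilon> (transl l) = 1 then {0} else {})"
proof -
  have "u \<in> U 0 \<longleftrightarrow> u = 0 \<and> (\<forall>l\<in>\<Lambda>. delta \<epsilon> l = 1)" for u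
    by (auto simp: dual_set_iff)
  then show ?thesis by (auto simp: delta_eq_1_iff)
qed

lemma M_0: "M 0 *v w = 0"
  by (subst M_linear) simp

text \<open>For m = 0 only u = 0 can occur, and Clifford multiplication by 0 imposes no condition;
  the identity is the fibrewise projection.\<close>

lemma multiplicity_0:
  assumes "\<forall>c\<in>cosets \<Gamma>. rep c \<in> c"
  shows "\<exists>d. eigenvalue_mult \<Gamma> \<epsilon> \<rho> L 0 d \<and>
    of_nat d = 1 / of_nat (card F) * (\<Sum>c\<in>cosets \<Gamma>. T (\<lambda>u. mat 1) 0 (rep c))"
proof (rule multiplicity_cosets[OF _ _ _ _ assms])
  show "(2 * of_real pi * \<i>) *s (M u *v w) = of_real 0 *s w \<longleftrightarrow> mat 1 *v w = w" if "u \<in> U 0" for u w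
  proof -
    have "u = 0" using that by (simp add: dual_set_iff)
    then show ?thesis by (simp add: M_0)
  qed
qed simp_all

text \<open>With u = 0 as the only frequency, harmonic spinors are constant, and equivariance of a
  constant is invariance.\<close>

lemma eigenspace_0:
  assumes "\<forall>l\<in>\<Lambda>. \<epsilon> (transl l) = 1"
  shows "eigenspace \<Gamma> \<epsilon> \<rho> L 0 = (\<lambda>w x. w) ` invariants \<Gamma> \<epsilon> \<rho> L"
proof -
  have U0: "U 0 = {0}" using assms by (simp add: dual_set_0)
  have s: "synth (U 0) c = (\<lambda>x. c 0)" for c :: "'n rvec \<Rightarrow> complex ^ ('s \<times> 'v)"
    by (auto simp: synth_def U0)
  have inv: "w \<in> invariants \<Gamma> \<epsilon> \<rho> L \<longleftrightarrow> (\<forall>\<gamma>\<in>\<Gamma>. kap \<gamma> *v w = w)" for w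
    by (simp add: invariants_def kap_def)
  have K0: "K 0 \<gamma> c 0 = kap \<gamma> *v c 0" for \<gamma> c by (simp add: K_def U0)
  have c0: "c 0 \<in> invariants \<Gamma> \<epsilon> \<rho> L" if c: "c \<in> coeff_space 0 0" for c
    unfolding inv
  proof
    fix \<gamma> assume "\<gamma> \<in> \<Gamma>"
    then have "K 0 \<gamma> c = c" using c by (simp add: coeff_space_def)
    then show "kap \<gamma> *v c 0 = c 0" using K0[of \<gamma> c] by simp
  qed
  have c1: "(\<lambda>u. if u = 0 then w else 0) \<in> coeff_space 0 0" if w: "w \<in> invariants \<Gamma> \<epsilon> \<rho> L" for w
  proof -
    have "K 0 \<gamma> (\<lambda>u. if u = 0 then w else 0) = (\<lambda>u. if u = 0 then w else 0)" if "\<gamma> \<in> \<Gamma>" for \<gamma>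
      using w that by (auto simp: inv K_def U0)
    then show ?thesis by (simp add: coeff_space_def U0 M_0)
  qed
  have "eigenspace \<Gamma> \<epsilon> \<rho> L 0 = synth (U 0) ` coeff_space 0 0"
    by (rule eigenspace_eq_synth) simp
  also have "\<dots> = (\<lambda>w x. w) ` invariants \<Gamma> \<epsilon> \<rho> L"
  proof
    show "synth (U 0) ` coeff_space 0 0 \<subseteq> (\<lambda>w x. w) ` invariants \<Gamma> \<epsilon> \<rho> L"
      using c0 by (auto simp: s)
    show "(\<lambda>w x. w) ` invariants \<Gamma> \<epsilon> \<rho> L \<subseteq> synth (U 0) ` coeff_space 0 0"
    proof
      fix f assume "f \<in> (\<lambda>w (x :: 'n rvec). w) ` invariants \<Gamma> \<epsilon> \<rho> L"
      then obtain w where "w \<in> invariants \<Gamma> \<epsilon> \<rho> L" "f = (\<lambda>x. w)" by blast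
      then show "f \<in> synth (U 0) ` coeff_space 0 0"
        by (intro image_eqI[OF _ c1[of w]]) (simp_all add: s)
    qed
  qed
  finally show ?thesis .
qed

text \<open>\<open>eigenvalue_mult\<close> asserts some basis of size d. A basis of the invariants,
  read as constant functions, is another basis of the same space.\<close>

lemma dim_invariants:
  assumes triv: "\<forall>l\<in>\<Lambda>. \<epsilon> (transl l) = 1" and d: "eigenvalue_mult \<Gamma> \<epsilon> \<rho> L 0 d"
  shows "d = vec.dim (invariants \<Gamma> \<epsilon> \<rho> L)"
proof -
  define C where "C = (\<lambda>w (x :: 'n rvec). w :: complex ^ ('s \<times> 'v))"
  interpret vector_space_pair "(*s) :: complex \<Rightarrow> complex ^ ('s \<times> 'v) \<Rightarrow> _"
    "cfun_scale :: complex \<Rightarrow> ('n rvec \<Rightarrow> complex ^ ('s \<times> 'v)) \<Rightarrow> _" by unfold_locales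
  have lin: "Vector_Spaces.linear (*s) cfun_scale C"
    by unfold_locales (simp_all add: C_def fun_eq_iff)
  have inj: "inj_on C S" for S by (rule inj_onI) (metis C_def)
  obtain B where B: "B \<subseteq> invariants \<Gamma> \<epsilon> \<rho> L" "vec.independent B" "invariants \<Gamma> \<epsilon> \<rho> L \<subseteq> vec.span B"
    "card B = vec.dim (invariants \<Gamma> \<epsilon> \<rho> L)"
    using vec.basis_exists by blast
  have "vec.subspace (invariants \<Gamma> \<epsilon> \<rho> L)"
    by (simp add: vec.subspace_def invariants_def matrix_vector_right_distrib vector_scalar_commute)
  then have span: "vec.span B = invariants \<Gamma> \<epsilon> \<rho> L" using B by (simp add: vec.span_subspace)
  have ind: "cfun.independent (C ` B)"
    by (rule linear_independent_injective_image[OF lin B(2) inj])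
  have spanC: "cfun.span (C ` B) = eigenspace \<Gamma> \<epsilon> \<rho> L 0"
    by (simp only: linear_span_image[OF lin] span eigenspace_0[OF triv]) (simp only: C_def)
  obtain A where A: "cfun.independent A" "cfun.span A = eigenspace \<Gamma> \<epsilon> \<rho> L 0" "card A = d"
    using d by (auto simp: eigenvalue_mult_def)
  have "cfun.dim (eigenspace \<Gamma> \<epsilon> \<rho> L 0) = card A"
    unfolding A(2)[symmetric] cfun.dim_span by (rule cfun.dim_eq_card_independent[OF A(1)])
  moreover have "cfun.dim (eigenspace \<Gamma> \<epsilon> \<rho> L 0) = card (C ` B)"
    unfolding spanC[symmetric] cfun.dim_span by (rule cfun.dim_eq_card_independent[OF ind])
  ultimately show ?thesis using A(3) B(4) card_image[OF inj[of B]] by simp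
qed

end

theorem theorem2p5:
  fixes \<Gamma> :: "'n::{finite,linorder} isometry set"
    and \<epsilon> :: "'n isometry \<Rightarrow> 'n cliff"
    and \<rho> :: "'n isometry \<Rightarrow> complex ^ 'v ^ 'v"
    and L :: "'n cliff \<Rightarrow> complex ^ 's ^ 's"
    and L' :: "'n cliff \<Rightarrow> complex ^ 't ^ 't"
    and rep :: "'n isometry set \<Rightarrow> 'n isometry"
    and x :: "'n isometry \<Rightarrow> 'n cliff"
  assumes dim_ge_2: "CARD('n) \<ge> 2"
    and Gamma: "bieberbach \<Gamma>" "orientable \<Gamma>"
    and eps: "spin_structure \<Gamma> \<epsilon>"
    and rho: "\<rho> \<in> hom (grp \<Gamma>) unitary_group" "\<forall>l\<in>transl_lattice \<Gamma>. \<rho> (transl l) = mat 1"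
    and L: "spin_rep CARD('n) L"
    and L': "spin_rep (CARD('n) - 1) L'"
    and rep: "\<forall>c\<in>cosets \<Gamma>. rep c \<in> c"
    and x: "\<forall>\<gamma>\<in>\<Gamma>. torus_conj \<epsilon> \<gamma> (x \<gamma>)"
  shows
    \<comment> \<open>(1)\<close>
    "(even CARD('n) \<longrightarrow> (\<forall>m>0. \<forall>s\<in>{1, -1}. \<exists>d.
        eigenvalue_mult \<Gamma> \<epsilon> \<rho> L (s * (2 * pi * m)) d \<and>
        of_nat d = 1 / of_nat (card (holonomy \<Gamma>)) *
          (\<Sum>c\<in>cosets \<Gamma>. term_even \<Gamma> \<epsilon> \<rho> L' m (rep c) (x (rep c)))))
   \<and> \<comment> \<open>(2)\<close>
     (odd CARD('n) \<longrightarrow> (\<forall>m>0. \<forall>s\<in>{1, -1}. \<exists>d.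
        eigenvalue_mult \<Gamma> \<epsilon> \<rho> L (s * (2 * pi * m)) d \<and>
        of_nat d = 1 / of_nat (card (holonomy \<Gamma>)) *
          ((\<Sum>c | c \<in> cosets \<Gamma> \<and> rot (rep c) \<notin> F1 \<Gamma>. term_gen \<Gamma> \<epsilon> \<rho> L' s m (rep c) (x (rep c)))
         + (\<Sum>c | c \<in> cosets \<Gamma> \<and> rot (rep c) \<in> F1 \<Gamma>. term_F1 \<Gamma> \<epsilon> \<rho> L' s m (rep c) (x (rep c))))))
   \<and> \<comment> \<open>(3)\<close>
     (\<not> (\<forall>l\<in>transl_lattice \<Gamma>. \<epsilon> (transl l) = 1) \<longrightarrow> eigenvalue_mult \<Gamma> \<epsilon> \<rho> L 0 0)
   \<and> ((\<forall>l\<in>transl_lattice \<Gamma>. \<epsilon> (transl l) = 1) \<longrightarrow> (\<exists>d.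
        eigenvalue_mult \<Gamma> \<epsilon> \<rho> L 0 d \<and>
        of_nat d = 1 / of_nat (card (holonomy \<Gamma>)) *
          (\<Sum>c\<in>cosets \<Gamma>. trace (\<rho> (rep c)) * chi L (\<epsilon> (rep c))) \<and>
        d = vec.dim (invariants \<Gamma> \<epsilon> \<rho> L)))
   \<and> \<comment> \<open>independence of the representative and of the torus element\<close>
     (even CARD('n) \<longrightarrow> (\<forall>m>0. \<forall>c\<in>cosets \<Gamma>. \<forall>\<gamma>\<in>c. \<forall>\<gamma>'\<in>c. \<forall>y y'.
        torus_conj \<epsilon> \<gamma> y \<longrightarrow> torus_conj \<epsilon> \<gamma>' y' \<longrightarrow>
        term_even \<Gamma> \<epsilon> \<rho> L' m \<gamma> y = term_even \<Gamma> \<epsilon> \<rho> L' m \<gamma>' y'))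
   \<and> (odd CARD('n) \<longrightarrow> (\<forall>m>0. \<forall>s\<in>{1, -1}. \<forall>c\<in>cosets \<Gamma>. \<forall>\<gamma>\<in>c. \<forall>\<gamma>'\<in>c. \<forall>y y'.
        torus_conj \<epsilon> \<gamma> y \<longrightarrow> torus_conj \<epsilon> \<gamma>' y' \<longrightarrow>
        (if rot \<gamma> \<in> F1 \<Gamma> then term_F1 \<Gamma> \<epsilon> \<rho> L' s m \<gamma> y else term_gen \<Gamma> \<epsilon> \<rho> L' s m \<gamma> y)
      = (if rot \<gamma>' \<in> F1 \<Gamma> then term_F1 \<Gamma> \<epsilon> \<rho> L' s m \<gamma>' y' else term_gen \<Gamma> \<epsilon> \<rho> L' s m \<gamma>' y')))"
proof -
  note n = dim_ge_2 and spin_L = L and spin_L' = L' and reps = rep and tori = x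
  have "cl_rep CARD('n) L" using L by (simp add: spin_rep_def)
  then interpret flat_spin_bundle \<Gamma> \<epsilon> \<rho> L
    using Gamma(1) eps rho by unfold_locales
  have repG: "rep c \<in> \<Gamma>" if "c \<in> cosets \<Gamma>" for c using reps coset_elem that by blast
  have xr: "torus_conj \<epsilon> (rep c) (x (rep c))" if "c \<in> cosets \<Gamma>" for c using tori repG[OF that] by blast
  have ev: "term_even \<Gamma> \<epsilon> \<rho> L' m \<gamma> y = T (eigen_proj s m) m \<gamma>"
    if "even CARD('n)" "\<gamma> \<in> \<Gamma>" "torus_conj \<epsilon> \<gamma> y" for \<gamma> y m s
    by (rule term_even_eq_T[OF that(1) spin_L spin_L' that(2,3)])
  have od: "(if rot \<gamma> \<in> F1 \<Gamma> then term_F1 \<Gamma> \<epsilon> \<rho> L' s m \<gamma> y else term_gen \<Gamma> \<epsilon> \<rho> L' s m \<gamma> y)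
      = T (eigen_proj s m) m \<gamma>"
    if "odd CARD('n)" "\<gamma> \<in> \<Gamma>" "torus_conj \<epsilon> \<gamma> y" "m > 0" "s \<in> {1, -1}" for \<gamma> y m s
    using term_odd_eq_T[OF n that(1) spin_L spin_L' that(2,3,4)] that(5) by auto
  have finC: "finite (cosets \<Gamma>)"
    using bij_betw_finite[OF rep_bij[OF reps]] finite_F by simp
  have 1: "\<exists>d. eigenvalue_mult \<Gamma> \<epsilon> \<rho> L (s * (2 * pi * m)) d \<and>
      of_nat d = 1 / of_nat (card F) * (\<Sum>c\<in>cosets \<Gamma>. term_even \<Gamma> \<epsilon> \<rho> L' m (rep c) (x (rep c)))"
    if "even CARD('n)" "m > 0" "s \<in> {1, -1}" for m s
  proof -
    have "(\<Sum>c\<in>cosets \<Gamma>. term_even \<Gamma> \<epsilon> \<rho> L' m (rep c) (x (rep c))) = (\<Sum>c\<in>cosets \<Gamma>. T (eigen_proj s m) m (rep c))"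
      by (intro sum.cong refl ev[OF that(1)] repG xr)
    then show ?thesis using multiplicity_pos[OF that(2) _ reps, of s] that(3) by auto
  qed
  have 2: "\<exists>d. eigenvalue_mult \<Gamma> \<epsilon> \<rho> L (s * (2 * pi * m)) d \<and>
      of_nat d = 1 / of_nat (card F) *
          ((\<Sum>c | c \<in> cosets \<Gamma> \<and> rot (rep c) \<notin> F1 \<Gamma>. term_gen \<Gamma> \<epsilon> \<rho> L' s m (rep c) (x (rep c)))
         + (\<Sum>c | c \<in> cosets \<Gamma> \<and> rot (rep c) \<in> F1 \<Gamma>. term_F1 \<Gamma> \<epsilon> \<rho> L' s m (rep c) (x (rep c))))"
    if "odd CARD('n)" "m > 0" "s \<in> {1, -1}" for m s
  proof -
    let ?t = "\<lambda>c. if rot (rep c) \<in> F1 \<Gamma> then term_F1 \<Gamma> \<epsilon> \<rho> L' s m (rep c) (x (rep c))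
      else term_gen \<Gamma> \<epsilon> \<rho> L' s m (rep c) (x (rep c))"
    have "(\<Sum>c\<in>cosets \<Gamma>. T (eigen_proj s m) m (rep c)) = (\<Sum>c\<in>cosets \<Gamma>. ?t c)"
      by (intro sum.cong refl od[OF that(1) _ _ that(2,3), symmetric] repG xr)
    also have "\<dots> = (\<Sum>c\<in>cosets \<Gamma> \<inter> {c. rot (rep c) \<in> F1 \<Gamma>}. term_F1 \<Gamma> \<epsilon> \<rho> L' s m (rep c) (x (rep c)))
        + (\<Sum>c\<in>cosets \<Gamma> \<inter> - {c. rot (rep c) \<in> F1 \<Gamma>}. term_gen \<Gamma> \<epsilon> \<rho> L' s m (rep c) (x (rep c)))"
      by (rule sum.If_cases[OF finC])
    also have "cosets \<Gamma> \<inter> {c. rot (rep c) \<in> F1 \<Gamma>} = {c. c \<in> cosets \<Gamma> \<and> rot (rep c) \<in> F1 \<Gamma>}" by auto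
    also have "cosets \<Gamma> \<inter> - {c. rot (rep c) \<in> F1 \<Gamma>} = {c. c \<in> cosets \<Gamma> \<and> rot (rep c) \<notin> F1 \<Gamma>}" by auto
    finally show ?thesis using multiplicity_pos[OF that(2) _ reps, of s] that(3) by (auto simp: add.commute)
  qed
  obtain d where d: "eigenvalue_mult \<Gamma> \<epsilon> \<rho> L 0 d"
    "of_nat d = 1 / of_nat (card F) * (\<Sum>c\<in>cosets \<Gamma>. T (\<lambda>u. mat 1) 0 (rep c))"
    using multiplicity_0[OF reps] by blast
  have 3: "eigenvalue_mult \<Gamma> \<epsilon> \<rho> L 0 0" if "\<not> (\<forall>l\<in>\<Lambda>. \<epsilon> (transl l) = 1)"
  proof -
    \<comment> \<open>No frequency is left, so the trace formula itself yields 0.\<close>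
    have "U 0 = {}" using that by (simp add: dual_set_0)
    then have "(of_nat d :: complex) = 0" using d(2) by (simp add: T_def dual_fix_def)
    then show ?thesis using d(1) by simp
  qed
  have 4: "\<exists>d. eigenvalue_mult \<Gamma> \<epsilon> \<rho> L 0 d \<and>
        of_nat d = 1 / of_nat (card F) * (\<Sum>c\<in>cosets \<Gamma>. trace (\<rho> (rep c)) * chi L (\<epsilon> (rep c))) \<and>
        d = vec.dim (invariants \<Gamma> \<epsilon> \<rho> L)" if triv: "\<forall>l\<in>\<Lambda>. \<epsilon> (transl l) = 1"
  proof -
    have U0: "U 0 = {0}" using triv by (simp add: dual_set_0)
    have "dual_fix \<Gamma> \<epsilon> 0 \<gamma> = {0}" for \<gamma> by (auto simp: dual_fix_def U0)
    then have "T (\<lambda>u. mat 1) 0 \<gamma> = trace (\<rho> \<gamma>) * chi L (\<epsilon> \<gamma>)" for \<gamma>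
      by (simp add: T_def trace_kap)
    then show ?thesis using d dim_invariants[OF triv d(1)] by auto
  qed
  have 5: "term_even \<Gamma> \<epsilon> \<rho> L' m \<gamma> y = term_even \<Gamma> \<epsilon> \<rho> L' m \<gamma>' y'"
    if "even CARD('n)" "c \<in> cosets \<Gamma>" "\<gamma> \<in> c" "\<gamma>' \<in> c" "torus_conj \<epsilon> \<gamma> y" "torus_conj \<epsilon> \<gamma>' y'" for m c \<gamma> \<gamma>' y y'
    \<comment> \<open>For even n the summand does not involve the sign of the eigenvalue; comparison
      with the projection for sign 1 is enough.\<close>
    using ev[OF that(1) coset_elem[OF that(2,3)] that(5), of m 1] ev[OF that(1) coset_elem[OF that(2,4)] that(6), of m 1]
      T_cong[OF coset_elem[OF that(2,3)] coset_elem[OF that(2,4)] coset_rot[OF that(2,3,4)]] by simp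
  have 6: "(if rot \<gamma> \<in> F1 \<Gamma> then term_F1 \<Gamma> \<epsilon> \<rho> L' s m \<gamma> y else term_gen \<Gamma> \<epsilon> \<rho> L' s m \<gamma> y)
      = (if rot \<gamma>' \<in> F1 \<Gamma> then term_F1 \<Gamma> \<epsilon> \<rho> L' s m \<gamma>' y' else term_gen \<Gamma> \<epsilon> \<rho> L' s m \<gamma>' y')"
    if "odd CARD('n)" "m > 0" "s \<in> {1, -1}" "c \<in> cosets \<Gamma>" "\<gamma> \<in> c" "\<gamma>' \<in> c" "torus_conj \<epsilon> \<gamma> y" "torus_conj \<epsilon> \<gamma>' y'"
    for m s c \<gamma> \<gamma>' y y'
    unfolding od[OF that(1) coset_elem[OF that(4,5)] that(7,2,3)] od[OF that(1) coset_elem[OF that(4,6)] that(8,2,3)]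
    by (rule T_cong[symmetric, OF coset_elem[OF that(4,5)] coset_elem[OF that(4,6)] coset_rot[OF that(4,5,6)]])
  show ?thesis
    by (intro conjI impI allI ballI) (fact 1 2 3 4 | rule 5 6; assumption)+
qed

end
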